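(* Fix $p\in[0,1]$. For a random graphon $V$, let $W_1,W_2$ be independent copies of $V$, let $U$ be uniform in $[0,1]$ and $S$ be a Bernoulli random variable of parameter $1-p$, with $U$ and $S$ independent from each other and from $(W_1,W_2)$, and let $W=W[V]$ be the random graphon $$W(x,y)=\begin{cases}W_1(x/U,\,y/U)&\text{if }x,y\le U;\\ W_2\big((x-U)/(1-U),\,(y-U)/(1-U)\big)&\text{if }x,y>U;\\ S&\text{if }x\le U<y\text{ or }y\le U<x.\end{cases}$$ If $V=\boldsymbol{W}^{\mathrm{rec}}_p$ is the recursive cographon of parameter $p$, then $W$ has the same law as $\boldsymbol{W}^{\mathrm{rec}}_p$. Moreover, the law of $\boldsymbol{W}^{\mathrm{rec}}_p$ is characterized by this property: if $V$ is a random graphon such that $W[V]$ has the same law as $V$, then $V$ has the same law as $\boldsymbol{W}^{\mathrm{rec}}_p$.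
   Context: A graphon is a measurable symmetric function $[0,1]^2\to[0,1]$, considered up to weak isomorphism (cut distance zero); the space of graphons carries the cut-distance topology, and laws of random graphons are laws on this space. Recursive cographon $\boldsymbol{W}^{\mathrm{rec}}_p$: let $(U_j)_{j\ge1}$ be i.i.d. uniform in $[0,1]$ and $(S_j)_{j\ge1}$ be i.i.d. signs in $\{\oplus,\ominus\}$ with $\mathbb P(S_j=\oplus)=p$, the two sequences being independent. For $x<y$ in $[0,1]$ let $j$ be the minimal index $j\ge 1$ such that $U_j\in(x,y]$; set $x\prec y$ if $S_j=\oplus$ and $y\prec x$ if $S_j=\ominus$ (almost surely $\prec$ is a total order on $[0,1]$). A representative of $\boldsymbol{W}^{\mathrm{rec}}_p$ is given, for $x<y$, by $\boldsymbol{W}^{\mathrm{rec}}_p(x,y)=\boldsymbol{W}^{\mathrm{rec}}_p(y,x)=0$ if $x\prec y$ and $=1$ if $y\prec x$. *)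

theory Defs
  imports "HOL-Probability.Probability"
begin

section \<open>Graphons and the cut distance\<close>

abbreviation unitM :: "real measure" where
  "unitM \<equiv> restrict_space lborel {0..1}"

text \<open>Only the values on the unit square matter; values elsewhere are ignored.\<close>

definition graphon_fun :: "(real \<Rightarrow> real \<Rightarrow> real) \<Rightarrow> bool" where
  "graphon_fun w \<longleftrightarrow>
     (\<lambda>(x, y). w x y) \<in> borel_measurable (unitM \<Otimes>\<^sub>M unitM) \<and>
     (\<forall>x\<in>{0..1}. \<forall>y\<in>{0..1}. w x y = w y x \<and> 0 \<le> w x y \<and> w x y \<le> 1)"

definition cut_norm :: "(real \<Rightarrow> real \<Rightarrow> real) \<Rightarrow> real" where
  "cut_norm k = (SUP (A, B) \<in> sets unitM \<times> sets unitM.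
     \<bar>LINT (x, y):A \<times> B|unitM \<Otimes>\<^sub>M unitM. k x y\<bar>)"

text \<open>Invertible measure-preserving maps: the inverse is required to be measurable too.\<close>

definition mp_bij :: "(real \<Rightarrow> real) \<Rightarrow> bool" where
  "mp_bij \<phi> \<longleftrightarrow>
     \<phi> \<in> unitM \<rightarrow>\<^sub>M unitM \<and> distr unitM unitM \<phi> = unitM \<and>
     bij_betw \<phi> {0..1} {0..1} \<and> the_inv_into {0..1} \<phi> \<in> unitM \<rightarrow>\<^sub>M unitM"

definition cut_dist :: "(real \<Rightarrow> real \<Rightarrow> real) \<Rightarrow> (real \<Rightarrow> real \<Rightarrow> real) \<Rightarrow> real" where
  "cut_dist w w' = (INF \<phi>\<in>{\<phi>. mp_bij \<phi>}. cut_norm (\<lambda>x y. w x y - w' (\<phi> x) (\<phi> y)))"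

definition weakly_isomorphic :: "(real \<Rightarrow> real \<Rightarrow> real) \<Rightarrow> (real \<Rightarrow> real \<Rightarrow> real) \<Rightarrow> bool" where
  "weakly_isomorphic w w' \<longleftrightarrow> graphon_fun w \<and> graphon_fun w' \<and> cut_dist w w' = 0"


subsection \<open>The cut distance is a pseudometric\<close>

definition kern :: "(real \<Rightarrow> real \<Rightarrow> real) \<Rightarrow> bool" where
  "kern k \<longleftrightarrow> (\<lambda>(x, y). k x y) \<in> borel_measurable (unitM \<Otimes>\<^sub>M unitM) \<and>
     (\<forall>x\<in>{0..1}. \<forall>y\<in>{0..1}. \<bar>k x y\<bar> \<le> 1)"

lemma space_unitM [simp]: "space unitM = {0..1}"
  by (simp add: space_restrict_space)

lemma prob_space_unitM: "prob_space unitM"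
  by (rule prob_space_restrict_space) auto

lemma prob_space_unitM2: "prob_space (unitM \<Otimes>\<^sub>M unitM)"
  by (intro prob_space_pair prob_space_unitM)

lemma integrable_kern:
  assumes "kern k" "A \<in> sets unitM" "B \<in> sets unitM"
  shows "set_integrable (unitM \<Otimes>\<^sub>M unitM) (A \<times> B) (\<lambda>(x, y). k x y)"
proof -
  interpret prob_space "unitM \<Otimes>\<^sub>M unitM" by (rule prob_space_unitM2)
  have "integrable (unitM \<Otimes>\<^sub>M unitM) (\<lambda>(x, y). k x y)"
    by (rule integrable_const_bound[where B = 1])
       (use assms(1) in \<open>auto simp: kern_def space_pair_measure\<close>)
  then show ?thesis
    unfolding set_integrable_def
    by (intro integrable_mult_indicator) (use assms in auto)
qed

lemma kern_integral_le_1: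
  assumes "kern k" "A \<in> sets unitM" "B \<in> sets unitM"
  shows "\<bar>LINT (x, y):A \<times> B|unitM \<Otimes>\<^sub>M unitM. k x y\<bar> \<le> 1"
proof -
  interpret prob_space "unitM \<Otimes>\<^sub>M unitM" by (rule prob_space_unitM2)
  have "\<bar>LINT (x, y):A \<times> B|unitM \<Otimes>\<^sub>M unitM. k x y\<bar> \<le>
      (LINT z|(unitM \<Otimes>\<^sub>M unitM). norm (indicator (A \<times> B) z *\<^sub>R (case z of (x, y) \<Rightarrow> k x y)))"
    unfolding set_lebesgue_integral_def real_norm_def[symmetric] by (rule integral_norm_bound)
  also have "\<dots> \<le> 1"
    by (rule integral_le_const)
       (use integrable_kern[OF assms] assms(1) in
         \<open>auto simp: kern_def set_integrable_def space_pair_measure indicator_def\<close>)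
  finally show ?thesis .
qed

lemma cut_norm_upper:
  assumes "kern k" "A \<in> sets unitM" "B \<in> sets unitM"
  shows "\<bar>LINT (x, y):A \<times> B|unitM \<Otimes>\<^sub>M unitM. k x y\<bar> \<le> cut_norm k"
proof -
  have "bdd_above ((\<lambda>(A, B). \<bar>LINT (x, y):A \<times> B|unitM \<Otimes>\<^sub>M unitM. k x y\<bar>) `
      (sets unitM \<times> sets unitM))"
    using kern_integral_le_1[OF assms(1)] by (intro bdd_aboveI[where M = 1]) auto
  from cSUP_upper[OF _ this, of "(A, B)"] assms show ?thesis
    by (auto simp: cut_norm_def)
qed

lemma cut_norm_least:
  assumes "\<And>A B. A \<in> sets unitM \<Longrightarrow> B \<in> sets unitM \<Longrightarrow>
      \<bar>LINT (x, y):A \<times> B|unitM \<Otimes>\<^sub>M unitM. k x y\<bar> \<le> c"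
  shows "cut_norm k \<le> c"
  unfolding cut_norm_def
proof (rule cSUP_least)
  show "sets unitM \<times> sets unitM \<noteq> {}" by blast
qed (use assms in auto)

lemma cut_norm_nonneg: "kern k \<Longrightarrow> 0 \<le> cut_norm k"
  using cut_norm_upper[of k "{}" "{}"] by simp

lemma cut_norm_triangle:
  assumes "kern j" "kern k"
  shows "cut_norm (\<lambda>x y. j x y + k x y) \<le> cut_norm j + cut_norm k"
proof (rule cut_norm_least)
  fix A B assume AB: "A \<in> sets unitM" "B \<in> sets unitM"
  have "(LINT (x, y):A \<times> B|unitM \<Otimes>\<^sub>M unitM. j x y + k x y) =
      (LINT (x, y):A \<times> B|unitM \<Otimes>\<^sub>M unitM. j x y) + (LINT (x, y):A \<times> B|unitM \<Otimes>\<^sub>M unitM. k x y)"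
    using set_integral_add(2)[OF integrable_kern[OF assms(1) AB] integrable_kern[OF assms(2) AB]]
    by (simp add: case_prod_unfold)
  then show "\<bar>LINT (x, y):A \<times> B|unitM \<Otimes>\<^sub>M unitM. j x y + k x y\<bar> \<le> cut_norm j + cut_norm k"
    using cut_norm_upper[OF assms(1) AB] cut_norm_upper[OF assms(2) AB] by linarith
qed

lemma cut_norm_minus:
  assumes "kern k"
  shows "cut_norm (\<lambda>x y. - k x y) \<le> cut_norm k"
proof (rule cut_norm_least)
  fix A B assume AB: "A \<in> sets unitM" "B \<in> sets unitM"
  have "(LINT (x, y):A \<times> B|unitM \<Otimes>\<^sub>M unitM. - k x y) =
      - (LINT (x, y):A \<times> B|unitM \<Otimes>\<^sub>M unitM. k x y)"
    by (simp add: set_lebesgue_integral_def case_prod_unfold)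
  then show "\<bar>LINT (x, y):A \<times> B|unitM \<Otimes>\<^sub>M unitM. - k x y\<bar> \<le> cut_norm k"
    using cut_norm_upper[OF assms AB] by simp
qed

lemma mp_bij_range: "mp_bij \<phi> \<Longrightarrow> x \<in> {0..1} \<Longrightarrow> \<phi> x \<in> {0..1}"
  unfolding mp_bij_def bij_betw_def by blast

lemma mp_bij_inv_left: "mp_bij \<phi> \<Longrightarrow> x \<in> {0..1} \<Longrightarrow> the_inv_into {0..1} \<phi> (\<phi> x) = x"
  unfolding mp_bij_def bij_betw_def by (simp add: the_inv_into_f_f)

lemma mp_bij_inv_right: "mp_bij \<phi> \<Longrightarrow> x \<in> {0..1} \<Longrightarrow> \<phi> (the_inv_into {0..1} \<phi> x) = x"
  unfolding mp_bij_def bij_betw_def by (simp add: f_the_inv_into_f)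

lemma mp_bij_measurable_pair:
  assumes "mp_bij \<phi>"
  shows "(\<lambda>(x, y). (\<phi> x, \<phi> y)) \<in> unitM \<Otimes>\<^sub>M unitM \<rightarrow>\<^sub>M unitM \<Otimes>\<^sub>M unitM"
proof -
  have [measurable]: "\<phi> \<in> unitM \<rightarrow>\<^sub>M unitM" using assms by (simp add: mp_bij_def)
  show ?thesis by measurable
qed

lemma mp_bij_distr_pair:
  assumes "mp_bij \<phi>"
  shows "distr (unitM \<Otimes>\<^sub>M unitM) (unitM \<Otimes>\<^sub>M unitM) (\<lambda>(x, y). (\<phi> x, \<phi> y)) = unitM \<Otimes>\<^sub>M unitM"
proof -
  interpret prob_space unitM by (rule prob_space_unitM)
  have m: "\<phi> \<in> unitM \<rightarrow>\<^sub>M unitM" and d: "distr unitM unitM \<phi> = unitM"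
    using assms by (simp_all add: mp_bij_def)
  show ?thesis
    using pair_measure_distr[OF m m] sigma_finite_measure_axioms by (simp add: d)
qed

lemma mp_bij_id: "mp_bij (\<lambda>x. x)"
proof -
  have "the_inv_into {0..1} (\<lambda>x. x) x = x" if "x \<in> {0..1}" for x :: real
    by (rule the_inv_into_f_f) (use that in auto)
  then have "the_inv_into {0..1} (\<lambda>x. x) \<in> unitM \<rightarrow>\<^sub>M unitM"
    by (subst measurable_cong[where g = "\<lambda>x. x"]) auto
  then show ?thesis
    by (simp add: mp_bij_def distr_id[unfolded id_def] bij_betw_def)
qed

lemma mp_bij_inv:
  assumes "mp_bij \<phi>"
  shows "mp_bij (the_inv_into {0..1} \<phi>)"
proof -
  let ?\<psi> = "the_inv_into {0..1} \<phi>"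
  have m: "\<phi> \<in> unitM \<rightarrow>\<^sub>M unitM" "?\<psi> \<in> unitM \<rightarrow>\<^sub>M unitM"
    and d: "distr unitM unitM \<phi> = unitM" and b: "bij_betw \<phi> {0..1} {0..1}"
    using assms by (simp_all add: mp_bij_def)
  have b': "bij_betw ?\<psi> {0..1} {0..1}" using b by (rule bij_betw_the_inv_into)
  have "the_inv_into {0..1} ?\<psi> x = \<phi> x" if "x \<in> {0..1}" for x
    by (rule the_inv_into_f_eq)
       (use b' that mp_bij_range[OF assms] mp_bij_inv_left[OF assms] in \<open>auto simp: bij_betw_def\<close>)
  then have m': "the_inv_into {0..1} ?\<psi> \<in> unitM \<rightarrow>\<^sub>M unitM"
    using m(1) by (subst measurable_cong[where g = \<phi>]) auto
  have "distr unitM unitM ?\<psi> = distr (distr unitM unitM \<phi>) unitM ?\<psi>"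
    by (simp add: d)
  also have "\<dots> = distr unitM unitM (?\<psi> \<circ> \<phi>)"
    by (rule distr_distr) (use m in auto)
  also have "\<dots> = distr unitM unitM (\<lambda>x. x)"
    by (rule distr_cong) (use mp_bij_inv_left[OF assms] in auto)
  also have "\<dots> = unitM" by (simp add: distr_id[unfolded id_def])
  finally show ?thesis using m m' b' by (simp add: mp_bij_def)
qed

lemma mp_bij_comp:
  assumes "mp_bij \<phi>" "mp_bij \<psi>"
  shows "mp_bij (\<lambda>x. \<psi> (\<phi> x))"
proof -
  let ?i = "the_inv_into {0..1}"
  have m: "\<phi> \<in> unitM \<rightarrow>\<^sub>M unitM" "?i \<phi> \<in> unitM \<rightarrow>\<^sub>M unitM" "\<psi> \<in> unitM \<rightarrow>\<^sub>M unitM" "?i \<psi> \<in> unitM \<rightarrow>\<^sub>M unitM"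
    and d: "distr unitM unitM \<phi> = unitM" "distr unitM unitM \<psi> = unitM"
    and b: "bij_betw \<phi> {0..1} {0..1}" "bij_betw \<psi> {0..1} {0..1}"
    using assms by (simp_all add: mp_bij_def)
  have b': "bij_betw (\<lambda>x. \<psi> (\<phi> x)) {0..1} {0..1}"
    using bij_betw_trans[OF b] by (simp add: comp_def)
  have "?i (\<lambda>x. \<psi> (\<phi> x)) x = ?i \<phi> (?i \<psi> x)" if "x \<in> {0..1}" for x
  proof (rule the_inv_into_f_eq)
    show "inj_on (\<lambda>x. \<psi> (\<phi> x)) {0..1}" using b' by (simp add: bij_betw_def)
    have "?i \<psi> x \<in> {0..1}" using mp_bij_range[OF mp_bij_inv[OF assms(2)] that] .
    then show "\<psi> (\<phi> (?i \<phi> (?i \<psi> x))) = x" "?i \<phi> (?i \<psi> x) \<in> {0..1}"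
      using mp_bij_inv_right[OF assms(1)] mp_bij_inv_right[OF assms(2) that]
        mp_bij_range[OF mp_bij_inv[OF assms(1)]] by auto
  qed
  then have m': "?i (\<lambda>x. \<psi> (\<phi> x)) \<in> unitM \<rightarrow>\<^sub>M unitM"
    using measurable_compose[OF m(4) m(2)]
    by (subst measurable_cong[where g = "\<lambda>x. ?i \<phi> (?i \<psi> x)"]) auto
  have "distr unitM unitM (\<lambda>x. \<psi> (\<phi> x)) = distr (distr unitM unitM \<phi>) unitM \<psi>"
    using distr_distr[OF m(3) m(1)] by (simp add: comp_def)
  then show ?thesis
    using m' b' measurable_compose[OF m(1) m(3)] by (simp add: mp_bij_def d)
qed

lemma kern_comp:
  assumes "kern k" "mp_bij \<phi>"
  shows "kern (\<lambda>x y. k (\<phi> x) (\<phi> y))"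
  using measurable_compose[OF mp_bij_measurable_pair[OF assms(2)], of "\<lambda>(x, y). k x y" borel]
    assms(1) mp_bij_range[OF assms(2)]
  by (auto simp: kern_def case_prod_unfold)

lemma cut_norm_comp:
  assumes "kern k" "mp_bij \<phi>"
  shows "cut_norm (\<lambda>x y. k (\<phi> x) (\<phi> y)) \<le> cut_norm k"
proof (rule cut_norm_least)
  fix A B assume AB: "A \<in> sets unitM" "B \<in> sets unitM"
  let ?\<psi> = "the_inv_into {0..1} \<phi>"
  define A' B' where "A' = ?\<psi> -` A \<inter> {0..1}" and "B' = ?\<psi> -` B \<inter> {0..1}"
  have "?\<psi> \<in> unitM \<rightarrow>\<^sub>M unitM" using assms(2) by (simp add: mp_bij_def)
  from measurable_sets[OF this AB(1)] measurable_sets[OF this AB(2)]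
  have A'B': "A' \<in> sets unitM" "B' \<in> sets unitM" by (simp_all add: A'_def B'_def)
  let ?f = "\<lambda>z. indicator (A' \<times> B') z *\<^sub>R (case z of (x, y) \<Rightarrow> k x y)"
  have meas: "?f \<in> borel_measurable (unitM \<Otimes>\<^sub>M unitM)"
    using integrable_kern[OF assms(1) A'B'] by (simp add: set_integrable_def)
  have "(LINT (x, y):A' \<times> B'|unitM \<Otimes>\<^sub>M unitM. k x y) =
     (LINT z|(distr (unitM \<Otimes>\<^sub>M unitM) (unitM \<Otimes>\<^sub>M unitM) (\<lambda>(x, y). (\<phi> x, \<phi> y))). ?f z)"
    by (simp add: set_lebesgue_integral_def mp_bij_distr_pair[OF assms(2)])
  also have "\<dots> = (LINT z|(unitM \<Otimes>\<^sub>M unitM). ?f (case z of (x, y) \<Rightarrow> (\<phi> x, \<phi> y)))"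
    by (rule integral_distr[OF mp_bij_measurable_pair[OF assms(2)] meas])
  also have "\<dots> = (LINT (x, y):A \<times> B|unitM \<Otimes>\<^sub>M unitM. k (\<phi> x) (\<phi> y))"
    unfolding set_lebesgue_integral_def
    by (rule Bochner_Integration.integral_cong)
       (use mp_bij_range[OF assms(2)] mp_bij_inv_left[OF assms(2)] in
         \<open>auto simp: indicator_def space_pair_measure A'_def B'_def\<close>)
  finally show "\<bar>LINT (x, y):A \<times> B|unitM \<Otimes>\<^sub>M unitM. k (\<phi> x) (\<phi> y)\<bar> \<le> cut_norm k"
    using cut_norm_upper[OF assms(1) A'B'] by simp
qed

lemma cut_norm_cong:
  assumes "\<And>x y. x \<in> {0..1} \<Longrightarrow> y \<in> {0..1} \<Longrightarrow> j x y = k x y"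
  shows "cut_norm j = cut_norm k"
proof -
  have "(LINT (x, y):A \<times> B|unitM \<Otimes>\<^sub>M unitM. j x y) = (LINT (x, y):A \<times> B|unitM \<Otimes>\<^sub>M unitM. k x y)" for A B
    unfolding set_lebesgue_integral_def
    by (rule Bochner_Integration.integral_cong) (auto simp: space_pair_measure assms)
  then show ?thesis by (simp add: cut_norm_def)
qed

lemma graphon_fun_comp:
  assumes "graphon_fun w" "mp_bij \<phi>"
  shows "graphon_fun (\<lambda>x y. w (\<phi> x) (\<phi> y))"
  using measurable_compose[OF mp_bij_measurable_pair[OF assms(2)], of "\<lambda>(x, y). w x y" borel]
    assms(1) mp_bij_range[OF assms(2)]
  by (auto simp: graphon_fun_def case_prod_unfold)

lemma kern_diff:
  assumes "graphon_fun w" "graphon_fun w'"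
  shows "kern (\<lambda>x y. w x y - w' x y)"
proof -
  have "\<bar>a - b\<bar> \<le> 1" if "0 \<le> a" "a \<le> 1" "0 \<le> b" "b \<le> 1" for a b :: real
    using that by linarith
  then show ?thesis
    using assms borel_measurable_diff[of "\<lambda>(x, y). w x y" "unitM \<Otimes>\<^sub>M unitM" "\<lambda>(x, y). w' x y"]
    by (auto simp: kern_def graphon_fun_def case_prod_unfold)
qed

lemma kern_diff_comp:
  "graphon_fun w \<Longrightarrow> graphon_fun w' \<Longrightarrow> mp_bij \<phi> \<Longrightarrow> kern (\<lambda>x y. w x y - w' (\<phi> x) (\<phi> y))"
  using kern_diff graphon_fun_comp by blast

lemma cut_dist_lower:
  assumes "graphon_fun w" "graphon_fun w'" "mp_bij \<phi>"
  shows "cut_dist w w' \<le> cut_norm (\<lambda>x y. w x y - w' (\<phi> x) (\<phi> y))"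
  unfolding cut_dist_def
  by (rule cINF_lower)
     (use assms in \<open>auto intro!: bdd_belowI[where m = 0] cut_norm_nonneg kern_diff_comp\<close>)

lemma cut_dist_greatest:
  assumes "\<And>\<phi>. mp_bij \<phi> \<Longrightarrow> c \<le> cut_norm (\<lambda>x y. w x y - w' (\<phi> x) (\<phi> y))"
  shows "c \<le> cut_dist w w'"
  unfolding cut_dist_def by (rule cINF_greatest) (use assms mp_bij_id in auto)

lemma cut_dist_nonneg: "graphon_fun w \<Longrightarrow> graphon_fun w' \<Longrightarrow> 0 \<le> cut_dist w w'"
  by (intro cut_dist_greatest cut_norm_nonneg kern_diff_comp)

lemma cut_dist_refl: "graphon_fun w \<Longrightarrow> cut_dist w w = 0"
proof -
  assume w: "graphon_fun w"
  have "cut_dist w w \<le> cut_norm (\<lambda>x y. w x y - w x y)"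
    using cut_dist_lower[OF w w mp_bij_id] .
  also have "\<dots> \<le> 0" by (rule cut_norm_least) (simp add: set_lebesgue_integral_def)
  finally show ?thesis using cut_dist_nonneg[OF w w] by simp
qed

lemma cut_dist_sym_le:
  assumes "graphon_fun w" "graphon_fun w'"
  shows "cut_dist w w' \<le> cut_dist w' w"
proof (rule cut_dist_greatest)
  fix \<phi> assume \<phi>: "mp_bij \<phi>"
  let ?\<psi> = "the_inv_into {0..1} \<phi>"
  have \<psi>: "mp_bij ?\<psi>" using \<phi> by (rule mp_bij_inv)
  have k: "kern (\<lambda>x y. w' x y - w (\<phi> x) (\<phi> y))" using assms \<phi> by (simp add: kern_diff_comp)
  have "cut_dist w w' \<le> cut_norm (\<lambda>x y. w x y - w' (?\<psi> x) (?\<psi> y))"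
    using assms \<psi> by (rule cut_dist_lower)
  also have "\<dots> = cut_norm (\<lambda>x y. - (w' (?\<psi> x) (?\<psi> y) - w (\<phi> (?\<psi> x)) (\<phi> (?\<psi> y))))"
    by (rule cut_norm_cong) (simp add: mp_bij_inv_right[OF \<phi>])
  also have "\<dots> \<le> cut_norm (\<lambda>x y. w' (?\<psi> x) (?\<psi> y) - w (\<phi> (?\<psi> x)) (\<phi> (?\<psi> y)))"
    by (rule cut_norm_minus) (rule kern_comp[OF k \<psi>])
  also have "\<dots> \<le> cut_norm (\<lambda>x y. w' x y - w (\<phi> x) (\<phi> y))"
    by (rule cut_norm_comp[OF k \<psi>])
  finally show "cut_dist w w' \<le> cut_norm (\<lambda>x y. w' x y - w (\<phi> x) (\<phi> y))" .
qed

lemma cut_dist_commute: "graphon_fun w \<Longrightarrow> graphon_fun w' \<Longrightarrow> cut_dist w w' = cut_dist w' w"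
  by (intro antisym cut_dist_sym_le)

lemma cut_dist_triangle:
  assumes "graphon_fun u" "graphon_fun v" "graphon_fun w"
  shows "cut_dist u w \<le> cut_dist u v + cut_dist v w"
proof -
  have *: "cut_dist u w \<le> cut_norm (\<lambda>x y. u x y - v (\<phi> x) (\<phi> y)) + cut_norm (\<lambda>x y. v x y - w (\<psi> x) (\<psi> y))"
    if \<phi>: "mp_bij \<phi>" and \<psi>: "mp_bij \<psi>" for \<phi> \<psi>
  proof -
    have k: "kern (\<lambda>x y. u x y - v (\<phi> x) (\<phi> y))" "kern (\<lambda>x y. v x y - w (\<psi> x) (\<psi> y))"
      using assms \<phi> \<psi> by (simp_all add: kern_diff_comp)
    have "cut_dist u w \<le> cut_norm (\<lambda>x y. u x y - w (\<psi> (\<phi> x)) (\<psi> (\<phi> y)))"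
      using cut_dist_lower[OF assms(1,3) mp_bij_comp[OF \<phi> \<psi>]] .
    also have "\<dots> = cut_norm (\<lambda>x y. (u x y - v (\<phi> x) (\<phi> y)) +
        (v (\<phi> x) (\<phi> y) - w (\<psi> (\<phi> x)) (\<psi> (\<phi> y))))" by simp
    also have "\<dots> \<le> cut_norm (\<lambda>x y. u x y - v (\<phi> x) (\<phi> y)) +
        cut_norm (\<lambda>x y. v (\<phi> x) (\<phi> y) - w (\<psi> (\<phi> x)) (\<psi> (\<phi> y)))"
      by (rule cut_norm_triangle[OF k(1) kern_comp[OF k(2) \<phi>]])
    also have "\<dots> \<le> cut_norm (\<lambda>x y. u x y - v (\<phi> x) (\<phi> y)) + cut_norm (\<lambda>x y. v x y - w (\<psi> x) (\<psi> y))"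
      using cut_norm_comp[OF k(2) \<phi>] by simp
    finally show ?thesis .
  qed
  have "cut_dist u w - cut_norm (\<lambda>x y. v x y - w (\<psi> x) (\<psi> y)) \<le> cut_dist u v" if "mp_bij \<psi>" for \<psi>
    by (rule cut_dist_greatest) (use *[OF _ that] in \<open>simp add: algebra_simps\<close>)
  then have "cut_dist u w - cut_dist u v \<le> cut_dist v w"
    by (intro cut_dist_greatest) (simp add: algebra_simps)
  then show ?thesis by simp
qed


section \<open>The space of graphons\<close>

quotient_type graphon = "real \<Rightarrow> real \<Rightarrow> real" / partial: weakly_isomorphic
proof (rule part_equivpI)
  have "graphon_fun (\<lambda>_ _. 0)" by (simp add: graphon_fun_def)
  then show "\<exists>w. weakly_isomorphic w w" by (auto simp: weakly_isomorphic_def cut_dist_refl)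
  show "symp weakly_isomorphic"
    by (auto simp: symp_def weakly_isomorphic_def cut_dist_commute)
  show "transp weakly_isomorphic"
    unfolding transp_def weakly_isomorphic_def
    by (metis add_0 antisym cut_dist_nonneg cut_dist_triangle)
qed

instantiation graphon :: metric_space
begin

lift_definition dist_graphon :: "graphon \<Rightarrow> graphon \<Rightarrow> real" is cut_dist
proof -
  fix a a' b b'
  assume "weakly_isomorphic a a'" "weakly_isomorphic b b'"
  then have g: "graphon_fun a" "graphon_fun a'" "graphon_fun b" "graphon_fun b'"
    and z: "cut_dist a a' = 0" "cut_dist b b' = 0" "cut_dist a' a = 0" "cut_dist b' b = 0"
    by (auto simp: weakly_isomorphic_def cut_dist_commute)
  show "cut_dist a b = cut_dist a' b'"
    using cut_dist_triangle[OF g(1,2,4)] cut_dist_triangle[OF g(1,4,3)]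
      cut_dist_triangle[OF g(2,1,3)] cut_dist_triangle[OF g(2,3,4)] z by linarith
qed

definition uniformity_graphon :: "(graphon \<times> graphon) filter" where
  "uniformity_graphon = (INF e\<in>{0<..}. principal {(x, y). dist x y < e})"

definition open_graphon :: "graphon set \<Rightarrow> bool" where
  "open_graphon U \<longleftrightarrow> (\<forall>x\<in>U. eventually (\<lambda>(x', y). x' = x \<longrightarrow> y \<in> U) uniformity)"

instance
proof
  fix x y z :: graphon
  show "dist x y = 0 \<longleftrightarrow> x = y"
    by transfer (auto simp: weakly_isomorphic_def)
  show "dist x y \<le> dist x z + dist y z"
    by transfer (metis weakly_isomorphic_def cut_dist_commute cut_dist_triangle)
qed (simp_all add: uniformity_graphon_def open_graphon_def)

end

text \<open>The Borel sets are those of the cut-distance topology, and the law of \<open>V\<close> is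
  \<open>distr M borel V\<close>.\<close>

definition random_graphon :: "'a measure \<Rightarrow> ('a \<Rightarrow> graphon) \<Rightarrow> bool" where
  "random_graphon M V \<longleftrightarrow> prob_space M \<and> V \<in> borel_measurable M"


section \<open>The recursive cographon\<close>

datatype sign = Plus | Minus

definition sign_pmf :: "real \<Rightarrow> sign pmf" where
  "sign_pmf p = map_pmf (\<lambda>b. if b then Plus else Minus) (bernoulli_pmf p)"

text \<open>The space carrying the two independent i.i.d. sequences (indexed from \<open>0\<close>).\<close>

definition rec_space :: "real \<Rightarrow> ((nat \<Rightarrow> real) \<times> (nat \<Rightarrow> sign)) measure" where
  "rec_space p = (\<Pi>\<^sub>M j\<in>UNIV. unitM) \<Otimes>\<^sub>M (\<Pi>\<^sub>M j\<in>UNIV. measure_pmf (sign_pmf p))"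

definition is_first_cut :: "(nat \<Rightarrow> real) \<Rightarrow> real \<Rightarrow> real \<Rightarrow> nat \<Rightarrow> bool" where
  "is_first_cut U x y j \<longleftrightarrow> U j \<in> {x<..y} \<and> (\<forall>i<j. U i \<notin> {x<..y})"

definition rec_prec :: "(nat \<Rightarrow> real) \<Rightarrow> (nat \<Rightarrow> sign) \<Rightarrow> real \<Rightarrow> real \<Rightarrow> bool" where
  "rec_prec U S x y \<longleftrightarrow>
     x < y \<and> (\<exists>j. is_first_cut U x y j \<and> S j = Plus) \<or>
     y < x \<and> (\<exists>j. is_first_cut U y x j \<and> S j = Minus)"

text \<open>The value is \<open>1\<close> iff the larger point precedes the smaller one. On the diagonal, and
  on the null event that no \<open>U j\<close> separates the two points, it is \<open>0\<close>.\<close>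

definition rec_fun :: "(nat \<Rightarrow> real) \<Rightarrow> (nat \<Rightarrow> sign) \<Rightarrow> real \<Rightarrow> real \<Rightarrow> real" where
  "rec_fun U S x y = (if rec_prec U S (max x y) (min x y) then 1 else 0)"

lemma graphon_fun_rec_fun: "graphon_fun (rec_fun U S)"
proof -
  have [measurable]: "(\<lambda>x. x) \<in> unitM \<rightarrow>\<^sub>M borel"
    by (simp add: measurable_restrict_space1)
  have [measurable]: "fst \<in> borel_measurable (unitM \<Otimes>\<^sub>M unitM)" "snd \<in> borel_measurable (unitM \<Otimes>\<^sub>M unitM)"
    using measurable_compose[OF measurable_fst, of "\<lambda>x. x" unitM borel unitM]
      measurable_compose[OF measurable_snd, of "\<lambda>x. x" unitM borel unitM] by simp_all
  have "(\<lambda>z. rec_fun U S (fst z) (snd z)) \<in> borel_measurable (unitM \<Otimes>\<^sub>M unitM)"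
    unfolding rec_fun_def rec_prec_def is_first_cut_def greaterThanAtMost_iff by measurable
  then show ?thesis
    by (simp add: graphon_fun_def case_prod_unfold rec_fun_def max.commute min.commute)
qed

definition rec_graphon :: "(nat \<Rightarrow> real) \<times> (nat \<Rightarrow> sign) \<Rightarrow> graphon" where
  "rec_graphon = (\<lambda>(U, S). abs_graphon (rec_fun U S))"


section \<open>Gluing two independent copies of a random graphon\<close>

definition glue_fun ::
  "(real \<Rightarrow> real \<Rightarrow> real) \<Rightarrow> (real \<Rightarrow> real \<Rightarrow> real) \<Rightarrow> real \<Rightarrow> real \<Rightarrow> real \<Rightarrow> real \<Rightarrow> real" where
  "glue_fun w\<^sub>1 w\<^sub>2 u s x y =
     (if x \<le> u \<and> y \<le> u then w\<^sub>1 (x / u) (y / u)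
      else if x > u \<and> y > u then w\<^sub>2 ((x - u) / (1 - u)) ((y - u) / (1 - u))
      else s)"

lemma graphon_fun_glue_fun:
  assumes "graphon_fun w\<^sub>1" "graphon_fun w\<^sub>2" "u \<in> {0..1}" "s \<in> {0..1}"
  shows "graphon_fun (glue_fun w\<^sub>1 w\<^sub>2 u s)"
proof -
  let ?P = "unitM \<Otimes>\<^sub>M unitM"
  define c where "c t = min 1 (max 0 t)" for t :: real
  have c: "c t \<in> {0..1}" "t \<in> {0..1} \<Longrightarrow> c t = t" for t by (auto simp: c_def)
  have c_meas: "(\<lambda>z. c (f z)) \<in> ?P \<rightarrow>\<^sub>M unitM" if "f \<in> borel_measurable ?P" for f
  proof (rule measurable_restrict_space2)
    show "(\<lambda>z. c (f z)) \<in> ?P \<rightarrow>\<^sub>M lborel" using that by (simp add: c_def)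
  qed (use c in auto)
  have [measurable]: "fst \<in> borel_measurable ?P" "snd \<in> borel_measurable ?P"
    using measurable_compose[OF measurable_fst, of "\<lambda>x. x" unitM borel unitM]
      measurable_compose[OF measurable_snd, of "\<lambda>x. x" unitM borel unitM]
    by (simp_all add: measurable_restrict_space1)
  have w: "(\<lambda>z. w (c (f z)) (c (g z))) \<in> borel_measurable ?P"
    if "graphon_fun w" "f \<in> borel_measurable ?P" "g \<in> borel_measurable ?P" for w f g
    using measurable_compose[OF measurable_Pair[OF c_meas[OF that(2)] c_meas[OF that(3)]],
        of "\<lambda>(x, y). w x y" borel] that(1) by (simp add: graphon_fun_def)
  have [measurable]:
    "(\<lambda>z. w\<^sub>1 (c (fst z / u)) (c (snd z / u))) \<in> borel_measurable ?P"
    "(\<lambda>z. w\<^sub>2 (c ((fst z - u) / (1 - u))) (c ((snd z - u) / (1 - u)))) \<in> borel_measurable ?P"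
    by (intro w assms; measurable)+
  have r1: "t / u \<in> {0..1}" if "t \<in> {0..1}" "t \<le> u" for t
    using that by (auto simp: divide_simps)
  have r2: "(t - u) / (1 - u) \<in> {0..1}" if "t \<in> {0..1}" "u < t" for t
    using that by (auto simp: divide_simps)
  have "(\<lambda>z. if fst z \<le> u \<and> snd z \<le> u then w\<^sub>1 (c (fst z / u)) (c (snd z / u))
      else if fst z > u \<and> snd z > u
        then w\<^sub>2 (c ((fst z - u) / (1 - u))) (c ((snd z - u) / (1 - u))) else s) \<in> borel_measurable ?P"
    by measurable
  then have "(\<lambda>(x, y). glue_fun w\<^sub>1 w\<^sub>2 u s x y) \<in> borel_measurable ?P"
    by (rule measurable_cong[THEN iffD1, rotated])
       (use r1 r2 in \<open>auto simp: glue_fun_def space_pair_measure c(2)\<close>)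
  moreover have "glue_fun w\<^sub>1 w\<^sub>2 u s x y = glue_fun w\<^sub>1 w\<^sub>2 u s y x \<and>
      0 \<le> glue_fun w\<^sub>1 w\<^sub>2 u s x y \<and> glue_fun w\<^sub>1 w\<^sub>2 u s x y \<le> 1"
    if "x \<in> {0..1}" "y \<in> {0..1}" for x y
    using that r1[of x] r1[of y] r2[of x] r2[of y] assms
    by (auto simp: glue_fun_def graphon_fun_def)
  ultimately show ?thesis by (simp add: graphon_fun_def)
qed

text \<open>\<open>rep_graphon\<close> chooses a representative; weakly isomorphic representatives give weakly
  isomorphic glued graphons, so the choice is immaterial.\<close>

definition glue :: "graphon \<Rightarrow> graphon \<Rightarrow> real \<Rightarrow> bool \<Rightarrow> graphon" where
  "glue W\<^sub>1 W\<^sub>2 u s = abs_graphon (glue_fun (rep_graphon W\<^sub>1) (rep_graphon W\<^sub>2) u (of_bool s))"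

text \<open>\<open>W[V]\<close>, realised on the product space carrying two independent copies of \<open>V\<close>, an
  independent uniform \<open>U\<close> and an independent Bernoulli variable \<open>S\<close> of parameter \<open>1 - p\<close>.\<close>

definition glue_space :: "real \<Rightarrow> 'a measure \<Rightarrow> ('a \<times> 'a \<times> real \<times> bool) measure" where
  "glue_space p M = M \<Otimes>\<^sub>M M \<Otimes>\<^sub>M unitM \<Otimes>\<^sub>M measure_pmf (bernoulli_pmf (1 - p))"

definition glued :: "('a \<Rightarrow> graphon) \<Rightarrow> 'a \<times> 'a \<times> real \<times> bool \<Rightarrow> graphon" where
  "glued V = (\<lambda>(\<omega>\<^sub>1, \<omega>\<^sub>2, u, s). glue (V \<omega>\<^sub>1) (V \<omega>\<^sub>2) u s)"

end

theory Submission
  imports Defs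
begin

text \<open>
  Let \<open>T\<close> be the operator that sends the law of a random graphon \<open>V\<close> to the law of \<open>W[V]\<close>
  (\<open>glue_law\<close> below). The statement says that the law of the recursive cographon is the unique
  fixed point of \<open>T\<close>.

  \<^emph>\<open>Uniqueness\<close> is a contraction argument. Glue \<open>V\<^sub>1, V\<^sub>2\<close> and \<open>V\<^sub>1', V\<^sub>2'\<close> with the same \<open>U\<close> and
  the same \<open>S\<close>. The two results agree on the off-diagonal blocks, and relabellings that nearly
  realise the cut distances inside the two cells combine into one relabelling of \<open>[0,1]\<close>, so that
  the cut distance of the results is at most \<open>U\<^sup>2 d(V\<^sub>1, V\<^sub>1') + (1 - U)\<^sup>2 d(V\<^sub>2, V\<^sub>2')\<close>
  (\<open>cut_dist_glue_fun\<close>). Since the expectation of \<open>U\<^sup>2 + (1 - U)\<^sup>2\<close> is \<open>2/3\<close>, gluing two independent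
  copies of a coupling multiplies the expected distance by at most \<open>2/3\<close>, while both marginals
  move by \<open>T\<close>. Two fixed points therefore have couplings with arbitrarily small expected distance,
  and such laws are equal (\<open>measure_eqI_coupling\<close>).

  \<^emph>\<open>Existence.\<close> Condition the recursive cographon on its first cut \<open>u\<close> and its first sign. Each
  later cut point falls into \<open>[0,u]\<close> with probability \<open>u\<close>, independently of everything else, and is then
  uniform in its cell. So the later marked points are an interleaving of two independent
  i.i.d. sequences, one rescaled to each cell, directed by i.i.d. bits of parameter \<open>u\<close>
  (\<open>distr_interleave_Seq\<close>). The order of two points in the same cell is decided by the first cut
  between them, which is a point of the sequence of that cell; hence the two diagonal blocks are the
  recursive cographons of the two sequences, and the off-diagonal value is given by the first sign
  (\<open>rec_fun_interleave\<close>).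

  \<^emph>\<open>Measurability\<close> rests on the separability of the space of graphons: step functions with rational
  values are dense for the \<open>L\<^sup>1\<close> distance, which dominates the cut distance. Maps into the space of graphons
  are then pointwise limits of maps with countable range.
\<close>


section \<open>Splitting the unit interval into two cells\<close>

text \<open>The affine chart of the left cell \<open>[0,u]\<close> (for \<open>True\<close>) or the right cell \<open>[u,1]\<close> (for \<open>False\<close>).\<close>

definition cell :: "real \<Rightarrow> bool \<Rightarrow> real \<Rightarrow> real" where
  "cell u b t = (if b then u * t else u + (1 - u) * t)"

lemma cell_range: "u \<in> {0..1} \<Longrightarrow> t \<in> {0..1} \<Longrightarrow> cell u b t \<in> {0..1}"
  using mult_left_le[of t u] mult_left_le[of t "1 - u"]
  by (auto simp: cell_def)

lemma measurable_cell: "u \<in> {0..1} \<Longrightarrow> cell u b \<in> unitM \<rightarrow>\<^sub>M unitM"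
proof (rule measurable_restrict_space2)
  show "cell u b \<in> unitM \<rightarrow>\<^sub>M lborel"
    unfolding cell_def by (rule measurable_restrict_space1) simp
qed (use cell_range in auto)

text \<open>Uniform measure on \<open>[0,1]\<close> is the mixture of the uniform measures on the two cells, with weights
  \<open>u\<close> and \<open>1 - u\<close>: an affine change of variables in each cell. It gives the block
  decomposition of cut norms, the invariance of combined relabellings and the law of a cut point.\<close>

lemma nn_integral_cells:
  assumes u: "u \<in> {0..1}" and f: "f \<in> borel_measurable unitM"
  shows "(\<integral>\<^sup>+x. f x \<partial>unitM) =
    ennreal u * (\<integral>\<^sup>+t. f (cell u True t) \<partial>unitM) + ennreal (1 - u) * (\<integral>\<^sup>+t. f (cell u False t) \<partial>unitM)"
proof -
  let ?I = "\<lambda>a b. indicator {a..b} :: real \<Rightarrow> ennreal"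
  define g where "g x = f x * ?I 0 1 x" for x
  have [measurable]: "g \<in> borel_measurable borel"
    using f by (subst (asm) borel_measurable_restrict_space_iff_ennreal) (auto simp: g_def[abs_def])
  have unit: "(\<integral>\<^sup>+t. h t \<partial>unitM) = (\<integral>\<^sup>+t. h t * ?I 0 1 t \<partial>lborel)" for h
    by (subst nn_integral_restrict_space) auto
  have 1: "(\<integral>\<^sup>+x. g x * ?I 0 u x \<partial>lborel) = ennreal u * (\<integral>\<^sup>+t. f (cell u True t) \<partial>unitM)"
  proof (cases "u = 0")
    case True
    have "(\<integral>\<^sup>+x. g x * ?I 0 u x \<partial>lborel) = (\<integral>\<^sup>+x. 0 \<partial>(lborel::real measure))"
      using AE_lborel_singleton[of 0] by (intro nn_integral_cong_AE) (auto simp: True)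
    then show ?thesis using True by simp
  next
    case False
    have "(\<integral>\<^sup>+x. g x * ?I 0 u x \<partial>lborel) = \<bar>u\<bar> * (\<integral>\<^sup>+x. g (0 + u * x) * ?I 0 u (0 + u * x) \<partial>lborel)"
      by (rule nn_integral_real_affine) (use False in auto)
    also have "(\<integral>\<^sup>+x. g (0 + u * x) * ?I 0 u (0 + u * x) \<partial>lborel) = (\<integral>\<^sup>+t. f (cell u True t) \<partial>unitM)"
      unfolding unit using u False
      by (intro nn_integral_cong) (auto simp: g_def indicator_def cell_def zero_le_mult_iff mult_le_one)
    finally show ?thesis using u by simp
  qed
  have 2: "(\<integral>\<^sup>+x. g x * ?I u 1 x \<partial>lborel) = ennreal (1 - u) * (\<integral>\<^sup>+t. f (cell u False t) \<partial>unitM)"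
  proof (cases "u = 1")
    case True
    have "(\<integral>\<^sup>+x. g x * ?I u 1 x \<partial>lborel) = (\<integral>\<^sup>+x. 0 \<partial>(lborel::real measure))"
      using AE_lborel_singleton[of 1] by (intro nn_integral_cong_AE) (auto simp: True)
    then show ?thesis using True by simp
  next
    case False
    have "(\<integral>\<^sup>+x. g x * ?I u 1 x \<partial>lborel) = \<bar>1 - u\<bar> * (\<integral>\<^sup>+x. g (u + (1 - u) * x) * ?I u 1 (u + (1 - u) * x) \<partial>lborel)"
      by (rule nn_integral_real_affine) (use False in auto)
    also have "(\<integral>\<^sup>+x. g (u + (1 - u) * x) * ?I u 1 (u + (1 - u) * x) \<partial>lborel) = (\<integral>\<^sup>+t. f (cell u False t) \<partial>unitM)"
    proof -
      have "u + (1 - u) * x \<le> 1 \<longleftrightarrow> x \<le> 1" for x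
      proof -
        have "u + (1 - u) * x \<le> 1 \<longleftrightarrow> (1 - u) * x \<le> (1 - u) * 1" unfolding mult_1_right le_diff_eq by (simp only: add.commute)
        also have "\<dots> \<longleftrightarrow> x \<le> 1" using u False by (subst mult_le_cancel_left_pos) auto
        finally show ?thesis .
      qed
      then show ?thesis
      unfolding unit using u False
      by (intro nn_integral_cong) (auto simp: g_def indicator_def cell_def zero_le_mult_iff)
    qed
    finally show ?thesis using u by simp
  qed
  have "(\<integral>\<^sup>+x. f x \<partial>unitM) = (\<integral>\<^sup>+x. g x * ?I 0 u x + g x * ?I u 1 x \<partial>lborel)"
    unfolding unit using AE_lborel_singleton[of u] u
    by (intro nn_integral_cong_AE) (auto simp: g_def indicator_def)
  also have "\<dots> = (\<integral>\<^sup>+x. g x * ?I 0 u x \<partial>lborel) + (\<integral>\<^sup>+x. g x * ?I u 1 x \<partial>lborel)"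
    by (rule nn_integral_add) auto
  finally show ?thesis by (simp add: 1 2)
qed

text \<open>A bounded function becomes nonnegative after adding \<open>c\<close>, so the previous identity applies.\<close>

lemma integral_cells:
  fixes f :: "real \<Rightarrow> real"
  assumes u: "u \<in> {0..1}" and f: "f \<in> borel_measurable unitM" and b: "\<And>x. x \<in> {0..1} \<Longrightarrow> \<bar>f x\<bar> \<le> c"
  shows "(LINT x|unitM. f x) = u * (LINT t|unitM. f (cell u True t)) + (1 - u) * (LINT t|unitM. f (cell u False t))"
proof -
  interpret prob_space unitM by (rule prob_space_unitM)
  have c: "0 \<le> c" using b[of 0] by simp
  have i1: "integrable unitM f"
    by (rule integrable_const_bound[where B = c]) (use f b in auto)
  have i2: "integrable unitM (\<lambda>t. f (cell u d t))" for d
    by (rule integrable_const_bound[where B = c])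
      (use measurable_compose[OF measurable_cell[OF u] f] b cell_range[OF u] in auto)
  have pos: "(LINT x|unitM. f x + c) = u * (LINT t|unitM. f (cell u True t) + c) + (1 - u) * (LINT t|unitM. f (cell u False t) + c)"
  proof -
    have *: "(\<integral>\<^sup>+ x. ennreal (f (g x) + c) \<partial>unitM) = ennreal (LINT x|unitM. f (g x) + c)"
      if "integrable unitM (\<lambda>x. f (g x))" "\<And>x. x \<in> {0..1} \<Longrightarrow> g x \<in> {0..1}" for g
    proof (rule nn_integral_eq_integral)
      show "AE x in unitM. 0 \<le> f (g x) + c"
      proof (rule AE_I2)
        fix x assume "x \<in> space unitM" then show "0 \<le> f (g x) + c" using b[OF that(2), of x] by simp
      qed
    qed (use that(1) in auto)
    have nn: "0 \<le> (LINT x|unitM. f (g x) + c)" if "\<And>x. x \<in> {0..1} \<Longrightarrow> g x \<in> {0..1}" for g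
      by (rule Bochner_Integration.integral_nonneg) (use b[OF that] in \<open>force\<close>)
    have "ennreal (LINT x|unitM. f x + c) = (\<integral>\<^sup>+ x. ennreal (f x + c) \<partial>unitM)"
      using *[of "\<lambda>x. x"] i1 by simp
    also have "\<dots> = ennreal u * (\<integral>\<^sup>+ x. ennreal (f (cell u True x) + c) \<partial>unitM)
        + ennreal (1 - u) * (\<integral>\<^sup>+ x. ennreal (f (cell u False x) + c) \<partial>unitM)"
      by (rule nn_integral_cells) (use u f in auto)
    also have "\<dots> = ennreal (u * (LINT t|unitM. f (cell u True t) + c) + (1 - u) * (LINT t|unitM. f (cell u False t) + c))"
      using u nn[OF cell_range[OF u]] *[OF i2 cell_range[OF u]]
      by (simp add: ennreal_mult'[symmetric] ennreal_plus[symmetric] del: ennreal_plus)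
    finally have eq: "ennreal (LINT x|unitM. f x + c) = \<dots>" .
    have "0 \<le> u * (LINT t|unitM. f (cell u True t) + c) + (1 - u) * (LINT t|unitM. f (cell u False t) + c)"
      using u nn[OF cell_range[OF u]] by (intro add_nonneg_nonneg mult_nonneg_nonneg) auto
    then show ?thesis
      using eq nn[of "\<lambda>x. x"] by (subst (asm) ennreal_inj) auto
  qed
  then show ?thesis
    using i1 i2 by (simp add: prob_space algebra_simps)
qed

lemma integral_cells2:
  fixes F :: "real \<Rightarrow> real \<Rightarrow> real"
  assumes u: "u \<in> {0..1}" and F: "(\<lambda>(x, y). F x y) \<in> borel_measurable (unitM \<Otimes>\<^sub>M unitM)"
    and b: "\<And>x y. x \<in> {0..1} \<Longrightarrow> y \<in> {0..1} \<Longrightarrow> \<bar>F x y\<bar> \<le> c"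
  defines "L \<equiv> \<lambda>i j. LINT (x, y)|(unitM \<Otimes>\<^sub>M unitM). F (cell u i x) (cell u j y)"
  shows "(LINT (x, y)|(unitM \<Otimes>\<^sub>M unitM). F x y) =
    u * (u * L True True + (1 - u) * L True False) + (1 - u) * (u * L False True + (1 - u) * L False False)"
proof -
  interpret U: prob_space unitM by (rule prob_space_unitM)
  interpret P: pair_prob_space unitM unitM ..
  note [measurable] = F
  have c: "0 \<le> c" using b[of 0 0] by simp
  have Fm: "(\<lambda>z. F (f (fst z)) (g (snd z))) \<in> borel_measurable (unitM \<Otimes>\<^sub>M unitM)"
    if "f \<in> unitM \<rightarrow>\<^sub>M unitM" "g \<in> unitM \<rightarrow>\<^sub>M unitM" for f g
    using measurable_compose[OF _ F, of "\<lambda>z. (f (fst z), g (snd z))" "unitM \<Otimes>\<^sub>M unitM"] that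
    by simp
  have fub: "(LINT (x, y)|(unitM \<Otimes>\<^sub>M unitM). F (f x) (g y)) = (LINT x|unitM. LINT y|unitM. F (f x) (g y))"
    if "f \<in> unitM \<rightarrow>\<^sub>M unitM" "g \<in> unitM \<rightarrow>\<^sub>M unitM" for f g
  proof -
    have "integrable (unitM \<Otimes>\<^sub>M unitM) (\<lambda>z. F (f (fst z)) (g (snd z)))"
      by (rule P.P.integrable_const_bound[where B = c])
        (use Fm[OF that] b measurable_space[OF that(1)] measurable_space[OF that(2)] in \<open>auto simp: space_pair_measure\<close>)
    from P.integral_fst'[OF this] show ?thesis by (simp add: case_prod_unfold)
  qed
  note cm = measurable_cell[OF u]
  have id: "(\<lambda>x. x) \<in> unitM \<rightarrow>\<^sub>M unitM" by simp
  have inner: "(LINT y|unitM. F x y) = u * (LINT y|unitM. F x (cell u True y)) + (1 - u) * (LINT y|unitM. F x (cell u False y))"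
    if "x \<in> {0..1}" for x
    by (rule integral_cells[where c = c]) (use u b that measurable_compose_Pair1[OF _ F, of x] in auto)
  have Im: "(\<lambda>x. LINT y|unitM. F (f x) (g y)) \<in> borel_measurable unitM"
    if "f \<in> unitM \<rightarrow>\<^sub>M unitM" "g \<in> unitM \<rightarrow>\<^sub>M unitM" for f g
    by (rule U.borel_measurable_lebesgue_integral) (use Fm[OF that] in \<open>simp add: case_prod_unfold\<close>)
  have Ib: "\<bar>LINT y|unitM. F (f x) (g y)\<bar> \<le> c" if "f \<in> unitM \<rightarrow>\<^sub>M unitM" "g \<in> unitM \<rightarrow>\<^sub>M unitM" "x \<in> {0..1}" for f g x
  proof -
    have m: "(\<lambda>y. F (f x) (g y)) \<in> borel_measurable unitM"
      using measurable_compose[OF that(2) measurable_compose_Pair1[OF _ F, of "f x"]] measurable_space[OF that(1), of x] that(3) by simp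
    have bb: "\<bar>F (f x) (g y)\<bar> \<le> c" if "y \<in> {0..1}" for y
      using b measurable_space[OF \<open>f \<in> _\<close>, of x] measurable_space[OF \<open>g \<in> _\<close>, of y] that \<open>x \<in> _\<close> by simp
    have i: "integrable unitM (\<lambda>y. F (f x) (g y))"
      by (rule U.integrable_const_bound[where B = c]) (use m bb in auto)
    have "\<bar>LINT y|unitM. F (f x) (g y)\<bar> \<le> (LINT y|unitM. \<bar>F (f x) (g y)\<bar>)"
      using integral_norm_bound[of unitM "\<lambda>y. F (f x) (g y)"] by simp
    also have "\<dots> \<le> c" by (rule U.integral_le_const) (use i bb in auto)
    finally show ?thesis .
  qed
  have Ii: "integrable unitM (\<lambda>x. LINT y|unitM. F (f x) (g y))" if "f \<in> unitM \<rightarrow>\<^sub>M unitM" "g \<in> unitM \<rightarrow>\<^sub>M unitM" for f g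
    by (rule U.integrable_const_bound[where B = c]) (use Im[OF that] Ib[OF that] in auto)
  have row: "(LINT x|unitM. LINT y|unitM. F (f x) y) =
      u * (LINT x|unitM. LINT y|unitM. F (f x) (cell u True y)) + (1 - u) * (LINT x|unitM. LINT y|unitM. F (f x) (cell u False y))"
    if "f \<in> unitM \<rightarrow>\<^sub>M unitM" for f
  proof -
    have "(LINT x|unitM. LINT y|unitM. F (f x) y) =
      (LINT x|unitM. u * (LINT y|unitM. F (f x) (cell u True y)) + (1 - u) * (LINT y|unitM. F (f x) (cell u False y)))"
      by (rule Bochner_Integration.integral_cong) (use inner measurable_space[OF that] in auto)
    then show ?thesis using Ii[OF that cm] by simp
  qed
  have "(LINT (x, y)|(unitM \<Otimes>\<^sub>M unitM). F x y) = (LINT x|unitM. LINT y|unitM. F x y)"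
    by (rule fub[OF id id])
  also have "\<dots> = u * (LINT x|unitM. LINT y|unitM. F (cell u True x) y) + (1 - u) * (LINT x|unitM. LINT y|unitM. F (cell u False x) y)"
    by (rule integral_cells[where c = c]) (use Im[OF id id] Ib[OF id id] u in auto)
  finally show ?thesis unfolding row[OF cm] L_def fub[OF cm cm] .
qed


section \<open>Gluing is a contraction for the cut distance\<close>

lemma AE_unitM_finite:
  assumes "finite N" shows "AE x in unitM. x \<notin> N"
proof -
  have "AE x in lborel. x \<notin> N"
    by (rule AE_not_in) (use finite_imp_null_set_lborel[OF assms] in simp)
  then show ?thesis by (subst AE_restrict_space_iff) auto
qed

lemma AE_unitM2_finite:
  assumes "finite N" shows "AE z in unitM \<Otimes>\<^sub>M unitM. fst z \<notin> N \<and> snd z \<notin> N"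
proof -
  interpret U: prob_space unitM by (rule prob_space_unitM)
  interpret P: pair_prob_space unitM unitM ..
  have "(AE z in unitM \<Otimes>\<^sub>M unitM. fst z \<notin> N) \<and> (AE z in unitM \<Otimes>\<^sub>M unitM. snd z \<notin> N)"
  proof
    have "AE x in distr (unitM \<Otimes>\<^sub>M unitM) unitM fst. x \<notin> N"
      unfolding U.distr_pair_fst by (rule AE_unitM_finite[OF assms])
    then show "AE z in unitM \<Otimes>\<^sub>M unitM. fst z \<notin> N"
      by (rule AE_distrD[rotated]) simp
    then have "AE z in distr (unitM \<Otimes>\<^sub>M unitM) (unitM \<Otimes>\<^sub>M unitM) (\<lambda>(x, y). (y, x)). fst z \<notin> N"
      by (subst P.distr_pair_swap[symmetric])
    from AE_distrD[OF measurable_pair_swap' this] show "AE z in unitM \<Otimes>\<^sub>M unitM. snd z \<notin> N"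
      by (simp add: case_prod_unfold)
  qed
  then show ?thesis by auto
qed

text \<open>Cut norms do not see null sets. Finite exceptional sets are all that occurs here: end points of
  the cells and points moved by hand to make a relabelling bijective.\<close>

lemma cut_norm_cong_cofinite:
  assumes "kern j" "kern k" "finite N"
    and eq: "\<And>x y. x \<in> {0..1} - N \<Longrightarrow> y \<in> {0..1} - N \<Longrightarrow> j x y = k x y"
  shows "cut_norm j = cut_norm k"
proof -
  have "(LINT (x, y):A \<times> B|unitM \<Otimes>\<^sub>M unitM. j x y) = (LINT (x, y):A \<times> B|unitM \<Otimes>\<^sub>M unitM. k x y)"
    if "A \<in> sets unitM" "B \<in> sets unitM" for A B
    unfolding set_lebesgue_integral_def
  proof (rule integral_cong_AE)
    show "AE z in unitM \<Otimes>\<^sub>M unitM. indicat_real (A \<times> B) z *\<^sub>R (case z of (x, y) \<Rightarrow> j x y) =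
       indicat_real (A \<times> B) z *\<^sub>R (case z of (x, y) \<Rightarrow> k x y)"
      using AE_unitM2_finite[OF assms(3)] AE_space
      by eventually_elim (use eq in \<open>auto simp: space_pair_measure\<close>)
  qed (use integrable_kern[OF assms(1) that] integrable_kern[OF assms(2) that] in
      \<open>auto simp: set_integrable_def\<close>)
  then show ?thesis by (auto simp: cut_norm_def intro!: SUP_cong)
qed

text \<open>For a kernel that vanishes on the off-diagonal blocks, the integral over \<open>A \<times> B\<close> splits into
  the integrals over the traces of \<open>A \<times> B\<close> on the two diagonal blocks, and rescaling a block of side \<open>u\<close>
  to the unit square costs the factor \<open>u\<^sup>2\<close>. A cell of length zero carries no mass, hence the
  provisos on \<open>u\<close>; the point \<open>0\<close> is left out since the left end of the right cell belongs to the
  left cell.\<close>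

lemma cut_norm_cells:
  assumes u: "u \<in> {0..1}" and k: "kern k" "kern k1" "kern k2"
    and k1: "\<And>x y. u \<noteq> 0 \<Longrightarrow> x \<in> {0<..1} \<Longrightarrow> y \<in> {0<..1} \<Longrightarrow> k (cell u True x) (cell u True y) = k1 x y"
    and k2: "\<And>x y. u \<noteq> 1 \<Longrightarrow> x \<in> {0<..1} \<Longrightarrow> y \<in> {0<..1} \<Longrightarrow> k (cell u False x) (cell u False y) = k2 x y"
    and k0: "\<And>x y i. u \<noteq> 0 \<Longrightarrow> u \<noteq> 1 \<Longrightarrow> x \<in> {0<..1} \<Longrightarrow> y \<in> {0<..1} \<Longrightarrow> k (cell u i x) (cell u (\<not> i) y) = 0"
  shows "cut_norm k \<le> u\<^sup>2 * cut_norm k1 + (1 - u)\<^sup>2 * cut_norm k2"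
proof (rule cut_norm_least)
  fix A B assume AB: "A \<in> sets unitM" "B \<in> sets unitM"
  define F where "F x y = indicat_real A x * indicat_real B y * k x y" for x y
  have Fm: "(\<lambda>(x, y). F x y) \<in> borel_measurable (unitM \<Otimes>\<^sub>M unitM)"
    using AB k(1) by (auto simp: F_def kern_def case_prod_unfold)
  have Fb: "\<bar>F x y\<bar> \<le> 1" if "x \<in> {0..1}" "y \<in> {0..1}" for x y
    using k(1) that by (auto simp: F_def kern_def indicator_def)
  define L where "L i j = (LINT (x, y)|(unitM \<Otimes>\<^sub>M unitM). F (cell u i x) (cell u j y))" for i j
  define pre where "pre i C = cell u i -` C \<inter> {0..1}" for i C
  have pre: "pre i C \<in> sets unitM" if "C \<in> sets unitM" for i C
    using measurable_sets[OF measurable_cell[OF u] that, of i] by (simp add: pre_def)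
  have Fcm: "(\<lambda>(x,y). F (cell u i x) (cell u j y)) \<in> borel_measurable (unitM \<Otimes>\<^sub>M unitM)" for i j
    using measurable_compose[OF _ Fm, of "\<lambda>z. (cell u i (fst z), cell u j (snd z))" "unitM \<Otimes>\<^sub>M unitM"]
      measurable_cell[OF u] by (simp add: case_prod_unfold)
  have Lset: "L i j = (LINT (x, y):pre i A \<times> pre j B|unitM \<Otimes>\<^sub>M unitM. h x y)"
    if "kern h" "\<And>x y. x \<in> {0<..1} \<Longrightarrow> y \<in> {0<..1} \<Longrightarrow> k (cell u i x) (cell u j y) = h x y" for i j h
    unfolding L_def set_lebesgue_integral_def
  proof (rule integral_cong_AE)
    show "AE z in unitM \<Otimes>\<^sub>M unitM. (case z of (x, y) \<Rightarrow> F (cell u i x) (cell u j y)) =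
      indicat_real (pre i A \<times> pre j B) z *\<^sub>R (case z of (x, y) \<Rightarrow> h x y)"
      using AE_unitM2_finite[of "{0}", OF finite.insertI[OF finite.emptyI]] AE_space
      by eventually_elim (use that(2) in \<open>auto simp: space_pair_measure F_def pre_def indicator_def\<close>)
  qed (use integrable_kern[OF that(1) pre[OF AB(1)] pre[OF AB(2)]] Fcm in
      \<open>auto simp: set_integrable_def\<close>)
  have le: "\<bar>L i j\<bar> \<le> cut_norm h"
    if "kern h" "\<And>x y. x \<in> {0<..1} \<Longrightarrow> y \<in> {0<..1} \<Longrightarrow> k (cell u i x) (cell u j y) = h x y" for i j h
    using cut_norm_upper[OF that(1) pre[OF AB(1), of i] pre[OF AB(2), of j]] Lset[OF that] by simp
  have z: "L i (\<not> i) = 0" if "u \<noteq> 0" "u \<noteq> 1" for i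
    using Lset[of "\<lambda>_ _. 0" i "\<not> i"] k0 that by (simp add: kern_def set_lebesgue_integral_def)
  have "(LINT (x, y):A \<times> B|unitM \<Otimes>\<^sub>M unitM. k x y) = (LINT (x, y)|(unitM \<Otimes>\<^sub>M unitM). F x y)"
    unfolding set_lebesgue_integral_def
    by (intro Bochner_Integration.integral_cong) (auto simp: F_def indicator_def)
  also have "\<dots> = u * (u * L True True + (1 - u) * L True False) + (1 - u) * (u * L False True + (1 - u) * L False False)"
    unfolding L_def by (rule integral_cells2[OF u Fm Fb])
  also have "\<dots> = u\<^sup>2 * L True True + (1 - u)\<^sup>2 * L False False"
    using z[of True] z[of False] by (cases "u = 0"; cases "u = 1") (auto simp: power2_eq_square)
  also have "\<bar>\<dots>\<bar> \<le> \<bar>u\<^sup>2 * L True True\<bar> + \<bar>(1 - u)\<^sup>2 * L False False\<bar>" by linarith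
  also have "\<dots> \<le> u\<^sup>2 * cut_norm k1 + (1 - u)\<^sup>2 * cut_norm k2"
    using le[OF k(2) k1] le[OF k(3) k2]
    by (cases "u = 0"; cases "u = 1") (auto simp: abs_mult intro!: add_mono mult_left_mono)
  finally show "\<bar>LINT (x, y):A \<times> B|unitM \<Otimes>\<^sub>M unitM. k x y\<bar> \<le> u\<^sup>2 * cut_norm k1 + (1 - u)\<^sup>2 * cut_norm k2" .
qed

lemma mp_bijI:
  assumes m: "\<phi> \<in> unitM \<rightarrow>\<^sub>M unitM" "\<psi> \<in> unitM \<rightarrow>\<^sub>M unitM" and d: "distr unitM unitM \<phi> = unitM"
    and i: "\<And>x. x \<in> {0..1} \<Longrightarrow> \<psi> (\<phi> x) = x" "\<And>x. x \<in> {0..1} \<Longrightarrow> \<phi> (\<psi> x) = x"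
  shows "mp_bij \<phi>"
proof -
  have r: "\<phi> x \<in> {0..1}" "\<psi> x \<in> {0..1}" if "x \<in> {0..1}" for x
    using measurable_space[OF m(1), of x] measurable_space[OF m(2), of x] that by auto
  have bij: "bij_betw \<phi> {0..1} {0..1}"
    by (rule bij_betw_byWitness[where f' = \<psi>]) (use i r in auto)
  have "the_inv_into {0..1} \<phi> x = \<psi> x" if "x \<in> {0..1}" for x
    by (rule the_inv_into_f_eq) (use bij i r that in \<open>auto simp: bij_betw_def\<close>)
  then have "the_inv_into {0..1} \<phi> \<in> unitM \<rightarrow>\<^sub>M unitM"
    using m(2) by (subst measurable_cong[where g = \<psi>]) auto
  then show ?thesis using m(1) d bij by (simp add: mp_bij_def)
qed

lemma distr_unitM_cofinite:
  assumes m: "\<phi> \<in> unitM \<rightarrow>\<^sub>M unitM" and N: "finite N" and eq: "\<And>x. x \<in> {0..1} - N \<Longrightarrow> \<phi> x = x"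
  shows "distr unitM unitM \<phi> = unitM"
proof -
  have "distr unitM unitM \<phi> = distr unitM unitM (\<lambda>x. x)"
    by (rule distr_cong_AE) (use AE_unitM_finite[OF N] eq m in auto)
  then show ?thesis by (simp add: distr_id[unfolded id_def])
qed

text \<open>The left end of the right cell is \<open>u\<close>, which also belongs to the left cell. For two relabellings
  of the cells to combine into a bijection of \<open>[0,1]\<close>, the one of the right cell has to fix its left
  end. Composing it with a transposition achieves this and changes it at two points only.\<close>

lemma mp_bij_fix_zero:
  assumes "mp_bij \<phi>"
  obtains \<phi>' N where "mp_bij \<phi>'" "\<phi>' 0 = 0" "finite N" "\<And>x. x \<in> {0..1} - N \<Longrightarrow> \<phi>' x = \<phi> x"
proof -
  define a where "a = \<phi> 0"
  define \<tau> where "\<tau> x = (if x = 0 then a else if x = a then 0 else x)" for x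
  have a: "a \<in> {0..1}" using mp_bij_range[OF assms] by (simp add: a_def)
  have m: "\<tau> \<in> unitM \<rightarrow>\<^sub>M unitM"
  proof (rule measurable_restrict_space2)
    show "\<tau> \<in> unitM \<rightarrow>\<^sub>M lborel" unfolding \<tau>_def by (rule measurable_restrict_space1) simp
  qed (use a in \<open>auto simp: \<tau>_def\<close>)
  have \<tau>: "mp_bij \<tau>"
  proof (rule mp_bijI[OF m m])
    show "distr unitM unitM \<tau> = unitM"
      by (rule distr_unitM_cofinite[OF m, of "{0, a}"]) (auto simp: \<tau>_def)
  qed (auto simp: \<tau>_def)
  show ?thesis
  proof (rule that[of "\<lambda>x. \<tau> (\<phi> x)" "{0, the_inv_into {0..1} \<phi> 0}"])
    show "mp_bij (\<lambda>x. \<tau> (\<phi> x))" by (rule mp_bij_comp[OF assms \<tau>])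
    show "\<tau> (\<phi> 0) = 0" by (simp add: \<tau>_def a_def)
    fix x assume x: "x \<in> {0..1} - {0, the_inv_into {0..1} \<phi> 0}"
    then have "\<phi> x \<noteq> 0" using mp_bij_inv_left[OF assms, of x] by auto
    moreover have "\<phi> x \<noteq> a" using mp_bij_inv_left[OF assms, of x] mp_bij_inv_left[OF assms, of 0] x
      by (auto simp: a_def)
    ultimately show "\<tau> (\<phi> x) = \<phi> x" by (simp add: \<tau>_def)
  qed auto
qed

definition glue_map :: "(real \<Rightarrow> real) \<Rightarrow> (real \<Rightarrow> real) \<Rightarrow> real \<Rightarrow> real \<Rightarrow> real" where
  "glue_map \<phi> \<psi> u x = (if x \<le> u then cell u True (\<phi> (x / u)) else cell u False (\<psi> ((x - u) / (1 - u))))"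

lemma glue_map_cell_True: "u \<in> {0..1} \<Longrightarrow> t \<in> {0..1} \<Longrightarrow> glue_map \<phi> \<psi> u (cell u True t) = cell u True (\<phi> t)"
  using mult_left_le[of t u] by (auto simp: glue_map_def cell_def)

lemma cell_False_gt: "u \<in> {0..1} \<Longrightarrow> u \<noteq> 1 \<Longrightarrow> t \<in> {0<..1} \<Longrightarrow> u < cell u False t"
  by (auto simp: cell_def)

lemma cell_True_le: "u \<in> {0..1} \<Longrightarrow> t \<in> {0..1} \<Longrightarrow> cell u True t \<le> u"
  using mult_left_le[of t u] by (auto simp: cell_def)

lemma cell_coords:
  "u \<noteq> 0 \<Longrightarrow> cell u True t / u = t" "u \<noteq> 1 \<Longrightarrow> (cell u False t - u) / (1 - u) = t"
  by (auto simp: cell_def)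

lemma glue_map_cell_False:
  "u \<in> {0..1} \<Longrightarrow> u \<noteq> 1 \<Longrightarrow> t \<in> {0<..1} \<Longrightarrow> glue_map \<phi> \<psi> u (cell u False t) = cell u False (\<psi> t)"
  using cell_False_gt[of u t] by (simp add: glue_map_def cell_coords not_le)

lemma unit_cases:
  assumes "u \<in> {0..1}" "x \<in> {0..1}"
  obtains (left) t where "t \<in> {0..1}" "x = cell u True t" | (right) t where "u \<noteq> 1" "t \<in> {0<..1}" "x = cell u False t"
proof (cases "x \<le> u")
  case True
  show ?thesis
    by (rule left[of "x / u"]) (use assms True in \<open>auto simp: cell_def divide_simps\<close>)
next
  case False
  show ?thesis
    by (rule right[of "(x - u) / (1 - u)"]) (use assms False in \<open>auto simp: cell_def divide_simps\<close>)
qed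

lemma measurable_glue_map:
  assumes u: "u \<in> {0..1}" and m: "\<phi> \<in> unitM \<rightarrow>\<^sub>M unitM" "\<psi> \<in> unitM \<rightarrow>\<^sub>M unitM"
  shows "glue_map \<phi> \<psi> u \<in> unitM \<rightarrow>\<^sub>M unitM"
proof -
  define c where "c t = min 1 (max 0 t)" for t :: real
  have c: "c t \<in> {0..1}" "t \<in> {0..1} \<Longrightarrow> c t = t" for t by (auto simp: c_def)
  have cm: "(\<lambda>x. c (f x)) \<in> unitM \<rightarrow>\<^sub>M unitM" if "f \<in> borel_measurable borel" for f
  proof (rule measurable_restrict_space2)
    show "(\<lambda>z. c (f z)) \<in> unitM \<rightarrow>\<^sub>M lborel" using that by (intro measurable_restrict_space1) (simp add: c_def)
  qed (use c in auto)
  have [measurable]: "(\<lambda>x. x) \<in> unitM \<rightarrow>\<^sub>M borel" by (simp add: measurable_restrict_space1)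
  have "(\<lambda>x. if x \<le> u then cell u True (\<phi> (c (x / u))) else cell u False (\<psi> (c ((x - u) / (1 - u))))) \<in> unitM \<rightarrow>\<^sub>M unitM"
    by (intro measurable_If measurable_compose[OF _ measurable_cell[OF u]] measurable_compose[OF _ m(1)]
      measurable_compose[OF _ m(2)] cm) measurable
  moreover have "x \<in> {0..1} \<Longrightarrow> x \<le> u \<Longrightarrow> x / u \<in> {0..1}" "x \<in> {0..1} \<Longrightarrow> \<not> x \<le> u \<Longrightarrow> (x - u) / (1 - u) \<in> {0..1}" for x
    using u by (auto simp: divide_simps)
  ultimately show ?thesis
    by (subst measurable_cong[where g = "\<lambda>x. if x \<le> u then cell u True (\<phi> (c (x / u))) else cell u False (\<psi> (c ((x - u) / (1 - u))))"])
      (auto simp: glue_map_def c(2))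
qed

text \<open>On the two cells the map acts as \<open>\<phi>\<close> and \<open>\<psi>\<close> in the affine charts, so its inverse is obtained by
  combining the inverses, and it preserves uniform measure because both parts do
  (\<open>nn_integral_cells\<close>).\<close>

lemma mp_bij_glue_map:
  assumes u: "u \<in> {0..1}" and \<phi>: "mp_bij \<phi>" and \<psi>: "mp_bij \<psi>" "\<psi> 0 = 0"
  shows "mp_bij (glue_map \<phi> \<psi> u)"
proof -
  let ?i = "the_inv_into {0..1}"
  have m: "\<phi> \<in> unitM \<rightarrow>\<^sub>M unitM" "?i \<phi> \<in> unitM \<rightarrow>\<^sub>M unitM" "\<psi> \<in> unitM \<rightarrow>\<^sub>M unitM" "?i \<psi> \<in> unitM \<rightarrow>\<^sub>M unitM"
    and d: "distr unitM unitM \<phi> = unitM" "distr unitM unitM \<psi> = unitM"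
    using \<phi> \<psi> by (simp_all add: mp_bij_def)
  have i0: "?i \<psi> 0 = 0" using mp_bij_inv_left[OF \<psi>(1), of 0] \<psi>(2) by simp
  have inv: "glue_map \<phi>' \<psi>' u (glue_map \<phi> \<psi> u x) = x"
    if "mp_bij \<phi>" "mp_bij \<psi>" "\<psi> 0 = 0" "\<And>x. x \<in> {0..1} \<Longrightarrow> \<phi>' (\<phi> x) = x" "\<And>x. x \<in> {0..1} \<Longrightarrow> \<psi>' (\<psi> x) = x" "x \<in> {0..1}"
    for \<phi> \<phi>' \<psi> \<psi>' x
    using u \<open>x \<in> {0..1}\<close>
  proof (cases rule: unit_cases)
    case (left t)
    then show ?thesis using u that mp_bij_range[OF that(1), of t] by (simp add: glue_map_cell_True)
  next
    case (right t)
    have "\<psi> t \<noteq> 0" using that(5)[of t] that(5)[of 0] that(3) right by auto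
    then have "\<psi> t \<in> {0<..1}" using mp_bij_range[OF that(2), of t] right by auto
    then show ?thesis using u right that(5)[of t] by (simp add: glue_map_cell_False)
  qed
  have mg: "glue_map \<phi> \<psi> u \<in> unitM \<rightarrow>\<^sub>M unitM" by (rule measurable_glue_map[OF u m(1,3)])
  show ?thesis
  proof (rule mp_bijI[OF mg measurable_glue_map[OF u m(2,4)]])
    show "distr unitM unitM (glue_map \<phi> \<psi> u) = unitM"
    proof (rule measure_eqI)
      fix A assume "A \<in> sets (distr unitM unitM (glue_map \<phi> \<psi> u))"
      then have A [measurable]: "A \<in> sets unitM" by simp
      have Acm: "(\<lambda>t. indicator A (cell u i t) :: ennreal) \<in> borel_measurable unitM" for i
        by (rule measurable_compose[OF measurable_cell[OF u]]) simp
      have "emeasure (distr unitM unitM (glue_map \<phi> \<psi> u)) A = (\<integral>\<^sup>+x. indicator A x \<partial>distr unitM unitM (glue_map \<phi> \<psi> u))"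
        by simp
      also have "\<dots> = (\<integral>\<^sup>+x. indicator A (glue_map \<phi> \<psi> u x) \<partial>unitM)"
        by (rule nn_integral_distr[OF mg]) simp
      also have "\<dots> = ennreal u * (\<integral>\<^sup>+x. indicator A (glue_map \<phi> \<psi> u (cell u True x)) \<partial>unitM)
         + ennreal (1 - u) * (\<integral>\<^sup>+x. indicator A (glue_map \<phi> \<psi> u (cell u False x)) \<partial>unitM)"
        by (rule nn_integral_cells[OF u]) (rule measurable_compose[OF mg], simp)
      also have "(\<integral>\<^sup>+x. indicator A (glue_map \<phi> \<psi> u (cell u True x)) \<partial>unitM) = (\<integral>\<^sup>+x. indicator A (cell u True (\<phi> x)) \<partial>unitM)"
        by (rule nn_integral_cong) (use u in \<open>simp add: glue_map_cell_True\<close>)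
      also have "\<dots> = (\<integral>\<^sup>+x. indicator A (cell u True x) \<partial>distr unitM unitM \<phi>)"
        by (rule nn_integral_distr[OF m(1) , symmetric]) (simp add: Acm)
      also have "ennreal (1 - u) * (\<integral>\<^sup>+x. indicator A (glue_map \<phi> \<psi> u (cell u False x)) \<partial>unitM) =
        ennreal (1 - u) * (\<integral>\<^sup>+x. indicator A (cell u False (\<psi> x)) \<partial>unitM)"
      proof (cases "u = 1")
        case False
        have "(\<integral>\<^sup>+x. indicator A (glue_map \<phi> \<psi> u (cell u False x)) \<partial>unitM) = (\<integral>\<^sup>+x. indicator A (cell u False (\<psi> x)) \<partial>unitM)"
        proof (rule nn_integral_cong_AE)
          show "AE x in unitM. indicator A (glue_map \<phi> \<psi> u (cell u False x)) = (indicator A (cell u False (\<psi> x)) :: ennreal)"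
            using AE_unitM_finite[of "{0}", OF finite.insertI[OF finite.emptyI]] AE_space
            by eventually_elim (use u False in \<open>simp add: glue_map_cell_False\<close>)
        qed
        then show ?thesis by simp
      qed simp
      also have "(\<integral>\<^sup>+x. indicator A (cell u False (\<psi> x)) \<partial>unitM) = (\<integral>\<^sup>+x. indicator A (cell u False x) \<partial>distr unitM unitM \<psi>)"
        by (rule nn_integral_distr[OF m(3) , symmetric]) (simp add: Acm)
      also have "ennreal u * (\<integral>\<^sup>+x. indicator A (cell u True x) \<partial>distr unitM unitM \<phi>) +
          ennreal (1 - u) * (\<integral>\<^sup>+x. indicator A (cell u False x) \<partial>distr unitM unitM \<psi>) = (\<integral>\<^sup>+x. indicator A x \<partial>unitM)"
        unfolding d by (rule nn_integral_cells[OF u, symmetric]) simp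
      finally show "emeasure (distr unitM unitM (glue_map \<phi> \<psi> u)) A = emeasure unitM A" by simp
    qed simp
  qed (intro inv \<phi> \<psi> i0 mp_bij_inv mp_bij_inv_left mp_bij_inv_right; assumption)+
qed

lemma glue_fun_cell:
  assumes "u \<in> {0..1}"
  shows "u \<noteq> 0 \<Longrightarrow> x \<in> {0..1} \<Longrightarrow> y \<in> {0..1} \<Longrightarrow> glue_fun v w u s (cell u True x) (cell u True y) = v x y"
    and "u \<noteq> 1 \<Longrightarrow> x \<in> {0<..1} \<Longrightarrow> y \<in> {0<..1} \<Longrightarrow> glue_fun v w u s (cell u False x) (cell u False y) = w x y"
    and "u \<noteq> 1 \<Longrightarrow> x \<in> {0<..1} \<Longrightarrow> y \<in> {0<..1} \<Longrightarrow> glue_fun v w u s (cell u i x) (cell u (\<not> i) y) = s"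
  using cell_True_le[of u x] cell_True_le[of u y] cell_False_gt[of u x] cell_False_gt[of u y] assms
  by (cases i; auto simp: glue_fun_def cell_coords)+

text \<open>The contraction estimate. Given relabellings \<open>\<phi>\<close> and \<open>\<psi>\<close> of the two cells, the combined
  relabelling compares the glued graphons block by block; then \<open>\<phi>\<close> and \<open>\<psi>\<close> are optimised
  separately.\<close>

theorem cut_dist_glue_fun:
  assumes u: "u \<in> {0..1}" and s: "s \<in> {0..1}" and g: "graphon_fun v" "graphon_fun w" "graphon_fun v'" "graphon_fun w'"
  shows "cut_dist (glue_fun v w u s) (glue_fun v' w' u s) \<le> u\<^sup>2 * cut_dist v v' + (1 - u)\<^sup>2 * cut_dist w w'"
proof -
  have *: "cut_dist (glue_fun v w u s) (glue_fun v' w' u s) \<le>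
     u\<^sup>2 * cut_norm (\<lambda>x y. v x y - v' (\<phi> x) (\<phi> y)) + (1 - u)\<^sup>2 * cut_norm (\<lambda>x y. w x y - w' (\<psi> x) (\<psi> y))"
    if \<phi>: "mp_bij \<phi>" and \<psi>: "mp_bij \<psi>" for \<phi> \<psi>
  proof -
    \<comment> \<open>The left end \<open>u\<close> of the right cell has to stay fixed, because it belongs to the left cell.\<close>
    obtain \<psi>' N where \<psi>': "mp_bij \<psi>'" "\<psi>' 0 = 0" "finite N" "\<And>x. x \<in> {0..1} - N \<Longrightarrow> \<psi>' x = \<psi> x"
      using mp_bij_fix_zero[OF \<psi>] by blast
    let ?\<Phi> = "glue_map \<phi> \<psi>' u"
    have \<Phi>: "mp_bij ?\<Phi>" by (rule mp_bij_glue_map[OF u \<phi> \<psi>'(1,2)])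
    have \<psi>'pos: "\<psi>' x \<in> {0<..1}" if "x \<in> {0<..1}" for x
      using mp_bij_inv_left[OF \<psi>'(1), of x] mp_bij_inv_left[OF \<psi>'(1), of 0] \<psi>'(2) mp_bij_range[OF \<psi>'(1), of x] that
      by (cases "\<psi>' x = 0") auto
    have r: "\<phi> x \<in> {0..1}" if "x \<in> {0<..1}" for x using mp_bij_range[OF \<phi>, of x] that by simp
    have gg: "graphon_fun (glue_fun v w u s)" "graphon_fun (glue_fun v' w' u s)"
      using graphon_fun_glue_fun g u s by auto
    have "cut_dist (glue_fun v w u s) (glue_fun v' w' u s) \<le>
        cut_norm (\<lambda>x y. glue_fun v w u s x y - glue_fun v' w' u s (?\<Phi> x) (?\<Phi> y))"
      using gg \<Phi> by (rule cut_dist_lower)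
    also have "\<dots> \<le> u\<^sup>2 * cut_norm (\<lambda>x y. v x y - v' (\<phi> x) (\<phi> y)) + (1 - u)\<^sup>2 * cut_norm (\<lambda>x y. w x y - w' (\<psi>' x) (\<psi>' y))"
    proof (rule cut_norm_cells[OF u])
      fix x y :: real and i assume "u \<noteq> 0" "u \<noteq> 1" and xy: "x \<in> {0<..1}" "y \<in> {0<..1}"
      then show "glue_fun v w u s (cell u i x) (cell u (\<not> i) y) -
           glue_fun v' w' u s (?\<Phi> (cell u i x)) (?\<Phi> (cell u (\<not> i) y)) = 0"
        using u \<psi>'pos[OF xy(1)] \<psi>'pos[OF xy(2)] r[OF xy(1)] r[OF xy(2)] cell_True_le[of u "\<phi> x"] cell_True_le[of u "\<phi> y"]
          cell_False_gt[of u "\<psi>' x"] cell_False_gt[of u "\<psi>' y"] glue_fun_cell(3)[of u x y v w s i]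
        by (cases i) (auto simp: glue_map_cell_True glue_map_cell_False, auto simp: glue_fun_def)
    qed (use u \<psi>'pos r g \<phi> \<psi>' \<Phi> gg in \<open>auto simp: glue_map_cell_True glue_map_cell_False glue_fun_cell kern_diff_comp\<close>)
    also have "cut_norm (\<lambda>x y. w x y - w' (\<psi>' x) (\<psi>' y)) = cut_norm (\<lambda>x y. w x y - w' (\<psi> x) (\<psi> y))"
      by (rule cut_norm_cong_cofinite[OF _ _ \<psi>'(3)]) (use g \<psi> \<psi>' in \<open>auto intro!: kern_diff_comp\<close>)
    finally show ?thesis .
  qed
  \<comment> \<open>Passing to the infimum over one relabelling with the other one fixed; the weight \<open>a\<close> may be zero.\<close>
  have inf_le: "a * cut_dist x y + b \<ge> c" if "0 \<le> a" "\<And>\<phi>. mp_bij \<phi> \<Longrightarrow> c \<le> a * cut_norm (\<lambda>s t. x s t - y (\<phi> s) (\<phi> t)) + b"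
    for a b c x y
  proof (cases "a = 0")
    case True then show ?thesis using that(2)[OF mp_bij_id] by simp
  next
    case False
    have "(c - b) / a \<le> cut_dist x y"
      by (rule cut_dist_greatest) (use that False in \<open>auto simp: divide_simps algebra_simps\<close>)
    then show ?thesis using that(1) False by (auto simp: divide_simps algebra_simps split: if_splits)
  qed
  have "cut_dist (glue_fun v w u s) (glue_fun v' w' u s) \<le> u\<^sup>2 * cut_dist v v' + (1 - u)\<^sup>2 * cut_norm (\<lambda>x y. w x y - w' (\<psi> x) (\<psi> y))"
    if "mp_bij \<psi>" for \<psi>
    by (rule inf_le) (use * that in auto)
  then have "cut_dist (glue_fun v w u s) (glue_fun v' w' u s) \<le> (1 - u)\<^sup>2 * cut_dist w w' + u\<^sup>2 * cut_dist v v'"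
    by (intro inf_le) (auto simp: add.commute)
  then show ?thesis by simp
qed


section \<open>Separability of the space of graphons\<close>

definition l1_dist :: "(real \<Rightarrow> real \<Rightarrow> real) \<Rightarrow> (real \<Rightarrow> real \<Rightarrow> real) \<Rightarrow> real" where
  "l1_dist v w = (LINT z|(unitM \<Otimes>\<^sub>M unitM). \<bar>v (fst z) (snd z) - w (fst z) (snd z)\<bar>)"

definition clip :: "real \<Rightarrow> real" where "clip t = min 1 (max 0 t)"

lemma clip: "clip t \<in> {0..1}" "t \<in> {0..1} \<Longrightarrow> clip t = t"
  by (auto simp: clip_def)

lemma measurable_clip [measurable]: "clip \<in> borel_measurable borel"
  unfolding clip_def by measurable

lemma measurable_clip_unitM: "f \<in> borel_measurable L \<Longrightarrow> (\<lambda>z. clip (f z)) \<in> L \<rightarrow>\<^sub>M unitM"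
  by (rule measurable_restrict_space2) (use clip in auto)

lemma measurable_unitM_real: "(\<lambda>x. x) \<in> unitM \<rightarrow>\<^sub>M borel"
  by (simp add: measurable_restrict_space1)

text \<open>Graphon functions without the symmetry requirement; the approximating step functions need not
  be symmetric.\<close>

definition unit_kernel :: "(real \<Rightarrow> real \<Rightarrow> real) \<Rightarrow> bool" where
  "unit_kernel w \<longleftrightarrow> (\<lambda>z. w (fst z) (snd z)) \<in> borel_measurable (unitM \<Otimes>\<^sub>M unitM) \<and>
    (\<forall>x\<in>{0..1}. \<forall>y\<in>{0..1}. w x y \<in> {0..1})"

lemma unit_kernel_graphon_fun: "graphon_fun w \<Longrightarrow> unit_kernel w"
  by (auto simp: graphon_fun_def unit_kernel_def case_prod_unfold)

lemma integrable_l1: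
  assumes "unit_kernel v" "unit_kernel w"
  shows "integrable (unitM \<Otimes>\<^sub>M unitM) (\<lambda>z. \<bar>v (fst z) (snd z) - w (fst z) (snd z)\<bar>)"
proof -
  interpret prob_space "unitM \<Otimes>\<^sub>M unitM" by (rule prob_space_unitM2)
  have "\<bar>a - b\<bar> \<le> 1" if "a \<in> {0..1}" "b \<in> {0..1}" for a b :: real using that by auto
  then show ?thesis
    using assms by (intro integrable_const_bound[where B = 1]) (auto simp: unit_kernel_def space_pair_measure)
qed

lemma l1_dist_triangle:
  assumes "unit_kernel u" "unit_kernel v" "unit_kernel w"
  shows "l1_dist u w \<le> l1_dist u v + l1_dist v w"
proof -
  have "l1_dist u w \<le> (LINT z|(unitM \<Otimes>\<^sub>M unitM). \<bar>u (fst z) (snd z) - v (fst z) (snd z)\<bar> + \<bar>v (fst z) (snd z) - w (fst z) (snd z)\<bar>)"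
    unfolding l1_dist_def by (intro integral_mono) (use assms in \<open>auto intro!: integrable_l1\<close>)
  also have "\<dots> = l1_dist u v + l1_dist v w"
    unfolding l1_dist_def using assms by (intro Bochner_Integration.integral_add integrable_l1)
  finally show ?thesis .
qed

lemma l1_dist_commute: "l1_dist v w = l1_dist w v"
  by (simp add: l1_dist_def abs_minus_commute)

lemma cut_dist_le_l1:
  assumes "graphon_fun v" "graphon_fun w"
  shows "cut_dist v w \<le> l1_dist v w"
proof -
  have "cut_dist v w \<le> cut_norm (\<lambda>x y. v x y - w x y)"
    using cut_dist_lower[OF assms mp_bij_id] .
  also have "\<dots> \<le> l1_dist v w"
  proof (rule cut_norm_least)
    fix A B assume AB: "A \<in> sets unitM" "B \<in> sets unitM"
    have "\<bar>LINT (x, y):A \<times> B|unitM \<Otimes>\<^sub>M unitM. v x y - w x y\<bar> \<le>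
       (LINT z|(unitM \<Otimes>\<^sub>M unitM). \<bar>indicator (A \<times> B) z *\<^sub>R (case z of (x, y) \<Rightarrow> v x y - w x y)\<bar>)"
      unfolding set_lebesgue_integral_def by (rule integral_abs_bound)
    also have "\<dots> \<le> l1_dist v w"
      unfolding l1_dist_def using integrable_kern[OF kern_diff[OF assms] AB]
      by (intro integral_mono integrable_l1 integrable_abs unit_kernel_graphon_fun assms)
        (auto simp: set_integrable_def indicator_def)
    finally show "\<bar>LINT (x, y):A \<times> B|unitM \<Otimes>\<^sub>M unitM. v x y - w x y\<bar> \<le> l1_dist v w" .
  qed
  finally show ?thesis .
qed

text \<open>Transfers null sets of the plane to the unit square, which is needed to use the approximation
  theory of Lebesgue measurable functions.\<close>

lemma AE_unitM2_lborel:
  assumes "AE z in lborel. P (z :: real \<times> real)"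
  shows "AE z in unitM \<Otimes>\<^sub>M unitM. P z"
proof -
  interpret U: prob_space unitM by (rule prob_space_unitM)
  interpret UU: pair_prob_space unitM unitM ..
  from assms obtain N where N: "{z \<in> space lborel. \<not> P z} \<subseteq> N" "emeasure lborel N = 0" "N \<in> sets lborel"
    by (rule AE_E)
  have "AE z in lborel \<Otimes>\<^sub>M lborel. z \<notin> N"
    unfolding lborel_prod by (rule AE_not_in) (use N in auto)
  from lborel_pair.AE_pair[OF this] have ae: "AE x in lborel. AE y in lborel. (x, y) \<notin> N" .
  have "(\<lambda>z. (fst z, snd z)) \<in> unitM \<Otimes>\<^sub>M unitM \<rightarrow>\<^sub>M (borel \<Otimes>\<^sub>M borel :: (real \<times> real) measure)"
    using measurable_compose[OF measurable_fst measurable_unitM_real] measurable_compose[OF measurable_snd measurable_unitM_real]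
    by (rule measurable_Pair)
  moreover have "- N \<in> sets (borel \<Otimes>\<^sub>M borel)" unfolding borel_prod using N(3) by (intro borel_comp) simp
  ultimately have "(\<lambda>z. (fst z, snd z)) -` (- N) \<inter> space (unitM \<Otimes>\<^sub>M unitM) \<in> sets (unitM \<Otimes>\<^sub>M unitM)"
    by (rule measurable_sets)
  then have "{z \<in> space (unitM \<Otimes>\<^sub>M unitM). z \<notin> N} \<in> sets (unitM \<Otimes>\<^sub>M unitM)"
    by (simp add: vimage_def Int_def conj_commute)
  moreover have "AE x in unitM. AE y in unitM. (x, y) \<notin> N"
    using ae by (auto simp: AE_restrict_space_iff)
  ultimately have "AE z in unitM \<Otimes>\<^sub>M unitM. z \<notin> N" by (rule UU.AE_pair_measure)
  then show ?thesis by eventually_elim (use N(1) in auto)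
qed

text \<open>A Lebesgue measurable function is an almost everywhere limit of continuous functions; clipping the
  values keeps them in \<open>[0,1]\<close>.\<close>

lemma unit_kernel_limit_continuous:
  assumes "unit_kernel w"
  obtains h :: "nat \<Rightarrow> real \<times> real \<Rightarrow> real" where "\<And>n. continuous_on UNIV (h n)" "\<And>n z. h n z \<in> {0..1}"
    "AE z in unitM \<Otimes>\<^sub>M unitM. (\<lambda>n. h n z) \<longlonglongrightarrow> w (fst z) (snd z)"
proof -
  define f where "f z = (w (clip (fst z)) (clip (snd z)) :: real)" for z :: "real \<times> real"
  have w: "(\<lambda>z. w (fst z) (snd z)) \<in> borel_measurable (unitM \<Otimes>\<^sub>M unitM)" using assms by (simp add: unit_kernel_def)
  have "(\<lambda>z :: real \<times> real. (clip (fst z), clip (snd z))) \<in> borel \<rightarrow>\<^sub>M unitM \<Otimes>\<^sub>M unitM"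
    by (intro measurable_Pair measurable_clip_unitM) (auto simp: borel_prod[symmetric])
  from measurable_compose[OF this w] have "f \<in> borel_measurable borel" by (simp add: f_def[abs_def])
  then have "f \<in> borel_measurable lebesgue" by (simp add: measurable_completion)
  then have "f measurable_on UNIV" by (rule lebesgue_measurable_imp_measurable_on) simp
  then obtain N g where N: "negligible N" and g: "\<And>n. continuous_on UNIV (g n)"
    and lim: "\<And>z. z \<notin> N \<Longrightarrow> (\<lambda>n. g n z) \<longlonglongrightarrow> f z"
    unfolding measurable_on_def by auto
  show ?thesis
  proof (rule that[of "\<lambda>n z. clip (g n z)"])
    show "continuous_on UNIV (\<lambda>z. clip (g n z))" for n
      unfolding clip_def by (intro continuous_intros g)
    have "AE z in lebesgue. z \<notin> N" by (rule AE_not_in) (use N in \<open>simp add: negligible_iff_null_sets\<close>)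
    then have "AE z in lborel. z \<notin> N" by (simp add: AE_completion_iff)
    then have "AE z in unitM \<Otimes>\<^sub>M unitM. z \<notin> N" by (rule AE_unitM2_lborel)
    then show "AE z in unitM \<Otimes>\<^sub>M unitM. (\<lambda>n. clip (g n z)) \<longlonglongrightarrow> w (fst z) (snd z)"
      using AE_space
    proof eventually_elim
      fix z assume z: "z \<notin> N" "z \<in> space (unitM \<Otimes>\<^sub>M unitM)"
      have "(\<lambda>n. clip (g n z)) \<longlonglongrightarrow> clip (f z)"
        unfolding clip_def by (intro tendsto_intros lim z)
      also have "clip (f z) = w (fst z) (snd z)"
        using z(2) assms by (auto simp: f_def clip(2) space_pair_measure unit_kernel_def)
      finally show "(\<lambda>n. clip (g n z)) \<longlonglongrightarrow> w (fst z) (snd z)" .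
    qed
  qed (rule clip)
qed

lemma unit_kernel_continuous:
  assumes "continuous_on UNIV h" "\<And>z. h z \<in> {0..1}"
  shows "unit_kernel (\<lambda>x y. h (x, y))"
proof -
  have "(\<lambda>z. (fst z, snd z)) \<in> unitM \<Otimes>\<^sub>M unitM \<rightarrow>\<^sub>M (borel \<Otimes>\<^sub>M borel :: (real \<times> real) measure)"
    using measurable_compose[OF measurable_fst measurable_unitM_real] measurable_compose[OF measurable_snd measurable_unitM_real]
    by (rule measurable_Pair)
  then have "(\<lambda>z. z) \<in> unitM \<Otimes>\<^sub>M unitM \<rightarrow>\<^sub>M (borel :: (real \<times> real) measure)" by (simp add: borel_prod)
  from measurable_compose[OF this borel_measurable_continuous_onI[OF assms(1)]] assms(2)
  show ?thesis by (simp add: unit_kernel_def)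
qed

lemma l1_dense_continuous:
  assumes "unit_kernel w" "0 < e"
  obtains h :: "real \<times> real \<Rightarrow> real" where "continuous_on UNIV h" "\<And>z. h z \<in> {0..1}" "l1_dist w (\<lambda>x y. h (x, y)) < e"
proof -
  interpret prob_space "unitM \<Otimes>\<^sub>M unitM" by (rule prob_space_unitM2)
  obtain h :: "nat \<Rightarrow> real \<times> real \<Rightarrow> real" where h: "\<And>n. continuous_on UNIV (h n)" "\<And>n z. h n z \<in> {0..1}"
    and lim: "AE z in unitM \<Otimes>\<^sub>M unitM. (\<lambda>n. h n z) \<longlonglongrightarrow> w (fst z) (snd z)"
    using unit_kernel_limit_continuous[OF assms(1)] by blast
  have hk: "unit_kernel (\<lambda>x y. h n (x, y))" for n using h by (rule unit_kernel_continuous)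
  have "(\<lambda>n. l1_dist w (\<lambda>x y. h n (x, y))) \<longlonglongrightarrow> (LINT z|(unitM \<Otimes>\<^sub>M unitM). 0)"
    unfolding l1_dist_def
  proof (rule integral_dominated_convergence[where w = "\<lambda>_. 1"])
    show "(\<lambda>z. \<bar>w (fst z) (snd z) - h n (fst z, snd z)\<bar>) \<in> borel_measurable (unitM \<Otimes>\<^sub>M unitM)" for n
      using integrable_l1[OF assms(1) hk[of n]] by simp
    show "AE z in unitM \<Otimes>\<^sub>M unitM. (\<lambda>n. \<bar>w (fst z) (snd z) - h n (fst z, snd z)\<bar>) \<longlonglongrightarrow> 0"
      using lim
    proof eventually_elim
      case (elim z)
      have "(\<lambda>n. \<bar>w (fst z) (snd z) - h n z\<bar>) \<longlonglongrightarrow> \<bar>w (fst z) (snd z) - w (fst z) (snd z)\<bar>"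
        by (intro tendsto_intros elim)
      then show ?case by simp
    qed
    have *: "\<bar>a - b\<bar> \<le> 1" if "a \<in> {0..1}" "b \<in> {0..1}" for a b :: real using that by auto
    show "AE z in unitM \<Otimes>\<^sub>M unitM. norm \<bar>w (fst z) (snd z) - h n (fst z, snd z)\<bar> \<le> 1" for n
      using assms(1) h(2) by (intro AE_I2) (auto simp: unit_kernel_def space_pair_measure intro!: *)
  qed auto
  then have "(\<lambda>n. l1_dist w (\<lambda>x y. h n (x, y))) \<longlonglongrightarrow> 0" by simp
  from order_tendstoD(2)[OF this assms(2)] obtain n where "l1_dist w (\<lambda>x y. h n (x, y)) < e"
    by (auto simp: eventually_sequentially)
  then show ?thesis using h that by blast
qed

text \<open>A step function on the grid of mesh \<open>1/n\<close>. The rational values are stored row by row in a list, which makes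
  the family countable for trivial reasons; clipping makes every code meaningful.\<close>

definition grid_step :: "nat \<times> rat list \<Rightarrow> real \<Rightarrow> real \<Rightarrow> real" where
  "grid_step = (\<lambda>(n, qs) x y. clip (of_rat (qs ! (nat \<lfloor>n * x\<rfloor> * Suc n + nat \<lfloor>n * y\<rfloor>))))"

lemma unit_kernel_grid_step: "unit_kernel (grid_step c)"
proof -
  obtain n qs where c: "c = (n, qs)" by force
  note measurable_unitM_real [measurable]
  have 1: "(\<lambda>x. nat \<lfloor>n * x\<rfloor>) \<in> unitM \<rightarrow>\<^sub>M count_space UNIV"
    by measurable
  have m: "(\<lambda>z. nat \<lfloor>n * fst z\<rfloor>) \<in> unitM \<Otimes>\<^sub>M unitM \<rightarrow>\<^sub>M count_space UNIV"
       "(\<lambda>z. nat \<lfloor>n * snd z\<rfloor>) \<in> unitM \<Otimes>\<^sub>M unitM \<rightarrow>\<^sub>M count_space UNIV"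
    using measurable_compose[OF measurable_fst 1] measurable_compose[OF measurable_snd 1] by auto
  have "(\<lambda>z. grid_step c (fst z) (snd z)) \<in> borel_measurable (unitM \<Otimes>\<^sub>M unitM)"
    unfolding grid_step_def c prod.case
  proof (rule measurable_compose_countable[where f = "\<lambda>i (z :: real \<times> real). clip (of_rat (qs ! (i * Suc n + nat \<lfloor>n * snd z\<rfloor>)))"
      and g = "\<lambda>z :: real \<times> real. nat \<lfloor>n * fst z\<rfloor>"])
    show "(\<lambda>z. clip (of_rat (qs ! (i * Suc n + nat \<lfloor>n * snd z\<rfloor>)))) \<in> borel_measurable (unitM \<Otimes>\<^sub>M unitM)" for i
      by (rule measurable_compose[OF m(2), of "\<lambda>j. clip (of_rat (qs ! (i * Suc n + j)))"]) simp
  qed (rule m(1))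
  then show ?thesis using clip by (auto simp: unit_kernel_def grid_step_def c)
qed

text \<open>Approximate by a continuous function, then use its uniform continuity on the unit square: on each
  grid square it is close to a rational number.\<close>

lemma l1_dense_grid_step:
  assumes "unit_kernel w" "0 < e"
  obtains c where "l1_dist w (grid_step c) < e"
proof -
  interpret prob_space "unitM \<Otimes>\<^sub>M unitM" by (rule prob_space_unitM2)
  obtain h :: "real \<times> real \<Rightarrow> real" where h: "continuous_on UNIV h" "\<And>z. h z \<in> {0..1}"
    and wh: "l1_dist w (\<lambda>x y. h (x, y)) < e / 3"
    using l1_dense_continuous[OF assms(1), of "e / 3"] assms(2) by auto
  have "uniformly_continuous_on ({0..1} \<times> {0..1}) h"
    by (intro compact_uniformly_continuous continuous_on_subset[OF h(1)] compact_Times) auto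
  then obtain d where d: "0 < d" and hd: "\<And>z z'. z \<in> {0..1} \<times> {0..1} \<Longrightarrow> z' \<in> {0..1} \<times> {0..1} \<Longrightarrow> dist z' z < d \<Longrightarrow> dist (h z') (h z) < e / 6"
    using assms(2) unfolding uniformly_continuous_on_def by (elim allE[of _ "e / 6"]) auto
  obtain n where n: "n > 0" "2 / real n < d"
  proof -
    obtain m :: nat where m: "2 / d < real m" using reals_Archimedean2 by blast
    then have "0 < real m" using d by (smt (verit) divide_pos_pos)
    with m d show ?thesis by (intro that[of m]) (auto simp: field_simps)
  qed
  have "\<exists>q :: rat. \<bar>of_rat q - h z\<bar> < e / 6" for z
  proof -
    obtain r where "h z < of_rat r" "of_rat r < h z + e / 6"
      using of_rat_dense[of "h z" "h z + e / 6"] assms(2) by auto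
    then show ?thesis by (intro exI[of _ r]) auto
  qed
  then obtain q :: "real \<times> real \<Rightarrow> rat" where q: "\<And>z. \<bar>of_rat (q z) - h z\<bar> < e / 6" using choice[of "\<lambda>z r. \<bar>of_rat r - h z\<bar> < e / 6"] by blast
  define qs where "qs = map (\<lambda>k. q (real (k div Suc n) / n, real (k mod Suc n) / n)) [0..<Suc n * Suc n]"
  have close: "\<bar>h (x, y) - grid_step (n, qs) x y\<bar> \<le> e / 3" if xy: "x \<in> {0..1}" "y \<in> {0..1}" for x y
  proof -
    define i j where "i = nat \<lfloor>n * x\<rfloor>" and "j = nat \<lfloor>n * y\<rfloor>"
    have fl: "real (nat \<lfloor>n * t\<rfloor>) / n \<le> t" "t < real (nat \<lfloor>n * t\<rfloor>) / n + 1 / n" "nat \<lfloor>n * t\<rfloor> \<le> n" if "t \<in> {0..1}" for t :: real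
    proof -
      have r: "real (nat \<lfloor>n * t\<rfloor>) = of_int \<lfloor>n * t\<rfloor>" using that by simp
      have "of_int \<lfloor>n * t\<rfloor> \<le> n * t" "n * t < of_int \<lfloor>n * t\<rfloor> + 1" by linarith+
      then show "real (nat \<lfloor>n * t\<rfloor>) / n \<le> t" "t < real (nat \<lfloor>n * t\<rfloor>) / n + 1 / n"
        unfolding r using n(1) by (auto simp: field_simps)
      have "n * t \<le> n" using that by (simp add: mult_left_le)
      then show "nat \<lfloor>n * t\<rfloor> \<le> n" by linarith
    qed
    have ij: "i \<le> n" "j \<le> n" using fl xy by (auto simp: i_def j_def)
    have k: "i * Suc n + j < Suc n * Suc n"
    proof -
      have "i * Suc n + j < i * Suc n + Suc n" using ij by simp
      also have "\<dots> = Suc i * Suc n" by simp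
      also have "\<dots> \<le> Suc n * Suc n" using ij by (intro mult_le_mono) auto
      finally show ?thesis .
    qed
    \<comment> \<open>The coordinate \<open>1\<close> has grid index \<open>n\<close>, so rows have length \<open>Suc n\<close> and indices are at most \<open>n\<close>.\<close>
    have dm: "(i * Suc n + j) div Suc n = i" "(i * Suc n + j) mod Suc n = j" using ij
      by (simp_all add: div_mult_self3 mod_mult_self3 del: mult_Suc_right)
    have "qs ! (i * Suc n + j) = q (real i / n, real j / n)"
      unfolding qs_def using k dm by (simp del: mult_Suc_right mult_Suc)
    then have g: "grid_step (n, qs) x y = clip (of_rat (q (real i / n, real j / n)))"
      by (simp add: grid_step_def i_def[symmetric] j_def[symmetric] del: mult_Suc_right)
    have "\<bar>clip a - b\<bar> \<le> \<bar>a - b\<bar>" if "b \<in> {0..1}" for a b using that by (auto simp: clip_def)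
    then have 1: "\<bar>grid_step (n, qs) x y - h (real i / n, real j / n)\<bar> < e / 6"
      unfolding g by (rule order_le_less_trans[OF _ q]) (rule h(2))
    have "dist (real i / n, real j / n) (x, y) \<le> dist (real i / n) x + dist (real j / n) y"
      unfolding dist_Pair_Pair by (rule order_trans[OF sqrt_add_le_add_sqrt]) auto
    also have "\<dots> \<le> 1 / n + 1 / n" using fl[OF xy(1)] fl[OF xy(2)] by (auto simp: dist_real_def i_def j_def)
    also have "\<dots> < d" using n by simp
    finally have "dist (h (real i / n, real j / n)) (h (x, y)) < e / 6"
      by (rule hd[rotated 2]) (use xy fl[OF xy(1)] fl[OF xy(2)] ij n in \<open>auto simp: divide_simps\<close>)
    then show ?thesis using 1 unfolding dist_real_def by linarith
  qed
  have "l1_dist (\<lambda>x y. h (x, y)) (grid_step (n, qs)) \<le> e / 3"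
    unfolding l1_dist_def
    by (rule integral_le_const) (use close integrable_l1[OF unit_kernel_continuous[OF h] unit_kernel_grid_step] in \<open>auto simp: space_pair_measure\<close>)
  then have "l1_dist w (grid_step (n, qs)) < e"
    using l1_dist_triangle[OF assms(1) unit_kernel_continuous[OF h] unit_kernel_grid_step, of "(n, qs)"] wh assms(2) by linarith
  then show ?thesis by (rule that)
qed

text \<open>A subset of a separable space is separable: near each step function pick a graphon function if
  there is one. The code \<open>k\<close> stands for a precision \<open>1 / Suc m\<close> together with a step function. This avoids
  symmetrising the step functions.\<close>

definition dense_graphon_fun :: "nat \<Rightarrow> real \<Rightarrow> real \<Rightarrow> real" where
  "dense_graphon_fun k = (let (m :: nat, c) = from_nat k in
     if \<exists>w. graphon_fun w \<and> l1_dist w (grid_step c) < 1 / Suc m then SOME w. graphon_fun w \<and> l1_dist w (grid_step c) < 1 / Suc m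
     else (\<lambda>_ _. 0))"

lemma graphon_fun_dense: "graphon_fun (dense_graphon_fun k)"
proof -
  obtain m :: nat and c :: "nat \<times> rat list" where k: "from_nat k = (m, c)" by (cases "from_nat k :: nat \<times> nat \<times> rat list")
  have "graphon_fun (\<lambda>_ _. 0)" by (simp add: graphon_fun_def)
  then show ?thesis
    using someI_ex[of "\<lambda>w. graphon_fun w \<and> l1_dist w (grid_step c) < 1 / Suc m"] unfolding dense_graphon_fun_def k by auto
qed

lemma dense_graphon_fun:
  assumes w: "graphon_fun w" and e: "0 < e"
  obtains k where "l1_dist w (dense_graphon_fun k) < e"
proof -
  obtain m where m: "inverse (Suc m) < e / 2" using reals_Archimedean[of "e / 2"] e by auto
  obtain c where c: "l1_dist w (grid_step c) < 1 / Suc m"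
    using l1_dense_grid_step[OF unit_kernel_graphon_fun[OF w], of "1 / Suc m"] by auto
  define k where "k = to_nat (m, c)"
  have k: "from_nat k = (m, c)" by (simp add: k_def)
  have ex: "\<exists>w. graphon_fun w \<and> l1_dist w (grid_step c) < 1 / Suc m" using w c by blast
  from someI_ex[OF this] ex have "l1_dist (dense_graphon_fun k) (grid_step c) < 1 / Suc m"
    unfolding dense_graphon_fun_def k by auto
  then have "l1_dist w (dense_graphon_fun k) < e"
    using l1_dist_triangle[OF unit_kernel_graphon_fun[OF w] unit_kernel_grid_step[of c] unit_kernel_graphon_fun[OF graphon_fun_dense[of k]]]
      c m by (simp add: l1_dist_commute[of "grid_step c"] inverse_eq_divide)
  then show ?thesis by (rule that)
qed

lemma weakly_isomorphic_refl: "graphon_fun w \<Longrightarrow> weakly_isomorphic w w"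
  by (simp add: weakly_isomorphic_def cut_dist_refl)

lemma dist_abs_graphon:
  "graphon_fun v \<Longrightarrow> graphon_fun w \<Longrightarrow> dist (abs_graphon v) (abs_graphon w) = cut_dist v w"
  by (simp add: dist_graphon.abs_eq weakly_isomorphic_refl)

lemma graphon_fun_rep: "graphon_fun (rep_graphon W)"
  using Quotient3_rep_reflp[OF Quotient3_graphon, of W] by (simp add: weakly_isomorphic_def)

lemma abs_rep_graphon: "abs_graphon (rep_graphon W) = W"
  by (rule Quotient3_abs_rep[OF Quotient3_graphon])

lemma dist_graphon_rep: "dist V W = cut_dist (rep_graphon V) (rep_graphon W)"
  using dist_abs_graphon[OF graphon_fun_rep graphon_fun_rep, of V W] by (simp add: abs_rep_graphon)

definition dense_graphon :: "nat \<Rightarrow> graphon" where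
  "dense_graphon k = abs_graphon (dense_graphon_fun k)"

lemma dense_graphon:
  assumes "0 < e" obtains k where "dist (dense_graphon k) W < e"
proof -
  obtain k where "l1_dist (rep_graphon W) (dense_graphon_fun k) < e" using dense_graphon_fun[OF graphon_fun_rep assms] by blast
  moreover have "dist W (dense_graphon k) = cut_dist (rep_graphon W) (dense_graphon_fun k)"
    using dist_abs_graphon[OF graphon_fun_rep graphon_fun_dense, of W k] by (simp add: abs_rep_graphon dense_graphon_def)
  ultimately have "dist (dense_graphon k) W < e"
    using cut_dist_le_l1[OF graphon_fun_rep graphon_fun_dense, of W k] by (simp add: dist_commute)
  then show ?thesis by (rule that)
qed

instance graphon :: second_countable_topology
proof
  define B where "B = (\<lambda>(k, n :: nat). ball (dense_graphon k) (1 / Suc n)) ` UNIV"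
  have "topological_basis B"
  proof (rule topological_basisI)
    fix O' :: "graphon set" and W assume "open O'" "W \<in> O'"
    then obtain e where e: "0 < e" "ball W e \<subseteq> O'" by (auto simp: open_contains_ball)
    obtain n where n: "inverse (Suc n) < e / 2" using reals_Archimedean[of "e / 2"] e by auto
    obtain k where k: "dist (dense_graphon k) W < 1 / Suc n" using dense_graphon[of "1 / Suc n"] by auto
    have "ball (dense_graphon k) (1 / Suc n) \<subseteq> ball W e"
    proof
      fix V assume "V \<in> ball (dense_graphon k) (1 / Suc n)"
      then show "V \<in> ball W e" using k n dist_triangle2[of W V "dense_graphon k"]
        by (simp add: inverse_eq_divide dist_commute)
    qed
    then show "\<exists>B'\<in>B. W \<in> B' \<and> B' \<subseteq> O'" using e k by (auto simp: B_def dist_commute)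
  qed (auto simp: B_def)
  then show "\<exists>B :: graphon set set. countable B \<and> open = generate_topology B"
    using topological_basis_imp_subbasis[of B] by (intro exI[of _ B]) (auto simp: B_def)
qed

text \<open>The map into graphons is a limit of maps with countable range: replace \<open>h \<omega>\<close> by the first member
  of the dense sequence within \<open>L\<^sup>1\<close> distance \<open>1 / Suc n\<close>. This choice is measurable in \<open>\<omega>\<close> because \<open>L\<^sup>1\<close>
  distances, unlike cut distances, are integrals and hence measurable by Fubini.\<close>

lemma borel_measurable_abs_graphon:
  assumes g: "\<And>\<omega>. \<omega> \<in> space \<Omega> \<Longrightarrow> graphon_fun (h \<omega>)"
    and m: "(\<lambda>(\<omega>, z). h \<omega> (fst z) (snd z)) \<in> borel_measurable (\<Omega> \<Otimes>\<^sub>M (unitM \<Otimes>\<^sub>M unitM))"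
  shows "(\<lambda>\<omega>. abs_graphon (h \<omega>)) \<in> borel_measurable \<Omega>"
proof -
  interpret prob_space "unitM \<Otimes>\<^sub>M unitM" by (rule prob_space_unitM2)
  note [measurable] = m
  have dm: "(\<lambda>z. dense_graphon_fun k (fst z) (snd z)) \<in> borel_measurable (unitM \<Otimes>\<^sub>M unitM)" for k
    using unit_kernel_graphon_fun[OF graphon_fun_dense] by (simp add: unit_kernel_def)
  have l1: "(\<lambda>\<omega>. l1_dist (h \<omega>) (dense_graphon_fun k)) \<in> borel_measurable \<Omega>" for k
    unfolding l1_dist_def
  proof (rule borel_measurable_lebesgue_integral)
    show "(\<lambda>(\<omega>, z). \<bar>h \<omega> (fst z) (snd z) - dense_graphon_fun k (fst z) (snd z)\<bar>) \<in> borel_measurable (\<Omega> \<Otimes>\<^sub>M (unitM \<Otimes>\<^sub>M unitM))"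
      using m measurable_compose[OF measurable_snd dm[of k], of \<Omega>] unfolding case_prod_unfold
      by (intro borel_measurable_abs borel_measurable_diff)
  qed
  define k where "k n \<omega> = (LEAST k. l1_dist (h \<omega>) (dense_graphon_fun k) < 1 / Suc n)" for n \<omega>
  have k: "l1_dist (h \<omega>) (dense_graphon_fun (k n \<omega>)) < 1 / Suc n" if w: "\<omega> \<in> space \<Omega>" for n \<omega>
  proof -
    obtain j where "l1_dist (h \<omega>) (dense_graphon_fun j) < 1 / Suc n"
      using dense_graphon_fun[OF g[OF w], of "1 / Suc n"] by auto
    then show ?thesis unfolding k_def by (rule LeastI)
  qed
  have km [measurable]: "k n \<in> \<Omega> \<rightarrow>\<^sub>M count_space UNIV" for n
    unfolding k_def[abs_def] using l1 by (intro measurable_Least) simp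
  show ?thesis
  proof (rule borel_measurable_LIMSEQ_metric)
    show "(\<lambda>\<omega>. dense_graphon (k n \<omega>)) \<in> borel_measurable \<Omega>" for n
      by (rule measurable_compose[OF km]) simp
    fix \<omega> assume w: "\<omega> \<in> space \<Omega>"
    have "dist (dense_graphon (k n \<omega>)) (abs_graphon (h \<omega>)) < 1 / Suc n" for n
      using cut_dist_le_l1[OF g[OF w] graphon_fun_dense, of "k n \<omega>"] k[OF w, of n]
      by (simp add: dense_graphon_def dist_commute[of "abs_graphon (dense_graphon_fun _)"] dist_abs_graphon[OF g[OF w] graphon_fun_dense])
    then show "(\<lambda>n. dense_graphon (k n \<omega>)) \<longlonglongrightarrow> abs_graphon (h \<omega>)"
      unfolding tendsto_dist_iff[of _ "abs_graphon (h \<omega>)"]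
      by (intro tendsto_sandwich[OF _ _ tendsto_const LIMSEQ_inverse_real_of_nat] always_eventually allI)
         (auto simp: inverse_eq_divide intro: less_imp_le)
  qed
qed


section \<open>Measurability of gluing\<close>

lemma dist_glue:
  assumes u: "u \<in> {0..1}"
  shows "dist (glue V W u s) (glue V' W' u s) \<le> u\<^sup>2 * dist V V' + (1 - u)\<^sup>2 * dist W W'"
proof -
  define b :: real where "b = of_bool s"
  have s: "b \<in> {0..1}" by (simp add: b_def)
  note g = graphon_fun_rep
  show ?thesis
    unfolding glue_def b_def[symmetric] dist_abs_graphon[OF graphon_fun_glue_fun[OF g g u s] graphon_fun_glue_fun[OF g g u s]]
      dist_graphon_rep[of V] dist_graphon_rep[of W]
    by (rule cut_dist_glue_fun[OF u s g g g g])
qed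

text \<open>Gluing does not depend on the choice of representatives, by the contraction estimate at distance
  zero.\<close>

lemma glue_abs_graphon:
  assumes u: "u \<in> {0..1}" and g: "graphon_fun v" "graphon_fun w"
  shows "glue (abs_graphon v) (abs_graphon w) u s = abs_graphon (glue_fun v w u (of_bool s))"
proof -
  define b :: real where "b = of_bool s"
  have s: "b \<in> {0..1}" by (simp add: b_def)
  have z: "cut_dist (rep_graphon (abs_graphon x)) x = 0" if "graphon_fun x" for x
    using dist_abs_graphon[OF graphon_fun_rep that, of "abs_graphon x"] by (simp add: abs_rep_graphon)
  have "dist (glue (abs_graphon v) (abs_graphon w) u s) (abs_graphon (glue_fun v w u b)) \<le>
      u\<^sup>2 * cut_dist (rep_graphon (abs_graphon v)) v + (1 - u)\<^sup>2 * cut_dist (rep_graphon (abs_graphon w)) w"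
    unfolding glue_def b_def[symmetric]
      dist_abs_graphon[OF graphon_fun_glue_fun[OF graphon_fun_rep graphon_fun_rep u s] graphon_fun_glue_fun[OF g u s]]
    by (rule cut_dist_glue_fun[OF u s graphon_fun_rep graphon_fun_rep g])
  then show ?thesis by (simp add: z g b_def)
qed

lemma measurable_glue_fixed:
  assumes g: "graphon_fun v" "graphon_fun w"
  shows "(\<lambda>u. abs_graphon (glue_fun v w u (of_bool s))) \<in> unitM \<rightarrow>\<^sub>M borel"
proof (rule borel_measurable_abs_graphon)
  show "graphon_fun (glue_fun v w u (of_bool s))" if "u \<in> space unitM" for u
    using that by (intro graphon_fun_glue_fun g) auto
  let ?P = "unitM \<Otimes>\<^sub>M (unitM \<Otimes>\<^sub>M unitM)"
  have [measurable]: "(\<lambda>z. fst z) \<in> borel_measurable ?P" "(\<lambda>z. fst (snd z)) \<in> borel_measurable ?P" "(\<lambda>z. snd (snd z)) \<in> borel_measurable ?P"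
    using measurable_compose[OF measurable_fst measurable_unitM_real]
      measurable_compose[OF measurable_compose[OF measurable_snd measurable_fst] measurable_unitM_real]
      measurable_compose[OF measurable_compose[OF measurable_snd measurable_snd] measurable_unitM_real] by auto
  have w: "(\<lambda>z. w (clip (f z)) (clip (g z))) \<in> borel_measurable ?P"
    if "graphon_fun w" "f \<in> borel_measurable ?P" "g \<in> borel_measurable ?P" for w f g
    using measurable_compose[OF measurable_Pair[OF measurable_clip_unitM[OF that(2)] measurable_clip_unitM[OF that(3)]],
        of "\<lambda>(x, y). w x y" borel] that(1) by (simp add: graphon_fun_def)
  have [measurable]:
    "(\<lambda>z. v (clip (fst (snd z) / fst z)) (clip (snd (snd z) / fst z))) \<in> borel_measurable ?P"
    "(\<lambda>z. w (clip ((fst (snd z) - fst z) / (1 - fst z))) (clip ((snd (snd z) - fst z) / (1 - fst z)))) \<in> borel_measurable ?P"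
    by (intro w g; measurable)+
  have r1: "t / u \<in> {0..1}" if "t \<in> {0..1}" "t \<le> u" for t u :: real
    using that by (auto simp: divide_simps)
  have r2: "(t - u) / (1 - u) \<in> {0..1}" if "t \<in> {0..1}" "u < t" for t u :: real
    using that by (auto simp: divide_simps)
  have "(\<lambda>z. if fst (snd z) \<le> fst z \<and> snd (snd z) \<le> fst z then v (clip (fst (snd z) / fst z)) (clip (snd (snd z) / fst z))
      else if fst (snd z) > fst z \<and> snd (snd z) > fst z
        then w (clip ((fst (snd z) - fst z) / (1 - fst z))) (clip ((snd (snd z) - fst z) / (1 - fst z))) else of_bool s) \<in> borel_measurable ?P"
    by measurable
  then show "(\<lambda>(u, z). glue_fun v w u (of_bool s) (fst z) (snd z)) \<in> borel_measurable ?P"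
    by (rule measurable_cong[THEN iffD1, rotated])
       (use r1 r2 in \<open>auto simp: glue_fun_def space_pair_measure clip(2)\<close>)
qed

text \<open>The representatives in \<open>glue\<close> are chosen arbitrarily, so joint measurability comes from the contraction
  estimate: gluing is Lipschitz in both graphons, uniformly in \<open>u\<close>, and for fixed members of the dense
  sequence it is measurable in \<open>u\<close>.\<close>

lemma measurable_glue:
  assumes f [measurable]: "f \<in> borel_measurable L" "g \<in> borel_measurable L" and h: "h \<in> L \<rightarrow>\<^sub>M unitM"
    and s [measurable]: "s \<in> L \<rightarrow>\<^sub>M count_space UNIV"
  shows "(\<lambda>x. glue (f x) (g x) (h x) (s x)) \<in> borel_measurable L"
proof -
  define k where "k n W = (LEAST k. dist (dense_graphon k) W < 1 / Suc n)" for n W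
  have k: "dist (dense_graphon (k n W)) W < 1 / Suc n" for n W
  proof -
    obtain j where "dist (dense_graphon j) W < 1 / Suc n" using dense_graphon[of "1 / Suc n"] by auto
    then show ?thesis unfolding k_def by (rule LeastI)
  qed
  have km [measurable]: "k n \<in> borel \<rightarrow>\<^sub>M count_space UNIV" for n
    unfolding k_def[abs_def] by measurable
  have hu: "h x \<in> {0..1}" if "x \<in> space L" for x using measurable_space[OF h that] by simp
  show ?thesis
  proof (rule borel_measurable_LIMSEQ_metric)
    fix n
    have 1: "(\<lambda>x. glue (dense_graphon i) (dense_graphon j) (h x) b) \<in> borel_measurable L" for i j b
      using measurable_compose[OF h measurable_glue_fixed[OF graphon_fun_dense graphon_fun_dense, of i j b]]
      by (rule measurable_cong[THEN iffD1, rotated])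
         (simp add: dense_graphon_def glue_abs_graphon[OF hu graphon_fun_dense graphon_fun_dense])
    have "(\<lambda>x. (\<lambda>(i, j, b) x. glue (dense_graphon i) (dense_graphon j) (h x) b) (k n (f x), k n (g x), s x) x) \<in> borel_measurable L"
    proof (rule measurable_compose_countable)
      show "(\<lambda>x. (k n (f x), k n (g x), s x)) \<in> L \<rightarrow>\<^sub>M count_space UNIV"
        by measurable
    qed (auto simp: 1)
    then show "(\<lambda>x. glue (dense_graphon (k n (f x))) (dense_graphon (k n (g x))) (h x) (s x)) \<in> borel_measurable L" by simp
  next
    fix x assume x: "x \<in> space L"
    have "dist (glue (dense_graphon (k n (f x))) (dense_graphon (k n (g x))) (h x) (s x)) (glue (f x) (g x) (h x) (s x)) \<le> 2 * inverse (Suc n)" for n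
    proof -
      have "dist (glue (dense_graphon (k n (f x))) (dense_graphon (k n (g x))) (h x) (s x)) (glue (f x) (g x) (h x) (s x)) \<le>
        (h x)\<^sup>2 * dist (dense_graphon (k n (f x))) (f x) + (1 - h x)\<^sup>2 * dist (dense_graphon (k n (g x))) (g x)"
        by (rule dist_glue[OF hu[OF x]])
      also have "\<dots> \<le> 1 * (1 / Suc n) + 1 * (1 / Suc n)"
        using hu[OF x] k[of n "f x"] k[of n "g x"] by (intro add_mono mult_mono power_le_one) auto
      finally show ?thesis by (simp add: inverse_eq_divide)
    qed
    then have "\<forall>\<^sub>F n in sequentially. norm (dist (glue (dense_graphon (k n (f x))) (dense_graphon (k n (g x))) (h x) (s x)) (glue (f x) (g x) (h x) (s x))) \<le> 2 * inverse (real (Suc n))"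
      by simp
    moreover have "(\<lambda>n. 2 * inverse (real (Suc n))) \<longlonglongrightarrow> 0"
      using tendsto_mult[OF tendsto_const LIMSEQ_inverse_real_of_nat, of 2] by simp
    ultimately show "(\<lambda>n. glue (dense_graphon (k n (f x))) (dense_graphon (k n (g x))) (h x) (s x)) \<longlonglongrightarrow> glue (f x) (g x) (h x) (s x)"
      unfolding tendsto_dist_iff[of _ "glue (f x) (g x) (h x) (s x)"] by (rule Lim_null_comparison)
  qed
qed


section \<open>Couplings and uniqueness of the fixed point\<close>

text \<open>If the coupled points are within \<open>\<delta>\<close> except with small probability, then \<open>\<mu> C\<close> is at most the \<open>\<nu>\<close>-measure of
  the \<open>\<delta>\<close>-neighbourhood of \<open>C\<close>, up to the Markov bound; for closed \<open>C\<close> these neighbourhoods shrink to \<open>C\<close>.\<close>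

lemma measure_closed_le_coupling:
  fixes \<mu> \<nu> :: "'a :: {metric_space, second_countable_topology} measure"
  assumes \<nu>: "prob_space \<nu>" "sets \<nu> = sets borel" and C: "closed C"
    and coupling: "\<And>e. 0 < e \<Longrightarrow> \<exists>\<kappa>. prob_space \<kappa> \<and> sets \<kappa> = sets (borel \<Otimes>\<^sub>M borel) \<and>
      distr \<kappa> borel fst = \<mu> \<and> distr \<kappa> borel snd = \<nu> \<and> (\<integral>\<^sup>+z. dist (fst z) (snd z) \<partial>\<kappa>) \<le> ennreal e"
  shows "measure \<mu> C \<le> measure \<nu> C"
proof (cases "C = {}")
  case False
  interpret \<nu>: prob_space \<nu> by fact
  define nb where "nb m = {y. infdist y C < 1 / Suc m}" for m :: nat
  have nb: "nb m \<in> sets borel" for m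
    unfolding nb_def by (intro borel_open open_Collect_less continuous_intros)
  have le: "measure \<mu> C \<le> measure \<nu> (nb m)" for m
  proof (rule field_le_epsilon)
    fix e :: real assume e: "0 < e"
    obtain \<kappa> where "prob_space \<kappa>" and \<kappa>: "sets \<kappa> = sets (borel \<Otimes>\<^sub>M borel)"
      "distr \<kappa> borel fst = \<mu>" "distr \<kappa> borel snd = \<nu>" and d: "(\<integral>\<^sup>+z. dist (fst z) (snd z) \<partial>\<kappa>) \<le> ennreal (e / Suc m)"
      using coupling[of "e / Suc m"] e by auto
    interpret \<kappa>: prob_space \<kappa> by fact
    have [measurable]: "fst \<in> \<kappa> \<rightarrow>\<^sub>M borel" "snd \<in> \<kappa> \<rightarrow>\<^sub>M borel"
      using \<kappa>(1) by (simp_all cong: measurable_cong_sets)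
    have sp: "space \<kappa> = UNIV" using sets_eq_imp_space_eq[OF \<kappa>(1)] by (simp add: space_pair_measure)
    have [measurable]: "C \<in> sets borel" "nb m \<in> sets borel" using C nb by auto
    \<comment> \<open>The event that the coupled points are at distance at least \<open>1 / Suc m\<close>.\<close>
    define F where "F = {z \<in> space \<kappa>. 1 \<le> ennreal (Suc m) * ennreal (dist (fst z) (snd z))}"
    have F [measurable]: "F \<in> sets \<kappa>" unfolding F_def by measurable
    have "emeasure \<kappa> F \<le> ennreal (Suc m) * (\<integral>\<^sup>+z. ennreal (dist (fst z) (snd z)) * indicator (space \<kappa>) z \<partial>\<kappa>)"
      unfolding F_def by (rule nn_integral_Markov_inequality) auto
    also have "(\<integral>\<^sup>+z. ennreal (dist (fst z) (snd z)) * indicator (space \<kappa>) z \<partial>\<kappa>) = (\<integral>\<^sup>+z. dist (fst z) (snd z) \<partial>\<kappa>)"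
      by (rule nn_integral_cong) auto
    also have "ennreal (Suc m) * (\<integral>\<^sup>+z. dist (fst z) (snd z) \<partial>\<kappa>) \<le> ennreal (Suc m) * ennreal (e / Suc m)"
      by (rule mult_left_mono[OF d]) simp
    also have "\<dots> = ennreal e" using e by (subst ennreal_mult'[symmetric]) auto
    finally have mF: "measure \<kappa> F \<le> e" using e by (simp add: \<kappa>.emeasure_eq_measure)
    have "measure \<mu> C = measure \<kappa> (fst -` C \<inter> space \<kappa>)"
      unfolding \<kappa>(2)[symmetric] by (rule measure_distr) auto
    also have "\<dots> \<le> measure \<kappa> ((snd -` nb m \<inter> space \<kappa>) \<union> F)"
    proof (rule \<kappa>.finite_measure_mono)
      show "fst -` C \<inter> space \<kappa> \<subseteq> (snd -` nb m \<inter> space \<kappa>) \<union> F"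
      proof
        fix z assume z: "z \<in> fst -` C \<inter> space \<kappa>"
        show "z \<in> (snd -` nb m \<inter> space \<kappa>) \<union> F"
        proof (cases "dist (fst z) (snd z) < 1 / Suc m")
          case True
          then have "infdist (snd z) C < 1 / Suc m"
            using infdist_le[of "fst z" C "snd z"] z by (simp add: dist_commute)
          then show ?thesis using z by (simp add: nb_def)
        next
          case False
          then have "1 \<le> Suc m * dist (fst z) (snd z)" by (simp add: field_simps)
          then have "ennreal 1 \<le> ennreal (Suc m * dist (fst z) (snd z))" by (rule ennreal_leI)
          then show ?thesis using z by (simp add: F_def ennreal_mult')
        qed
      qed
    qed (intro sets.Un F measurable_sets[where A = borel]; simp)
    also have "\<dots> \<le> measure \<kappa> (snd -` nb m \<inter> space \<kappa>) + measure \<kappa> F"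
      by (intro measure_Un_le F measurable_sets[where A = borel]; simp)
    also have "measure \<kappa> (snd -` nb m \<inter> space \<kappa>) = measure \<nu> (nb m)"
      unfolding \<kappa>(3)[symmetric] by (rule measure_distr[symmetric]) auto
    finally show "measure \<mu> C \<le> measure \<nu> (nb m) + e" using mF by simp
  qed
  have "(\<lambda>m. measure \<nu> (nb m)) \<longlonglongrightarrow> measure \<nu> (\<Inter>m. nb m)"
  proof (rule \<nu>.finite_Lim_measure_decseq)
    have "(1::real) / Suc n \<le> 1 / Suc m" if "m \<le> n" for m n using that by (simp add: field_simps)
    then show "decseq nb" by (fastforce simp: decseq_def nb_def)
  qed (use nb \<nu>(2) in auto)
  also have "(\<Inter>m. nb m) = C"
  proof (intro equalityI subsetI)
    fix y assume y: "y \<in> (\<Inter>m. nb m)"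
    have "infdist y C \<le> 0"
    proof (rule ccontr)
      assume "\<not> infdist y C \<le> 0"
      then obtain m where "inverse (Suc m) < infdist y C" using reals_Archimedean[of "infdist y C"] by auto
      moreover have "infdist y C < 1 / Suc m" using y by (simp add: nb_def)
      ultimately show False by (simp add: inverse_eq_divide)
    qed
    then have "infdist y C = 0" using infdist_nonneg[of y C] by simp
    then show "y \<in> C" using in_closed_iff_infdist_zero[OF C False] by simp
  qed (auto simp: nb_def)
  finally show ?thesis using le by (intro LIMSEQ_le_const) auto
qed simp

text \<open>Swapping the coordinates of the couplings gives the reverse inequality, and closed sets determine a
  Borel probability measure.\<close>

lemma measure_eqI_coupling:
  fixes \<mu> \<nu> :: "'a :: {metric_space, second_countable_topology} measure"
  assumes \<mu>: "prob_space \<mu>" "sets \<mu> = sets borel" and \<nu>: "prob_space \<nu>" "sets \<nu> = sets borel"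
    and coupling: "\<And>e. 0 < e \<Longrightarrow> \<exists>\<kappa>. prob_space \<kappa> \<and> sets \<kappa> = sets (borel \<Otimes>\<^sub>M borel) \<and>
      distr \<kappa> borel fst = \<mu> \<and> distr \<kappa> borel snd = \<nu> \<and> (\<integral>\<^sup>+z. dist (fst z) (snd z) \<partial>\<kappa>) \<le> ennreal e"
  shows "\<mu> = \<nu>"
proof -
  interpret \<mu>: prob_space \<mu> by fact
  interpret \<nu>: prob_space \<nu> by fact
  have coupling': "\<exists>\<kappa>. prob_space \<kappa> \<and> sets \<kappa> = sets (borel \<Otimes>\<^sub>M borel) \<and>
      distr \<kappa> borel fst = \<nu> \<and> distr \<kappa> borel snd = \<mu> \<and> (\<integral>\<^sup>+z. dist (fst z) (snd z) \<partial>\<kappa>) \<le> ennreal e" if e: "0 < e" for e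
  proof -
    obtain \<kappa> where "prob_space \<kappa>" and \<kappa>: "sets \<kappa> = sets (borel \<Otimes>\<^sub>M borel)"
      "distr \<kappa> borel fst = \<mu>" "distr \<kappa> borel snd = \<nu>" "(\<integral>\<^sup>+z. dist (fst z) (snd z) \<partial>\<kappa>) \<le> ennreal e"
      using coupling[OF e] by auto
    interpret \<kappa>: prob_space \<kappa> by fact
    have m [measurable]: "fst \<in> \<kappa> \<rightarrow>\<^sub>M borel" "snd \<in> \<kappa> \<rightarrow>\<^sub>M borel"
      using \<kappa>(1) by (simp_all cong: measurable_cong_sets)
    have sw: "(\<lambda>z. (snd z, fst z)) \<in> \<kappa> \<rightarrow>\<^sub>M borel \<Otimes>\<^sub>M borel" by (rule measurable_Pair[OF m(2,1)])
    let ?\<kappa> = "distr \<kappa> (borel \<Otimes>\<^sub>M borel) (\<lambda>z. (snd z, fst z))"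
    show ?thesis
    proof (intro exI[of _ ?\<kappa>] conjI)
      show "prob_space ?\<kappa>" by (rule \<kappa>.prob_space_distr[OF sw])
      show "distr ?\<kappa> borel fst = \<nu>" "distr ?\<kappa> borel snd = \<mu>"
        using \<kappa>(2,3) by (simp_all add: distr_distr[OF _ sw] comp_def cong: distr_cong)
      have "(\<integral>\<^sup>+z. dist (fst z) (snd z) \<partial>?\<kappa>) = (\<integral>\<^sup>+z. dist (snd z) (fst z) \<partial>\<kappa>)"
        by (subst nn_integral_distr[OF sw]) auto
      then show "(\<integral>\<^sup>+z. dist (fst z) (snd z) \<partial>?\<kappa>) \<le> ennreal e" using \<kappa>(4) by (simp add: dist_commute)
    qed simp
  qed
  have closed: "emeasure \<mu> C = emeasure \<nu> C" if "closed C" for C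
    using measure_closed_le_coupling[OF \<nu> that coupling] measure_closed_le_coupling[OF \<mu> that coupling']
    by (simp add: \<mu>.emeasure_eq_measure \<nu>.emeasure_eq_measure)
  show ?thesis
  proof (rule measure_eqI_generator_eq[where E = "{C. closed C}" and \<Omega> = UNIV and A = "\<lambda>_. UNIV"])
    show "Int_stable {C :: 'a set. closed C}" by (auto simp: Int_stable_def)
    show "sets \<mu> = sigma_sets UNIV {C. closed C}" "sets \<nu> = sigma_sets UNIV {C. closed C}"
      unfolding \<mu>(2) \<nu>(2) borel_eq_closed by (auto intro: sets_measure_of)
  qed (use closed in auto)
qed

lemma prob_space_glue_space: "prob_space M \<Longrightarrow> prob_space (glue_space p M)"
  unfolding glue_space_def by (intro prob_space_pair prob_space_unitM prob_space_measure_pmf)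

lemma measurable_glued:
  assumes V: "V \<in> borel_measurable M"
  shows "glued V \<in> borel_measurable (glue_space p M)"
proof -
  have "(\<lambda>x. glue (V (fst x)) (V (fst (snd x))) (fst (snd (snd x))) (snd (snd (snd x)))) \<in> borel_measurable (glue_space p M)"
    unfolding glue_space_def
  proof (rule measurable_glue)
    let ?B = "measure_pmf (bernoulli_pmf (1 - p))"
    let ?G = "M \<Otimes>\<^sub>M M \<Otimes>\<^sub>M unitM \<Otimes>\<^sub>M ?B"
    show "(\<lambda>x. V (fst x)) \<in> borel_measurable ?G" by (rule measurable_compose[OF measurable_fst V])
    show "(\<lambda>x. V (fst (snd x))) \<in> borel_measurable ?G"
      by (rule measurable_compose[OF measurable_compose[OF measurable_snd measurable_fst] V])
    show "(\<lambda>x. fst (snd (snd x))) \<in> ?G \<rightarrow>\<^sub>M unitM"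
      by (rule measurable_compose[OF measurable_compose[OF measurable_snd measurable_snd] measurable_fst])
    have "(\<lambda>x. snd (snd (snd x))) \<in> ?G \<rightarrow>\<^sub>M ?B"
      by (rule measurable_compose[OF measurable_compose[OF measurable_snd measurable_snd] measurable_snd])
    then show "(\<lambda>x. snd (snd (snd x))) \<in> ?G \<rightarrow>\<^sub>M count_space UNIV" by simp
  qed
  then show ?thesis by (simp add: glued_def case_prod_unfold)
qed

text \<open>The operator \<open>T\<close>, acting on laws: the identity is a random graphon with law \<open>\<mu>\<close>.\<close>

definition glue_law :: "real \<Rightarrow> graphon measure \<Rightarrow> graphon measure" where
  "glue_law p \<mu> = distr (glue_space p \<mu>) borel (glued (\<lambda>W. W))"

text \<open>The law of \<open>W[V]\<close> depends on \<open>V\<close> only through its law, since the product of image measures is the image of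
  the product measure.\<close>

lemma distr_glued:
  assumes M: "prob_space M" and V: "V \<in> borel_measurable M"
  shows "distr (glue_space p M) borel (glued V) = glue_law p (distr M borel V)"
proof -
  let ?B = "measure_pmf (bernoulli_pmf (1 - p))"
  let ?R = "unitM \<Otimes>\<^sub>M ?B" and ?D = "distr M borel V"
  interpret R: prob_space ?R by (intro prob_space_pair prob_space_unitM prob_space_measure_pmf)
  interpret D: prob_space ?D by (rule prob_space.prob_space_distr[OF M V])
  interpret DR: prob_space "?D \<Otimes>\<^sub>M ?R" by (intro prob_space_pair D.prob_space_axioms R.prob_space_axioms)
  have Rid: "distr ?R ?R (\<lambda>x. x) = ?R" by (rule distr_id[unfolded id_def])
  have 1: "?D \<Otimes>\<^sub>M ?R = distr (M \<Otimes>\<^sub>M ?R) (borel \<Otimes>\<^sub>M ?R) (\<lambda>(x, y). (V x, y))"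
    using pair_measure_distr[OF V measurable_ident[unfolded id_def, of ?R]] R.sigma_finite_measure_axioms by (simp add: Rid)
  have m1: "(\<lambda>(x, y). (V x, y)) \<in> M \<Otimes>\<^sub>M ?R \<rightarrow>\<^sub>M borel \<Otimes>\<^sub>M ?R"
    using measurable_Pair[OF measurable_compose[OF measurable_fst V] measurable_snd] by (simp add: case_prod_unfold)
  have "?D \<Otimes>\<^sub>M (?D \<Otimes>\<^sub>M ?R) = distr (M \<Otimes>\<^sub>M (M \<Otimes>\<^sub>M ?R)) (borel \<Otimes>\<^sub>M (borel \<Otimes>\<^sub>M ?R)) (\<lambda>(x, y). (V x, case y of (x, y) \<Rightarrow> (V x, y)))"
    using pair_measure_distr[OF V m1] DR.sigma_finite_measure_axioms by (simp add: 1)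
  then have D: "glue_space p ?D = distr (glue_space p M) (borel \<Otimes>\<^sub>M (borel \<Otimes>\<^sub>M ?R)) (\<lambda>(x, y). (V x, case y of (x, y) \<Rightarrow> (V x, y)))"
    by (simp add: glue_space_def)
  have m2: "(\<lambda>(x, y). (V x, case y of (x, y) \<Rightarrow> (V x, y))) \<in> glue_space p M \<rightarrow>\<^sub>M borel \<Otimes>\<^sub>M (borel \<Otimes>\<^sub>M ?R)"
    unfolding glue_space_def
    using measurable_Pair[OF measurable_compose[OF measurable_fst V] measurable_compose[OF measurable_snd m1]] by (simp add: case_prod_unfold)
  have m3: "glued (\<lambda>W. W) \<in> borel \<Otimes>\<^sub>M (borel \<Otimes>\<^sub>M ?R) \<rightarrow>\<^sub>M borel"
    using measurable_glued[of "\<lambda>W. W" borel p] by (simp add: glue_space_def)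
  show ?thesis
    unfolding glue_law_def D distr_distr[OF m3 m2]
    by (rule distr_cong) (auto simp: glued_def)
qed

text \<open>The integration over the two copies is put innermost: both applications work for a fixed cut
  \<open>u\<close> and a fixed sign.\<close>

lemma nn_integral_glue_space:
  assumes M: "prob_space M" and f: "f \<in> borel_measurable (glue_space p M)"
  shows "(\<integral>\<^sup>+z. f z \<partial>glue_space p M) = (\<integral>\<^sup>+u. \<integral>\<^sup>+s. \<integral>\<^sup>+a. \<integral>\<^sup>+b. f (a, b, u, s) \<partial>M \<partial>M \<partial>bernoulli_pmf (1 - p) \<partial>unitM)"
proof -
  let ?B = "measure_pmf (bernoulli_pmf (1 - p))"
  let ?R = "unitM \<Otimes>\<^sub>M ?B"
  interpret M: prob_space M by fact
  interpret R: prob_space ?R by (intro prob_space_pair prob_space_unitM prob_space_measure_pmf)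
  interpret MR: pair_prob_space M ?R ..
  have fm: "f \<in> borel_measurable (M \<Otimes>\<^sub>M (M \<Otimes>\<^sub>M ?R))" using f by (simp add: glue_space_def)
  have fm': "(\<lambda>x. f (g x, h x, k x)) \<in> borel_measurable L"
    if "g \<in> L \<rightarrow>\<^sub>M M" "h \<in> L \<rightarrow>\<^sub>M M" "k \<in> L \<rightarrow>\<^sub>M ?R" for g h k L
    using measurable_compose[OF measurable_Pair[OF that(1) measurable_Pair[OF that(2,3)]] fm] .
  have "(\<integral>\<^sup>+z. f z \<partial>glue_space p M) = (\<integral>\<^sup>+a. \<integral>\<^sup>+z. f (a, z) \<partial>(M \<Otimes>\<^sub>M ?R) \<partial>M)"
    unfolding glue_space_def using fm by (rule MR.P.nn_integral_fst[symmetric])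
  also have "\<dots> = (\<integral>\<^sup>+a. \<integral>\<^sup>+r. \<integral>\<^sup>+b. f (a, b, r) \<partial>M \<partial>?R \<partial>M)"
  proof (intro nn_integral_cong)
    fix a assume "a \<in> space M"
    from measurable_compose[OF measurable_Pair1'[OF this] fm]
    show "(\<integral>\<^sup>+z. f (a, z) \<partial>(M \<Otimes>\<^sub>M ?R)) = (\<integral>\<^sup>+r. \<integral>\<^sup>+b. f (a, b, r) \<partial>M \<partial>?R)"
      by (rule MR.nn_integral_snd[symmetric])
  qed
  also have "\<dots> = (\<integral>\<^sup>+r. \<integral>\<^sup>+a. \<integral>\<^sup>+b. f (a, b, r) \<partial>M \<partial>M \<partial>?R)"
    by (rule MR.Fubini'[symmetric])
      (use fm'[OF measurable_compose[OF measurable_fst measurable_fst] measurable_snd measurable_compose[OF measurable_fst measurable_snd]]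
       in \<open>auto simp: case_prod_unfold intro!: M.borel_measurable_nn_integral\<close>)
  also have "\<dots> = (\<integral>\<^sup>+u. \<integral>\<^sup>+s. \<integral>\<^sup>+a. \<integral>\<^sup>+b. f (a, b, u, s) \<partial>M \<partial>M \<partial>?B \<partial>unitM)"
    by (rule measure_pmf.nn_integral_fst[symmetric], intro M.borel_measurable_nn_integral, unfold case_prod_unfold, intro M.borel_measurable_nn_integral)
      (use fm'[OF measurable_compose[OF measurable_fst measurable_snd] measurable_snd measurable_compose[OF measurable_fst measurable_fst]]
       in \<open>simp add: case_prod_unfold\<close>)
  finally show ?thesis .
qed

lemma nn_integral_unit_squares:
  "(\<integral>\<^sup>+u. ennreal (u\<^sup>2) \<partial>unitM) = ennreal (1 / 3)" "(\<integral>\<^sup>+u. ennreal ((1 - u)\<^sup>2) \<partial>unitM) = ennreal (1 / 3)"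
proof -
  have "(\<integral>\<^sup>+u. ennreal (u\<^sup>2) * indicator {0..1} u \<partial>lborel) = 1 ^ 3 / 3 - 0 ^ 3 / (3 :: real)"
    by (rule nn_integral_FTC_Icc) (auto intro!: derivative_eq_intros simp: power2_eq_square)
  then show "(\<integral>\<^sup>+u. ennreal (u\<^sup>2) \<partial>unitM) = ennreal (1 / 3)"
    by (subst nn_integral_restrict_space) auto
  have "(\<integral>\<^sup>+u. ennreal ((1 - u)\<^sup>2) * indicator {0..1} u \<partial>lborel) = - ((1 - 1) ^ 3 / 3) - - ((1 - 0) ^ 3 / (3 :: real))"
    by (rule nn_integral_FTC_Icc) (auto intro!: derivative_eq_intros simp: power2_eq_square)
  then show "(\<integral>\<^sup>+u. ennreal ((1 - u)\<^sup>2) \<partial>unitM) = ennreal (1 / 3)"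
    by (subst nn_integral_restrict_space) auto
qed

text \<open>Gluing two independent copies of a coupled pair with common \<open>U\<close> and \<open>S\<close> gives a coupling of the images of
  the marginals under \<open>T\<close>, and in expectation each of the two cells contributes at most \<open>1/3\<close> of the
  old distance.\<close>

definition glue_coupling :: "real \<Rightarrow> (graphon \<times> graphon) measure \<Rightarrow> (graphon \<times> graphon) measure" where
  "glue_coupling p \<kappa> = distr (glue_space p \<kappa>) (borel \<Otimes>\<^sub>M borel) (\<lambda>\<omega>. (glued fst \<omega>, glued snd \<omega>))"

lemma glue_coupling:
  assumes "prob_space \<kappa>" and sets: "sets \<kappa> = sets (borel \<Otimes>\<^sub>M borel)"
  shows "prob_space (glue_coupling p \<kappa>)" "sets (glue_coupling p \<kappa>) = sets (borel \<Otimes>\<^sub>M borel)"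
    "distr (glue_coupling p \<kappa>) borel fst = glue_law p (distr \<kappa> borel fst)"
    "distr (glue_coupling p \<kappa>) borel snd = glue_law p (distr \<kappa> borel snd)"
    "(\<integral>\<^sup>+z. dist (fst z) (snd z) \<partial>glue_coupling p \<kappa>) \<le> ennreal (2 / 3) * (\<integral>\<^sup>+z. dist (fst z) (snd z) \<partial>\<kappa>)"
proof -
  interpret \<kappa>: prob_space \<kappa> by fact
  have fs [measurable]: "fst \<in> \<kappa> \<rightarrow>\<^sub>M borel" "snd \<in> \<kappa> \<rightarrow>\<^sub>M borel"
    using sets by (simp_all cong: measurable_cong_sets)
  note g = measurable_glued[OF fs(1), of p] measurable_glued[OF fs(2), of p]
  have m: "(\<lambda>\<omega>. (glued fst \<omega>, glued snd \<omega>)) \<in> glue_space p \<kappa> \<rightarrow>\<^sub>M borel \<Otimes>\<^sub>M borel"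
    by (rule measurable_Pair[OF g])
  show "prob_space (glue_coupling p \<kappa>)"
    unfolding glue_coupling_def by (rule prob_space.prob_space_distr[OF prob_space_glue_space m]) fact
  show "sets (glue_coupling p \<kappa>) = sets (borel \<Otimes>\<^sub>M borel)" by (simp add: glue_coupling_def)
  show "distr (glue_coupling p \<kappa>) borel fst = glue_law p (distr \<kappa> borel fst)"
    "distr (glue_coupling p \<kappa>) borel snd = glue_law p (distr \<kappa> borel snd)"
    unfolding glue_coupling_def distr_distr[OF measurable_fst m] distr_distr[OF measurable_snd m]
    using distr_glued[OF assms(1) fs(1), of p] distr_glued[OF assms(1) fs(2), of p] by (simp_all add: comp_def)
  define D where "D a = ennreal (dist (fst a) (snd a))" for a :: "graphon \<times> graphon"
  have D [measurable]: "D \<in> borel_measurable \<kappa>" unfolding D_def by measurable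
  let ?B = "measure_pmf (bernoulli_pmf (1 - p))"
  let ?f = "\<lambda>(a, b, u, s :: bool). ennreal (u\<^sup>2) * D a + ennreal ((1 - u)\<^sup>2) * D b"
  have fm: "?f \<in> borel_measurable (glue_space p \<kappa>)"
  proof -
    have [measurable]: "(\<lambda>z. D (fst z)) \<in> borel_measurable (glue_space p \<kappa>)" "(\<lambda>z. D (fst (snd z))) \<in> borel_measurable (glue_space p \<kappa>)"
      "(\<lambda>z. fst (snd (snd z))) \<in> borel_measurable (glue_space p \<kappa>)"
      unfolding glue_space_def
      using measurable_compose[OF measurable_fst D] measurable_compose[OF measurable_compose[OF measurable_snd measurable_fst] D]
        measurable_compose[OF measurable_compose[OF measurable_compose[OF measurable_snd measurable_snd] measurable_fst] measurable_unitM_real]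
      by auto
    show ?thesis unfolding case_prod_unfold by measurable
  qed
  have "(\<integral>\<^sup>+z. dist (fst z) (snd z) \<partial>glue_coupling p \<kappa>) = (\<integral>\<^sup>+\<omega>. dist (glued fst \<omega>) (glued snd \<omega>) \<partial>glue_space p \<kappa>)"
    unfolding glue_coupling_def by (subst nn_integral_distr[OF m]) auto
  also have "\<dots> \<le> (\<integral>\<^sup>+\<omega>. ?f \<omega> \<partial>glue_space p \<kappa>)"
  proof (rule nn_integral_mono)
    fix \<omega> assume w: "\<omega> \<in> space (glue_space p \<kappa>)"
    obtain a b u s where \<omega>: "\<omega> = (a, b, u, s)" by (cases \<omega>)
    then have u: "u \<in> {0..1}" using w by (auto simp: glue_space_def space_pair_measure)
    have "ennreal (dist (glued fst \<omega>) (glued snd \<omega>)) \<le>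
        ennreal (u\<^sup>2 * dist (fst a) (snd a) + (1 - u)\<^sup>2 * dist (fst b) (snd b))"
      using dist_glue[OF u, of "fst a" "fst b" s "snd a" "snd b"] by (intro ennreal_leI) (simp add: \<omega> glued_def)
    also have "\<dots> = ?f \<omega>" by (simp add: \<omega> D_def ennreal_mult')
    finally show "ennreal (dist (glued fst \<omega>) (glued snd \<omega>)) \<le> ?f \<omega>" .
  qed
  also have "\<dots> = (\<integral>\<^sup>+u. \<integral>\<^sup>+s. \<integral>\<^sup>+a. \<integral>\<^sup>+b. ennreal (u\<^sup>2) * D a + ennreal ((1 - u)\<^sup>2) * D b \<partial>\<kappa> \<partial>\<kappa> \<partial>?B \<partial>unitM)"
    by (subst nn_integral_glue_space[OF assms(1) fm]) simp
  also have "\<dots> = (\<integral>\<^sup>+u. ennreal (u\<^sup>2) * integral\<^sup>N \<kappa> D + ennreal ((1 - u)\<^sup>2) * integral\<^sup>N \<kappa> D \<partial>unitM)"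
    by (intro nn_integral_cong)
      (simp add: nn_integral_add nn_integral_cmult \<kappa>.emeasure_space_1 measure_pmf.emeasure_space_1)
  also have "\<dots> = ennreal (1 / 3) * integral\<^sup>N \<kappa> D + ennreal (1 / 3) * integral\<^sup>N \<kappa> D"
  proof -
    have sq [measurable]: "(\<lambda>u. ennreal (u\<^sup>2)) \<in> borel_measurable unitM" "(\<lambda>u. ennreal ((1 - u)\<^sup>2)) \<in> borel_measurable unitM"
      by (auto intro!: measurable_restrict_space1)
    show ?thesis
      by (simp add: nn_integral_add nn_integral_multc[OF sq(1)] nn_integral_multc[OF sq(2)] nn_integral_unit_squares)
  qed
  also have "\<dots> = ennreal (2 / 3) * integral\<^sup>N \<kappa> D"
    by (simp add: distrib_right[symmetric] ennreal_plus[symmetric] del: ennreal_plus)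
  finally show "(\<integral>\<^sup>+z. dist (fst z) (snd z) \<partial>glue_coupling p \<kappa>) \<le> ennreal (2 / 3) * (\<integral>\<^sup>+z. dist (fst z) (snd z) \<partial>\<kappa>)"
    by (simp add: D_def[abs_def])
qed

lemma dist_graphon_le_1: "dist V W \<le> (1 :: real)" for V W :: graphon
proof -
  have "dist V W \<le> cut_norm (\<lambda>x y. rep_graphon V x y - rep_graphon W x y)"
    unfolding dist_graphon_rep[of V] using cut_dist_lower[OF graphon_fun_rep graphon_fun_rep mp_bij_id, of V W] .
  also have "\<dots> \<le> 1"
    by (intro cut_norm_least kern_integral_le_1 kern_diff graphon_fun_rep)
  finally show ?thesis .
qed

text \<open>Start from the independent coupling, whose expected distance is at most \<open>1\<close>, and iterate.\<close>

theorem glue_law_fixed_point_unique: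
  assumes \<mu>: "prob_space \<mu>" "sets \<mu> = sets borel" "glue_law p \<mu> = \<mu>"
    and \<nu>: "prob_space \<nu>" "sets \<nu> = sets borel" "glue_law p \<nu> = \<nu>"
  shows "\<mu> = \<nu>"
proof (rule measure_eqI_coupling[OF \<mu>(1,2) \<nu>(1,2)])
  fix e :: real assume e: "0 < e"
  interpret \<mu>: prob_space \<mu> by fact
  interpret \<nu>: prob_space \<nu> by fact
  interpret P: pair_prob_space \<mu> \<nu> ..
  define \<kappa> where "\<kappa> n = (glue_coupling p ^^ n) (\<mu> \<Otimes>\<^sub>M \<nu>)" for n
  have \<kappa>: "prob_space (\<kappa> n) \<and> sets (\<kappa> n) = sets (borel \<Otimes>\<^sub>M borel) \<and> distr (\<kappa> n) borel fst = \<mu> \<and> distr (\<kappa> n) borel snd = \<nu> \<and>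
     (\<integral>\<^sup>+z. dist (fst z) (snd z) \<partial>\<kappa> n) \<le> ennreal ((2 / 3) ^ n)" for n
  proof (induction n)
    case 0
    have "distr (\<mu> \<Otimes>\<^sub>M \<nu>) borel fst = distr (\<mu> \<Otimes>\<^sub>M \<nu>) \<mu> fst" using \<mu>(2) by (intro distr_cong) auto
    moreover have "distr (\<mu> \<Otimes>\<^sub>M \<nu>) borel snd = distr (\<mu> \<Otimes>\<^sub>M \<nu>) \<nu> snd" using \<nu>(2) by (intro distr_cong) auto
    moreover have "distr (\<mu> \<Otimes>\<^sub>M \<nu>) \<nu> snd = \<nu>"
    proof -
      have "distr (\<mu> \<Otimes>\<^sub>M \<nu>) \<nu> snd = distr (distr (\<nu> \<Otimes>\<^sub>M \<mu>) (\<mu> \<Otimes>\<^sub>M \<nu>) (\<lambda>(x, y). (y, x))) \<nu> snd"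
        using P.distr_pair_swap by simp
      also have "\<dots> = distr (\<nu> \<Otimes>\<^sub>M \<mu>) \<nu> fst"
        by (subst distr_distr) (auto simp: comp_def case_prod_unfold)
      finally show ?thesis by (simp add: \<mu>.distr_pair_fst)
    qed
    moreover have "(\<integral>\<^sup>+z. dist (fst z) (snd z) \<partial>(\<mu> \<Otimes>\<^sub>M \<nu>)) \<le> (\<integral>\<^sup>+z. 1 \<partial>(\<mu> \<Otimes>\<^sub>M \<nu>))"
      by (rule nn_integral_mono) (simp add: dist_graphon_le_1)
    ultimately show ?case
      using P.P.prob_space_axioms \<mu>(2) \<nu>(2)
      by (auto simp: \<kappa>_def \<nu>.distr_pair_fst P.P.emeasure_space_1 cong: sets_pair_measure_cong)
  next
    case (Suc n)
    then have pn: "prob_space (\<kappa> n)" "sets (\<kappa> n) = sets (borel \<Otimes>\<^sub>M borel)"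
      and mn: "distr (\<kappa> n) borel fst = \<mu>" "distr (\<kappa> n) borel snd = \<nu>"
      and dn: "(\<integral>\<^sup>+z. dist (fst z) (snd z) \<partial>\<kappa> n) \<le> ennreal ((2 / 3) ^ n)" by auto
    have S: "\<kappa> (Suc n) = glue_coupling p (\<kappa> n)" by (simp add: \<kappa>_def)
    have "(\<integral>\<^sup>+z. dist (fst z) (snd z) \<partial>\<kappa> (Suc n)) \<le> ennreal (2 / 3) * (\<integral>\<^sup>+z. dist (fst z) (snd z) \<partial>\<kappa> n)"
      unfolding S by (rule glue_coupling(5)[OF pn])
    also have "\<dots> \<le> ennreal (2 / 3) * ennreal ((2 / 3) ^ n)" by (rule mult_left_mono[OF dn]) simp
    also have "\<dots> = ennreal ((2 / 3) ^ Suc n)" by (simp add: ennreal_mult'[symmetric])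
    finally show ?case unfolding S using glue_coupling(1-4)[OF pn, of p] mn \<mu>(3) \<nu>(3) by (simp add: S)
  qed
  obtain n where n: "(2 / 3 :: real) ^ n < e" using real_arch_pow_inv[OF e, of "2 / 3"] by auto
  show "\<exists>\<kappa>. prob_space \<kappa> \<and> sets \<kappa> = sets (borel \<Otimes>\<^sub>M borel) \<and>
      distr \<kappa> borel fst = \<mu> \<and> distr \<kappa> borel snd = \<nu> \<and> (\<integral>\<^sup>+z. dist (fst z) (snd z) \<partial>\<kappa>) \<le> ennreal e"
    using \<kappa>[of n] ennreal_leI[OF less_imp_le[OF n]] by (intro exI[of _ "\<kappa> n"]) (auto intro: order_trans)
qed


section \<open>Interleaving i.i.d. sequences\<close>

text \<open>The law of an i.i.d. sequence with common law \<open>M\<close>.\<close>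

abbreviation Seq :: "'a measure \<Rightarrow> (nat \<Rightarrow> 'a) measure" where
  "Seq M \<equiv> \<Pi>\<^sub>M i\<in>UNIV. M"

lemma measurable_SeqI:
  "(\<And>n. (\<lambda>x. f x n) \<in> L \<rightarrow>\<^sub>M M) \<Longrightarrow> f \<in> L \<rightarrow>\<^sub>M Seq M"
  by (rule measurable_PiM_single') (auto dest: measurable_space)

lemma measurable_Seq_nth: "f \<in> L \<rightarrow>\<^sub>M Seq M \<Longrightarrow> (\<lambda>x. f x n) \<in> L \<rightarrow>\<^sub>M M"
  by (rule measurable_compose[OF _ measurable_component_singleton]) auto

lemma measurable_Seq_shift: "f \<in> L \<rightarrow>\<^sub>M Seq M \<Longrightarrow> (\<lambda>x n. f x (Suc n)) \<in> L \<rightarrow>\<^sub>M Seq M"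
  by (rule measurable_SeqI) (rule measurable_Seq_nth)

lemma measurable_Seq_case_nat:
  "f \<in> L \<rightarrow>\<^sub>M M \<Longrightarrow> g \<in> L \<rightarrow>\<^sub>M Seq M \<Longrightarrow> (\<lambda>x. case_nat (f x) (g x)) \<in> L \<rightarrow>\<^sub>M Seq M"
proof (rule measurable_SeqI)
  fix n assume "f \<in> L \<rightarrow>\<^sub>M M" "g \<in> L \<rightarrow>\<^sub>M Seq M"
  then show "(\<lambda>x. case_nat (f x) (g x) n) \<in> L \<rightarrow>\<^sub>M M"
    using measurable_Seq_nth[of g L M] by (cases n) auto
qed

lemma space_Seq_shift: "x \<in> space (Seq M) \<Longrightarrow> (\<lambda>n. x (Suc n)) \<in> space (Seq M)"
  by (auto simp: space_PiM)

lemmas measurable_Seq_coords =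
  measurable_Seq_nth[OF measurable_ident[unfolded id_def]] measurable_Seq_shift[OF measurable_ident[unfolded id_def]]
  measurable_Seq_nth[OF measurable_fst] measurable_Seq_shift[OF measurable_fst]
  measurable_Seq_nth[OF measurable_snd] measurable_Seq_shift[OF measurable_snd]

lemma indicator_ennreal: "A \<in> sets M \<Longrightarrow> (indicator A :: _ \<Rightarrow> ennreal) \<in> borel_measurable M"
  by (rule borel_measurable_indicator)

lemma borel_measurable_head_tail:
  assumes "A \<in> sets R" "C \<in> sets (Seq R)"
  shows "(\<lambda>z. indicator A (z 0) * indicator C (\<lambda>n. z (Suc n)) :: ennreal) \<in> borel_measurable (Seq R)"
proof -
  have hd: "(\<lambda>z. z 0) \<in> Seq R \<rightarrow>\<^sub>M R" and tl: "(\<lambda>z n. z (Suc n)) \<in> Seq R \<rightarrow>\<^sub>M Seq R"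
    by (rule measurable_Seq_coords)+
  have 1: "(\<lambda>z. indicator A (z 0) :: ennreal) \<in> borel_measurable (Seq R)"
    by (rule measurable_compose[OF hd]) (intro indicator_ennreal assms)
  have 2: "(\<lambda>z. indicator C (\<lambda>n. z (Suc n)) :: ennreal) \<in> borel_measurable (Seq R)"
    by (rule measurable_compose[OF tl]) (intro indicator_ennreal assms)
  show ?thesis by (rule borel_measurable_times_ennreal[OF 1 2])
qed

lemma prob_space_Seq: "prob_space M \<Longrightarrow> prob_space (Seq M)"
  by (rule prob_space_PiM)

lemma nn_integral_Seq:
  assumes "prob_space M" and f: "f \<in> borel_measurable (Seq M)"
  shows "(\<integral>\<^sup>+z. f z \<partial>Seq M) = (\<integral>\<^sup>+x. \<integral>\<^sup>+z. f (case_nat x z) \<partial>Seq M \<partial>M)"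
proof -
  interpret M: prob_space M by fact
  interpret S: prob_space "Seq M" by (rule prob_space_Seq) fact
  interpret sequence_space M by unfold_locales
  have m: "(\<lambda>(s, \<omega>). case_nat s \<omega>) \<in> M \<Otimes>\<^sub>M Seq M \<rightarrow>\<^sub>M Seq M"
    using measurable_Seq_case_nat[OF measurable_fst measurable_snd] by (simp add: case_prod_unfold)
  have "(\<integral>\<^sup>+z. f z \<partial>Seq M) = (\<integral>\<^sup>+z. f z \<partial>distr (M \<Otimes>\<^sub>M Seq M) (Seq M) (\<lambda>(s, \<omega>). case_nat s \<omega>))"
    by (simp add: PiM_iter)
  also have "\<dots> = (\<integral>\<^sup>+z. f (case z of (s, \<omega>) \<Rightarrow> case_nat s \<omega>) \<partial>(M \<Otimes>\<^sub>M Seq M))"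
    by (rule nn_integral_distr[OF m]) (simp add: f)
  also have "\<dots> = (\<integral>\<^sup>+x. \<integral>\<^sup>+z. f (case_nat x z) \<partial>Seq M \<partial>M)"
    using measurable_compose[OF m f] by (subst S.nn_integral_fst[symmetric]) auto
  finally show ?thesis .
qed

text \<open>An i.i.d. sequence is characterised by its regenerative structure: the head has law \<open>R\<close> and is independent
  of the tail, which has the law of the whole sequence. Iterating determines the measure of all cylinders.
  Both laws computed below satisfy this by inspection of their recursive definition.\<close>

lemma Seq_eqI:
  assumes "prob_space R" "prob_space Q" and sets: "sets Q = sets (Seq R)"
    and shift: "\<And>A C. A \<in> sets R \<Longrightarrow> C \<in> sets (Seq R) \<Longrightarrow>
      (\<integral>\<^sup>+z. indicator A (z 0) * indicator C (\<lambda>n. z (Suc n)) \<partial>Q) = emeasure R A * emeasure Q C"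
  shows "Q = Seq R"
proof -
  interpret R: prob_space R by fact
  interpret Q: prob_space Q by fact
  interpret sequence_space R by unfold_locales
  have space: "space Q = space (Seq R)" by (rule sets_eq_imp_space_eq[OF sets])
  define box where "box n F = {z \<in> space (Seq R). \<forall>i<n. z i \<in> F i}" for n and F :: "nat \<Rightarrow> _ set"
  have box: "box n F \<in> sets (Seq R)" if "\<And>i. F i \<in> sets R" for n F
    unfolding box_def using that by measurable
  have shiftsp: "(\<lambda>n. z (Suc n)) \<in> space (Seq R)" if "z \<in> space (Seq R)" for z
    using that by (auto simp: space_PiM)
  have cyl: "emeasure Q (box n F) = (\<Prod>i<n. emeasure R (F i))" if "\<And>i. F i \<in> sets R" for n F
    using that
  proof (induction n arbitrary: F)
    case 0
    then show ?case using Q.emeasure_space_1 by (simp add: box_def space)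
  next
    case (Suc n)
    have "emeasure Q (box (Suc n) F) = (\<integral>\<^sup>+z. indicator (box (Suc n) F) z \<partial>Q)"
      using box[OF Suc.prems, of "Suc n"] sets by simp
    also have "\<dots> = (\<integral>\<^sup>+z. indicator (F 0) (z 0) * indicator (box n (\<lambda>i. F (Suc i))) (\<lambda>n. z (Suc n)) \<partial>Q)"
      by (rule nn_integral_cong) (auto simp: space shiftsp box_def indicator_def less_Suc_eq_0_disj)
    also have "\<dots> = emeasure R (F 0) * emeasure Q (box n (\<lambda>i. F (Suc i)))"
      by (rule shift) (use Suc.prems box in auto)
    finally show ?case using Suc.IH[of "\<lambda>i. F (Suc i)"] Suc.prems by (simp add: prod.lessThan_Suc_shift del: prod.lessThan_Suc)
  qed
  show ?thesis
  proof (rule PiM_eq[OF sets])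
    fix J :: "nat set" and F assume J: "finite J" "J \<subseteq> UNIV" "\<And>j. j \<in> J \<Longrightarrow> F j \<in> sets R"
    obtain n where n: "J \<subseteq> {..<n}" using finite_nat_iff_bounded J(1) by auto
    define F' where "F' i = (if i \<in> J then F i else space R)" for i
    have "prod_emb UNIV (\<lambda>_. R) J (Pi\<^sub>E J F) = box n F'"
    proof -
      have "x \<in> prod_emb UNIV (\<lambda>_. R) J (Pi\<^sub>E J F) \<longleftrightarrow> (\<forall>i. x i \<in> space R) \<and> (\<forall>i\<in>J. x i \<in> F i)" for x
        by (auto simp: prod_emb_def PiE_iff)
      moreover have "x \<in> box n F' \<longleftrightarrow> (\<forall>i. x i \<in> space R) \<and> (\<forall>i<n. i \<in> J \<longrightarrow> x i \<in> F i)" for x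
        by (auto simp: F'_def box_def space_PiM PiE_iff)
      ultimately show ?thesis using n by blast
    qed
    then have "emeasure Q (prod_emb UNIV (\<lambda>_. R) J (Pi\<^sub>E J F)) = emeasure Q (box n F')" by simp
    also have "\<dots> = (\<Prod>i<n. emeasure R (F' i))"
      by (rule cyl) (simp add: F'_def J(3))
    also have "\<dots> = (\<Prod>i\<in>J. emeasure R (F' i))"
      by (rule prod.mono_neutral_right) (use n in \<open>simp_all add: F'_def R.emeasure_space_1\<close>)
    also have "\<dots> = (\<Prod>i\<in>J. emeasure R (F i))" by (simp add: F'_def)
    finally show "emeasure Q (prod_emb UNIV (\<lambda>_. R) J (Pi\<^sub>E J F)) = (\<Prod>j\<in>J. emeasure R (F j))" .
  qed
qed

text \<open>Head and tail of the sequence of pairs are independent because those of both sequences are, and the two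
  sequences are independent; so \<open>Seq_eqI\<close> applies.\<close>

lemma distr_zip_Seq:
  assumes "prob_space M" "prob_space N"
  shows "distr (Seq M \<Otimes>\<^sub>M Seq N) (Seq (M \<Otimes>\<^sub>M N)) (\<lambda>(x, y) n. (x n, y n)) = Seq (M \<Otimes>\<^sub>M N)"
proof -
  interpret M: prob_space M by fact
  interpret N: prob_space N by fact
  interpret SM: prob_space "Seq M" by (rule prob_space_Seq) fact
  interpret SN: prob_space "Seq N" by (rule prob_space_Seq) fact
  interpret SMN: pair_prob_space "Seq M" "Seq N" ..
  interpret MN: pair_prob_space M N ..
  have zm: "(\<lambda>z n. (f z n, g z n)) \<in> L \<rightarrow>\<^sub>M Seq (M \<Otimes>\<^sub>M N)" if "f \<in> L \<rightarrow>\<^sub>M Seq M" "g \<in> L \<rightarrow>\<^sub>M Seq N" for f g L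
    using measurable_Seq_nth[OF that(1)] measurable_Seq_nth[OF that(2)] by (intro measurable_SeqI measurable_Pair)
  let ?z = "\<lambda>(x, y) n. (x n, y n)" and ?S = "Seq M \<Otimes>\<^sub>M Seq N"
  have z: "?z \<in> ?S \<rightarrow>\<^sub>M Seq (M \<Otimes>\<^sub>M N)"
    using zm[OF measurable_fst measurable_snd] by (simp add: case_prod_unfold)
  show ?thesis
  proof (rule Seq_eqI)
    show "prob_space (distr ?S (Seq (M \<Otimes>\<^sub>M N)) ?z)" by (rule SMN.P.prob_space_distr[OF z])
    fix A C assume A [measurable]: "A \<in> sets (M \<Otimes>\<^sub>M N)" and C: "C \<in> sets (Seq (M \<Otimes>\<^sub>M N))"
    have Cm: "(\<lambda>z. indicator C (\<lambda>n. (f z n, g z n)) :: ennreal) \<in> borel_measurable L"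
      if "f \<in> L \<rightarrow>\<^sub>M Seq M" "g \<in> L \<rightarrow>\<^sub>M Seq N" for f g L
      using measurable_compose[OF zm[OF that] indicator_ennreal[OF C]] .
    have Am: "(\<lambda>z. indicator A (f z, g z) :: ennreal) \<in> borel_measurable L"
      if "f \<in> L \<rightarrow>\<^sub>M M" "g \<in> L \<rightarrow>\<^sub>M N" for f g L
      using measurable_compose[OF measurable_Pair[OF that] indicator_ennreal[OF A]] .
    have m1: "(\<lambda>z. indicator A (z 0) * indicator C (\<lambda>n. z (Suc n)) :: ennreal) \<in> borel_measurable (Seq (M \<Otimes>\<^sub>M N))"
      using A C by (rule borel_measurable_head_tail)
    have "emeasure (distr ?S (Seq (M \<Otimes>\<^sub>M N)) ?z) C = (\<integral>\<^sup>+z. indicator C z \<partial>distr ?S (Seq (M \<Otimes>\<^sub>M N)) ?z)"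
      using C by simp
    also have "\<dots> = (\<integral>\<^sup>+z. indicator C (?z z) \<partial>?S)"
      using C by (intro nn_integral_distr[OF z]) simp
    also have "\<dots> = (\<integral>\<^sup>+x. \<integral>\<^sup>+y. indicator C (\<lambda>n. (x n, y n)) \<partial>Seq N \<partial>Seq M)"
      using Cm[OF measurable_fst measurable_snd]
      by (subst SN.nn_integral_fst[symmetric]) (auto simp: case_prod_unfold)
    finally have eC: "emeasure (distr ?S (Seq (M \<Otimes>\<^sub>M N)) ?z) C = (\<integral>\<^sup>+x. \<integral>\<^sup>+y. indicator C (\<lambda>n. (x n, y n)) \<partial>Seq N \<partial>Seq M)" .
    have eA: "emeasure (M \<Otimes>\<^sub>M N) A = (\<integral>\<^sup>+x. \<integral>\<^sup>+y. indicator A (x, y) \<partial>N \<partial>M)"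
      by (subst N.nn_integral_fst) auto
    have "(\<integral>\<^sup>+z. indicator A (z 0) * indicator C (\<lambda>n. z (Suc n)) \<partial>distr ?S (Seq (M \<Otimes>\<^sub>M N)) ?z) =
       (\<integral>\<^sup>+z. indicator A (?z z 0) * indicator C (\<lambda>n. ?z z (Suc n)) \<partial>?S)"
      using m1 by (intro nn_integral_distr[OF z]) simp
    also have "\<dots> = (\<integral>\<^sup>+x. \<integral>\<^sup>+y. indicator A (x 0, y 0) * indicator C (\<lambda>n. (x (Suc n), y (Suc n))) \<partial>Seq N \<partial>Seq M)"
      using measurable_compose[OF z m1]
      by (subst SN.nn_integral_fst[symmetric]) (auto simp: case_prod_unfold)
    also have "\<dots> = (\<integral>\<^sup>+x. (\<integral>\<^sup>+y. indicator A (x 0, y) \<partial>N) * (\<integral>\<^sup>+y. indicator C (\<lambda>n. (x (Suc n), y n)) \<partial>Seq N) \<partial>Seq M)"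
    proof (rule nn_integral_cong)
      fix x assume x: "x \<in> space (Seq M)"
      then have x0: "x 0 \<in> space M" and xs: "(\<lambda>n. x (Suc n)) \<in> space (Seq M)" by (auto simp: space_PiM)
      have "(\<integral>\<^sup>+y. indicator A (x 0, y 0) * indicator C (\<lambda>n. (x (Suc n), y (Suc n))) \<partial>Seq N) =
         (\<integral>\<^sup>+y0. \<integral>\<^sup>+y. indicator A (x 0, y0) * indicator C (\<lambda>n. (x (Suc n), y n)) \<partial>Seq N \<partial>N)"
        by (subst nn_integral_Seq) (use assms x0 xs in \<open>auto intro!: borel_measurable_times_ennreal Am Cm measurable_Seq_coords\<close>)
      also have "\<dots> = (\<integral>\<^sup>+y0. indicator A (x 0, y0) * (\<integral>\<^sup>+y. indicator C (\<lambda>n. (x (Suc n), y n)) \<partial>Seq N) \<partial>N)"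
        by (intro nn_integral_cong nn_integral_cmult) (use xs in \<open>auto intro!: Cm\<close>)
      also have "\<dots> = (\<integral>\<^sup>+y. indicator A (x 0, y) \<partial>N) * (\<integral>\<^sup>+y. indicator C (\<lambda>n. (x (Suc n), y n)) \<partial>Seq N)"
        by (intro nn_integral_multc) (use x0 in \<open>auto intro!: Am\<close>)
      finally show "(\<integral>\<^sup>+y. indicator A (x 0, y 0) * indicator C (\<lambda>n. (x (Suc n), y (Suc n))) \<partial>Seq N) = \<dots>" .
    qed
    also have "\<dots> = (\<integral>\<^sup>+x0. \<integral>\<^sup>+x. (\<integral>\<^sup>+y. indicator A (x0, y) \<partial>N) * (\<integral>\<^sup>+y. indicator C (\<lambda>n. (x n, y n)) \<partial>Seq N) \<partial>Seq M \<partial>M)"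
    proof -
      have "(\<lambda>x. (\<integral>\<^sup>+y. indicator A (x 0, y) \<partial>N) * (\<integral>\<^sup>+y. indicator C (\<lambda>n. (x (Suc n), y n)) \<partial>Seq N)) \<in> borel_measurable (Seq M)"
        by (intro borel_measurable_times_ennreal N.borel_measurable_nn_integral SN.borel_measurable_nn_integral)
          (auto simp: case_prod_unfold intro!: Am Cm measurable_Seq_coords)
      from nn_integral_Seq[OF assms(1) this] show ?thesis by simp
    qed
    also have "\<dots> = (\<integral>\<^sup>+x0. (\<integral>\<^sup>+y. indicator A (x0, y) \<partial>N) * (\<integral>\<^sup>+x. \<integral>\<^sup>+y. indicator C (\<lambda>n. (x n, y n)) \<partial>Seq N \<partial>Seq M) \<partial>M)"
      by (intro nn_integral_cong nn_integral_cmult SN.borel_measurable_nn_integral) (auto simp: case_prod_unfold intro!: Cm)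
    also have "\<dots> = (\<integral>\<^sup>+x. \<integral>\<^sup>+y. indicator A (x, y) \<partial>N \<partial>M) * (\<integral>\<^sup>+x. \<integral>\<^sup>+y. indicator C (\<lambda>n. (x n, y n)) \<partial>Seq N \<partial>Seq M)"
      by (intro nn_integral_multc N.borel_measurable_nn_integral) (auto simp: case_prod_unfold intro!: Am)
    finally show "(\<integral>\<^sup>+z. indicator A (z 0) * indicator C (\<lambda>n. z (Suc n)) \<partial>distr ?S (Seq (M \<Otimes>\<^sub>M N)) ?z) =
       emeasure (M \<Otimes>\<^sub>M N) A * emeasure (distr ?S (Seq (M \<Otimes>\<^sub>M N)) ?z) C"
      by (simp add: eA eC)
  qed (simp_all add: MN.P.prob_space_axioms)
qed

text \<open>The bit \<open>b 0\<close> tells from which of the two sequences the next entry is taken; that sequence advances,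
  the other one waits. The maps \<open>l\<close> and \<open>r\<close> place the entries into their cells.\<close>

fun interleave :: "('a \<Rightarrow> 'c) \<Rightarrow> ('a \<Rightarrow> 'c) \<Rightarrow> (nat \<Rightarrow> bool) \<Rightarrow> (nat \<Rightarrow> 'a) \<Rightarrow> (nat \<Rightarrow> 'a) \<Rightarrow> nat \<Rightarrow> 'c" where
  "interleave l r b x y 0 = (if b 0 then l (x 0) else r (y 0))"
| "interleave l r b x y (Suc n) =
    (if b 0 then interleave l r (\<lambda>i. b (Suc i)) (\<lambda>i. x (Suc i)) y n else interleave l r (\<lambda>i. b (Suc i)) x (\<lambda>i. y (Suc i)) n)"

lemma measurable_interleave:
  assumes lr: "l \<in> N \<rightarrow>\<^sub>M R" "r \<in> N \<rightarrow>\<^sub>M R"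
    and fgh: "f \<in> L \<rightarrow>\<^sub>M Seq (measure_pmf B)" "g \<in> L \<rightarrow>\<^sub>M Seq N" "h \<in> L \<rightarrow>\<^sub>M Seq N"
  shows "(\<lambda>z. interleave l r (f z) (g z) (h z)) \<in> L \<rightarrow>\<^sub>M Seq R"
proof (rule measurable_SeqI)
  fix n show "(\<lambda>z. interleave l r (f z) (g z) (h z) n) \<in> L \<rightarrow>\<^sub>M R"
    using fgh
  proof (induction n arbitrary: f g h)
    case 0
    have [measurable]: "(\<lambda>z. f z 0) \<in> L \<rightarrow>\<^sub>M count_space UNIV" using measurable_Seq_nth[OF 0(1), of 0] by simp
    show ?case
      unfolding interleave.simps
      by (intro measurable_If measurable_compose[OF measurable_Seq_nth[OF 0(2)] lr(1)]
        measurable_compose[OF measurable_Seq_nth[OF 0(3)] lr(2)]) measurable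
  next
    case (Suc n)
    have [measurable]: "(\<lambda>z. f z 0) \<in> L \<rightarrow>\<^sub>M count_space UNIV" using measurable_Seq_nth[OF Suc.prems(1), of 0] by simp
    show ?case
      unfolding interleave.simps
    proof (rule measurable_If)
      show "(\<lambda>z. interleave l r (\<lambda>i. f z (Suc i)) (\<lambda>i. g z (Suc i)) (h z) n) \<in> L \<rightarrow>\<^sub>M R"
        by (rule Suc.IH[OF measurable_Seq_shift[OF Suc.prems(1)] measurable_Seq_shift[OF Suc.prems(2)] Suc.prems(3)])
      show "(\<lambda>z. interleave l r (\<lambda>i. f z (Suc i)) (g z) (\<lambda>i. h z (Suc i)) n) \<in> L \<rightarrow>\<^sub>M R"
        by (rule Suc.IH[OF measurable_Seq_shift[OF Suc.prems(1)] Suc.prems(2) measurable_Seq_shift[OF Suc.prems(3)]])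
    qed measurable
  qed
qed

lemma nn_integral_distr_interleave:
  fixes u :: real
  assumes N: "prob_space N" and lr: "l \<in> N \<rightarrow>\<^sub>M R" "r \<in> N \<rightarrow>\<^sub>M R" and f: "f \<in> borel_measurable (Seq R)"
  defines "B \<equiv> Seq (measure_pmf (bernoulli_pmf u))"
  shows "(\<integral>\<^sup>+z. f z \<partial>distr (B \<Otimes>\<^sub>M (Seq N \<Otimes>\<^sub>M Seq N)) (Seq R) (\<lambda>(b, x, y). interleave l r b x y)) =
    (\<integral>\<^sup>+b. \<integral>\<^sup>+x. \<integral>\<^sup>+y. f (interleave l r b x y) \<partial>Seq N \<partial>Seq N \<partial>B)"
    (is "(\<integral>\<^sup>+z. f z \<partial>distr ?L _ ?m) = _")
proof -
  interpret SN: prob_space "Seq N" by (rule prob_space_Seq) fact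
  interpret SN2: pair_prob_space "Seq N" "Seq N" ..
  have m: "?m \<in> ?L \<rightarrow>\<^sub>M Seq R"
    using measurable_interleave[OF lr measurable_fst measurable_compose[OF measurable_snd measurable_fst]
      measurable_compose[OF measurable_snd measurable_snd]] by (simp add: case_prod_unfold B_def)
  have "(\<integral>\<^sup>+z. f z \<partial>distr ?L (Seq R) ?m) = (\<integral>\<^sup>+z. f (?m z) \<partial>?L)"
    by (rule nn_integral_distr[OF m]) (simp add: f)
  also have "\<dots> = (\<integral>\<^sup>+b. \<integral>\<^sup>+p. f (?m (b, p)) \<partial>(Seq N \<Otimes>\<^sub>M Seq N) \<partial>B)"
    using measurable_compose[OF m f] by (subst SN2.P.nn_integral_fst[symmetric]) auto
  also have "\<dots> = (\<integral>\<^sup>+b. \<integral>\<^sup>+x. \<integral>\<^sup>+y. f (?m (b, x, y)) \<partial>Seq N \<partial>Seq N \<partial>B)"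
  proof (rule nn_integral_cong)
    fix b assume "b \<in> space B"
    then have "(\<lambda>p. f (?m (b, p))) \<in> borel_measurable (Seq N \<Otimes>\<^sub>M Seq N)"
      using measurable_compose[OF measurable_Pair1' measurable_compose[OF m f]] by simp
    from SN.nn_integral_fst[OF this] show "(\<integral>\<^sup>+p. f (?m (b, p)) \<partial>(Seq N \<Otimes>\<^sub>M Seq N)) =
        (\<integral>\<^sup>+x. \<integral>\<^sup>+y. f (?m (b, x, y)) \<partial>Seq N \<partial>Seq N)" by simp
  qed
  finally show ?thesis by simp
qed

text \<open>Interleaving two independent i.i.d. sequences by i.i.d. bits of parameter \<open>u\<close> gives an i.i.d. sequence
  whose common law is the mixture of the two laws with weights \<open>u\<close> and \<open>1 - u\<close>. Given the first bit, the head is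
  a fresh entry of the sequence selected, and what remains are again three independent i.i.d.
  sequences, so \<open>Seq_eqI\<close> applies.\<close>

theorem distr_interleave_Seq:
  fixes u :: real
  assumes u: "u \<in> {0..1}" and N: "prob_space N" and R: "prob_space R"
    and lr: "l \<in> N \<rightarrow>\<^sub>M R" "r \<in> N \<rightarrow>\<^sub>M R"
    and mix: "\<And>A. A \<in> sets R \<Longrightarrow> emeasure R A =
      ennreal u * (\<integral>\<^sup>+x. indicator A (l x) \<partial>N) + ennreal (1 - u) * (\<integral>\<^sup>+x. indicator A (r x) \<partial>N)"
  shows "distr (Seq (measure_pmf (bernoulli_pmf u)) \<Otimes>\<^sub>M (Seq N \<Otimes>\<^sub>M Seq N)) (Seq R) (\<lambda>(b, x, y). interleave l r b x y) = Seq R"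
    (is "distr ?L _ ?m = _")
proof -
  let ?B = "Seq (measure_pmf (bernoulli_pmf u))"
  interpret N: prob_space N by fact
  interpret SN: prob_space "Seq N" by (rule prob_space_Seq) fact
  interpret SN2: pair_prob_space "Seq N" "Seq N" ..
  have pb: "prob_space (measure_pmf (bernoulli_pmf u))" by unfold_locales
  interpret SB: prob_space ?B by (rule prob_space_Seq) fact
  interpret T: pair_prob_space ?B "Seq N \<Otimes>\<^sub>M Seq N" ..
  have m: "?m \<in> ?L \<rightarrow>\<^sub>M Seq R"
    using measurable_interleave[OF lr measurable_fst measurable_compose[OF measurable_snd measurable_fst]
      measurable_compose[OF measurable_snd measurable_snd]] by (simp add: case_prod_unfold)
  have iter: "(\<integral>\<^sup>+z. f z \<partial>distr ?L (Seq R) ?m) = (\<integral>\<^sup>+b. \<integral>\<^sup>+x. \<integral>\<^sup>+y. f (interleave l r b x y) \<partial>Seq N \<partial>Seq N \<partial>?B)"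
    if f: "f \<in> borel_measurable (Seq R)" for f :: "_ \<Rightarrow> ennreal"
    by (rule nn_integral_distr_interleave[OF N lr f])
  show ?thesis
  proof (rule Seq_eqI[OF R])
    show "prob_space (distr ?L (Seq R) ?m)" by (rule T.P.prob_space_distr[OF m])
    fix A C assume A: "A \<in> sets R" and C: "C \<in> sets (Seq R)"
    have Cm: "(\<lambda>z. indicator C (interleave l r (f z) (g z) (h z)) :: ennreal) \<in> borel_measurable L"
      if "f \<in> L \<rightarrow>\<^sub>M ?B" "g \<in> L \<rightarrow>\<^sub>M Seq N" "h \<in> L \<rightarrow>\<^sub>M Seq N" for f g h L
      using measurable_compose[OF measurable_interleave[OF lr that] indicator_ennreal[OF C]] .
    have lrm: "(\<lambda>z. indicator A (l (f z)) :: ennreal) \<in> borel_measurable L"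
        "(\<lambda>z. indicator A (r (f z)) :: ennreal) \<in> borel_measurable L"
      if "f \<in> L \<rightarrow>\<^sub>M N" for f L
      using measurable_compose[OF measurable_compose[OF that lr(1)] indicator_ennreal[OF A]]
        measurable_compose[OF measurable_compose[OF that lr(2)] indicator_ennreal[OF A]] .
    have m1: "(\<lambda>z. indicator A (z 0) * indicator C (\<lambda>n. z (Suc n)) :: ennreal) \<in> borel_measurable (Seq R)"
      using A C by (rule borel_measurable_head_tail)
    define K where "K = (\<integral>\<^sup>+b. \<integral>\<^sup>+x. \<integral>\<^sup>+y. indicator C (interleave l r b x y) \<partial>Seq N \<partial>Seq N \<partial>?B)"
    have eC: "emeasure (distr ?L (Seq R) ?m) C = K"
      using iter[OF indicator_ennreal[OF C]] C by (simp add: K_def)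
    let ?g = "\<lambda>b x y. indicator A (interleave l r b x y 0) * indicator C (\<lambda>n. interleave l r b x y (Suc n)) :: ennreal"
    have left: "(\<integral>\<^sup>+b. \<integral>\<^sup>+x. \<integral>\<^sup>+y. ?g (case_nat True b) x y \<partial>Seq N \<partial>Seq N \<partial>?B) = (\<integral>\<^sup>+x. indicator A (l x) \<partial>N) * K"
    proof -
      have "(\<integral>\<^sup>+b. \<integral>\<^sup>+x. \<integral>\<^sup>+y. ?g (case_nat True b) x y \<partial>Seq N \<partial>Seq N \<partial>?B) =
        (\<integral>\<^sup>+b. \<integral>\<^sup>+x. \<integral>\<^sup>+y. indicator A (l (x 0)) * indicator C (interleave l r b (\<lambda>n. x (Suc n)) y) \<partial>Seq N \<partial>Seq N \<partial>?B)"
        by simp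
      also have "\<dots> = (\<integral>\<^sup>+b. \<integral>\<^sup>+x. indicator A (l (x 0)) * (\<integral>\<^sup>+y. indicator C (interleave l r b (\<lambda>n. x (Suc n)) y) \<partial>Seq N) \<partial>Seq N \<partial>?B)"
        by (intro nn_integral_cong nn_integral_cmult Cm measurable_const space_Seq_shift measurable_ident[unfolded id_def]; assumption?)
      also have "\<dots> = (\<integral>\<^sup>+b. \<integral>\<^sup>+x0. \<integral>\<^sup>+x. indicator A (l x0) * (\<integral>\<^sup>+y. indicator C (interleave l r b x y) \<partial>Seq N) \<partial>Seq N \<partial>N \<partial>?B)"
        by (intro nn_integral_cong, subst nn_integral_Seq[OF N])
           (auto simp: case_prod_unfold intro!: borel_measurable_times_ennreal lrm SN.borel_measurable_nn_integral Cm measurable_Seq_coords)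
      also have "\<dots> = (\<integral>\<^sup>+b. \<integral>\<^sup>+x0. indicator A (l x0) * (\<integral>\<^sup>+x. \<integral>\<^sup>+y. indicator C (interleave l r b x y) \<partial>Seq N \<partial>Seq N) \<partial>N \<partial>?B)"
        by (intro nn_integral_cong nn_integral_cmult SN.borel_measurable_nn_integral) (auto simp: case_prod_unfold intro!: Cm)
      also have "\<dots> = (\<integral>\<^sup>+b. (\<integral>\<^sup>+x. indicator A (l x) \<partial>N) * (\<integral>\<^sup>+x. \<integral>\<^sup>+y. indicator C (interleave l r b x y) \<partial>Seq N \<partial>Seq N) \<partial>?B)"
        by (intro nn_integral_cong nn_integral_multc) (auto intro!: lrm)
      also have "\<dots> = (\<integral>\<^sup>+x. indicator A (l x) \<partial>N) * K"
        unfolding K_def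
        by (intro nn_integral_cmult SN.borel_measurable_nn_integral) (auto simp: case_prod_unfold intro!: SN.borel_measurable_nn_integral Cm)
      finally show ?thesis .
    qed
    have right: "(\<integral>\<^sup>+b. \<integral>\<^sup>+x. \<integral>\<^sup>+y. ?g (case_nat False b) x y \<partial>Seq N \<partial>Seq N \<partial>?B) = (\<integral>\<^sup>+x. indicator A (r x) \<partial>N) * K"
    proof -
      have "(\<integral>\<^sup>+b. \<integral>\<^sup>+x. \<integral>\<^sup>+y. ?g (case_nat False b) x y \<partial>Seq N \<partial>Seq N \<partial>?B) =
        (\<integral>\<^sup>+b. \<integral>\<^sup>+x. \<integral>\<^sup>+y. indicator A (r (y 0)) * indicator C (interleave l r b x (\<lambda>n. y (Suc n))) \<partial>Seq N \<partial>Seq N \<partial>?B)"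
        by simp
      also have "\<dots> = (\<integral>\<^sup>+b. \<integral>\<^sup>+x. \<integral>\<^sup>+y0. \<integral>\<^sup>+y. indicator A (r y0) * indicator C (interleave l r b x y) \<partial>Seq N \<partial>N \<partial>Seq N \<partial>?B)"
        by (intro nn_integral_cong, subst nn_integral_Seq[OF N])
           (auto intro!: borel_measurable_times_ennreal lrm Cm measurable_Seq_coords)
      also have "\<dots> = (\<integral>\<^sup>+b. \<integral>\<^sup>+x. \<integral>\<^sup>+y0. indicator A (r y0) * (\<integral>\<^sup>+y. indicator C (interleave l r b x y) \<partial>Seq N) \<partial>N \<partial>Seq N \<partial>?B)"
        by (intro nn_integral_cong nn_integral_cmult) (auto intro!: Cm)
      also have "\<dots> = (\<integral>\<^sup>+b. \<integral>\<^sup>+x. (\<integral>\<^sup>+x. indicator A (r x) \<partial>N) * (\<integral>\<^sup>+y. indicator C (interleave l r b x y) \<partial>Seq N) \<partial>Seq N \<partial>?B)"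
        by (intro nn_integral_cong nn_integral_multc) (auto intro!: lrm)
      also have "\<dots> = (\<integral>\<^sup>+b. (\<integral>\<^sup>+x. indicator A (r x) \<partial>N) * (\<integral>\<^sup>+x. \<integral>\<^sup>+y. indicator C (interleave l r b x y) \<partial>Seq N \<partial>Seq N) \<partial>?B)"
        by (intro nn_integral_cong nn_integral_cmult SN.borel_measurable_nn_integral) (auto simp: case_prod_unfold intro!: Cm)
      also have "\<dots> = (\<integral>\<^sup>+x. indicator A (r x) \<partial>N) * K"
        unfolding K_def
        by (intro nn_integral_cmult SN.borel_measurable_nn_integral) (auto simp: case_prod_unfold intro!: SN.borel_measurable_nn_integral Cm)
      finally show ?thesis .
    qed
    have gm: "(\<lambda>b. \<integral>\<^sup>+x. \<integral>\<^sup>+y. ?g b x y \<partial>Seq N \<partial>Seq N) \<in> borel_measurable ?B"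
    proof -
      have "(\<lambda>((b, x), y). ?g b x y) \<in> borel_measurable ((?B \<Otimes>\<^sub>M Seq N) \<Otimes>\<^sub>M Seq N)"
        using measurable_compose[OF measurable_interleave[OF lr measurable_compose[OF measurable_fst measurable_fst]
           measurable_compose[OF measurable_fst measurable_snd] measurable_snd] m1]
        by (simp add: case_prod_unfold)
      then have "(\<lambda>(b, x). \<integral>\<^sup>+y. ?g b x y \<partial>Seq N) \<in> borel_measurable (?B \<Otimes>\<^sub>M Seq N)"
        using SN.borel_measurable_nn_integral[of "\<lambda>(b, x) y. ?g b x y" "?B \<Otimes>\<^sub>M Seq N"] by (simp add: case_prod_unfold)
      then show ?thesis by (rule SN.borel_measurable_nn_integral)
    qed
    have "(\<integral>\<^sup>+z. indicator A (z 0) * indicator C (\<lambda>n. z (Suc n)) \<partial>distr ?L (Seq R) ?m) =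
      (\<integral>\<^sup>+b. \<integral>\<^sup>+x. \<integral>\<^sup>+y. ?g b x y \<partial>Seq N \<partial>Seq N \<partial>?B)"
      by (rule iter[OF m1])
    also have "\<dots> = (\<integral>\<^sup>+b0. \<integral>\<^sup>+b. \<integral>\<^sup>+x. \<integral>\<^sup>+y. ?g (case_nat b0 b) x y \<partial>Seq N \<partial>Seq N \<partial>?B \<partial>bernoulli_pmf u)"
      by (rule nn_integral_Seq[OF pb gm])
    also have "\<dots> = (\<integral>\<^sup>+x. indicator A (l x) \<partial>N) * K * ennreal u + (\<integral>\<^sup>+x. indicator A (r x) \<partial>N) * K * ennreal (1 - u)"
      unfolding left[symmetric] right[symmetric] using u by (subst nn_integral_bernoulli_pmf) auto
    also have "\<dots> = emeasure R A * K"
      by (simp add: mix[OF A] algebra_simps)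
    finally show "(\<integral>\<^sup>+z. indicator A (z 0) * indicator C (\<lambda>n. z (Suc n)) \<partial>distr ?L (Seq R) ?m) =
        emeasure R A * emeasure (distr ?L (Seq R) ?m) C" by (simp add: eC)
  qed simp
qed

text \<open>The event that \<open>c\<close> never occurs from time \<open>0\<close> on has a probability that is unchanged when multiplied by
  the probability of \<open>- {c}\<close>, which is less than \<open>1\<close>, hence it is null; from time \<open>n\<close> on the probability is the same by
  shifting.\<close>

lemma AE_Seq_infinitely_often:
  fixes q :: "bool pmf"
  assumes c: "pmf q c > 0"
  shows "AE b in Seq (measure_pmf q). \<forall>n. \<exists>m\<ge>n. b m = c"
proof -
  let ?B = "Seq (measure_pmf q)"
  have pq: "prob_space (measure_pmf q)" by (rule prob_space_measure_pmf)
  interpret B: prob_space ?B by (rule prob_space_Seq) (rule pq)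
  define E where "E n = {b \<in> space ?B. \<forall>m\<ge>n. b m \<noteq> c}" for n :: nat
  have E: "E n \<in> sets ?B" for n
  proof -
    have [measurable]: "(\<lambda>b. b m) \<in> ?B \<rightarrow>\<^sub>M count_space UNIV" for m
      using measurable_Seq_coords(1)[of m "measure_pmf q"] by simp
    show ?thesis unfolding E_def by measurable
  qed
  have sp: "space ?B = UNIV" by (auto simp: space_PiM)
  have E_iff: "b \<in> E n \<longleftrightarrow> (\<forall>m\<ge>n. b m \<noteq> c)" for b n by (simp only: E_def sp) simp
  have nat_split: "(\<forall>m. Q m) \<longleftrightarrow> Q 0 \<and> (\<forall>m. Q (Suc m))" for Q :: "nat \<Rightarrow> bool"
    by (metis not0_implies_Suc)
  have E_0: "case_nat c' b \<in> E 0 \<longleftrightarrow> c' \<noteq> c \<and> b \<in> E 0" for c' b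
    unfolding E_iff by (subst nat_split) simp
  have E_Suc: "case_nat c' b \<in> E (Suc n) \<longleftrightarrow> b \<in> E n" for c' b n
    unfolding E_iff by (subst nat_split) simp
  have step: "emeasure ?B A = (\<integral>\<^sup>+c'. \<integral>\<^sup>+b. indicator A (case_nat c' b) \<partial>?B \<partial>q)" if "A \<in> sets ?B" for A
    using nn_integral_Seq[OF pq indicator_ennreal[OF that]] that by simp
  have null: "emeasure ?B (E n) = 0" for n
  proof (induction n)
    case 0
    have "emeasure ?B (E 0) = (\<integral>\<^sup>+c'. indicator (- {c}) c' * emeasure ?B (E 0) \<partial>q)"
    proof (subst step[OF E], intro nn_integral_cong)
      fix c' assume "c' \<in> space (measure_pmf q)"
      have "(\<integral>\<^sup>+b. indicator (E 0) (case_nat c' b) \<partial>?B) = (\<integral>\<^sup>+b. indicator (- {c}) c' * indicator (E 0) b \<partial>?B)"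
        by (intro nn_integral_cong) (simp add: indicator_def E_0)
      also have "\<dots> = indicator (- {c}) c' * emeasure ?B (E 0)"
        using E by (subst nn_integral_cmult) auto
      finally show "(\<integral>\<^sup>+b. indicator (E 0) (case_nat c' b) \<partial>?B) = indicator (- {c}) c' * emeasure ?B (E 0)" .
    qed
    also have "\<dots> = emeasure q (- {c}) * emeasure ?B (E 0)"
      by (subst nn_integral_multc) auto
    finally have "measure ?B (E 0) = measure q (- {c}) * measure ?B (E 0)"
      by (simp add: B.emeasure_eq_measure measure_pmf.emeasure_eq_measure ennreal_mult'[symmetric])
    moreover have "measure q (- {c}) = 1 - pmf q c"
      using measure_pmf.prob_compl[of "{c}" q] by (simp add: Compl_eq_Diff_UNIV measure_pmf_single)
    ultimately have "pmf q c * measure ?B (E 0) = 0" by (simp add: algebra_simps)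
    then show ?case using c by (simp add: B.emeasure_eq_measure)
  next
    case (Suc n)
    have "emeasure ?B (E (Suc n)) = (\<integral>\<^sup>+c'. \<integral>\<^sup>+b. indicator (E (Suc n)) (case_nat c' b) \<partial>?B \<partial>q)"
      by (rule step[OF E])
    also have "\<dots> = (\<integral>\<^sup>+c'. emeasure ?B (E n) \<partial>q)"
    proof (intro nn_integral_cong)
      fix c' assume "c' \<in> space (measure_pmf q)"
      have "(\<integral>\<^sup>+b. indicator (E (Suc n)) (case_nat c' b) \<partial>?B) = (\<integral>\<^sup>+b. indicator (E n) b \<partial>?B)"
        by (intro nn_integral_cong) (simp add: indicator_def E_Suc)
      then show "(\<integral>\<^sup>+b. indicator (E (Suc n)) (case_nat c' b) \<partial>?B) = emeasure ?B (E n)" using E by simp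
    qed
    finally show ?case by (simp add: Suc)
  qed
  have "AE b in ?B. \<forall>n. b \<notin> E n"
    unfolding AE_all_countable by (intro allI AE_not_in null_setsI null E)
  then show ?thesis using AE_space by eventually_elim (metis E_iff)
qed

lemma interleave_swap: "interleave l r b x y n = interleave r l (\<lambda>i. \<not> b i) y x n"
  by (induction n arbitrary: b x y) auto

text \<open>Every occurrence of the bit \<open>True\<close> uses up one entry of the first sequence, so no entry waits forever.\<close>

lemma interleave_cofinal:
  assumes "\<forall>n. \<exists>m\<ge>n. b m"
  shows "\<exists>j. interleave l r b x y j = l (x k)"
proof -
  have "\<forall>n. \<exists>m\<ge>n. b m \<Longrightarrow> b m \<Longrightarrow> \<exists>j. interleave l r b x y j = l (x k)" for m
  proof (induction k arbitrary: b x y m)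
    case 0
    then show ?case
    proof (induction m arbitrary: b y)
      case 0
      then show ?case by (intro exI[of _ 0]) simp
    next
      case (Suc m)
      show ?case
      proof (cases "b 0")
        case True then show ?thesis by (intro exI[of _ 0]) simp
      next
        case False
        have "\<forall>n. \<exists>m\<ge>n. b (Suc m)" using Suc.prems(1) by (metis Suc_le_D Suc_le_mono)
        from Suc.IH[of "\<lambda>i. b (Suc i)" "\<lambda>i. y (Suc i)", OF this Suc.prems(2)]
        obtain j where "interleave l r (\<lambda>i. b (Suc i)) x (\<lambda>i. y (Suc i)) j = l (x 0)" by blast
        then show ?thesis using False by (intro exI[of _ "Suc j"]) simp
      qed
    qed
  next
    case (Suc k)
    from Suc.prems show ?case
    proof (induction m arbitrary: b y rule: less_induct)
      case (less m)
      \<comment> \<open>The inner induction skips the entries taken from \<open>y\<close> before the next entry of \<open>x\<close>.\<close>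
      have io: "\<forall>n. \<exists>m\<ge>n. b (Suc m)" using less.prems(1) by (metis Suc_le_D Suc_le_mono)
      show ?case
      proof (cases "b 0")
        case True
        from io obtain m' where "b (Suc m')" by blast
        from Suc.IH[of "\<lambda>i. b (Suc i)" m' "\<lambda>i. x (Suc i)" y, OF io this]
        obtain j where "interleave l r (\<lambda>i. b (Suc i)) (\<lambda>i. x (Suc i)) y j = l (x (Suc k))" by blast
        then show ?thesis using True by (intro exI[of _ "Suc j"]) simp
      next
        case False
        then obtain m' where m': "m = Suc m'" using less.prems(2) by (cases m) auto
        from less.IH[of m' "\<lambda>i. b (Suc i)" "\<lambda>i. y (Suc i)"] m' io less.prems(2)
        obtain j where "interleave l r (\<lambda>i. b (Suc i)) x (\<lambda>i. y (Suc i)) j = l (x (Suc k))" by blast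
        then show ?thesis using False by (intro exI[of _ "Suc j"]) simp
      qed
    qed
  qed
  then show ?thesis using assms by blast
qed

definition first_hit :: "('a \<Rightarrow> bool) \<Rightarrow> (nat \<Rightarrow> 'a) \<Rightarrow> 'a \<Rightarrow> bool" where
  "first_hit P z v \<longleftrightarrow> (\<exists>j. z j = v \<and> P (z j) \<and> (\<forall>i<j. \<not> P (z i)))"

text \<open>Interleaving preserves the order within each sequence. If the entries of the second sequence never satisfy
  \<open>P\<close>, the first hit of the interleaved sequence is therefore the first hit of the first sequence.\<close>

lemma first_hit_interleave:
  assumes r: "\<And>n. \<not> P (r (y n))" and io: "\<forall>n. \<exists>m\<ge>n. b m"
  shows "first_hit P (interleave l r b x y) v \<longleftrightarrow> first_hit P (\<lambda>n. l (x n)) v"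
proof -
  \<comment> \<open>A first hit of the interleaved sequence is the first hit of \<open>l \<circ> x\<close>; bits that select \<open>y\<close> only delay it.\<close>
  have *: "P (interleave l r b x y j) \<Longrightarrow> \<forall>i<j. \<not> P (interleave l r b x y i) \<Longrightarrow> first_hit P (\<lambda>n. l (x n)) (interleave l r b x y j)" for j
    using r
  proof (induction j arbitrary: b x y)
    case 0
    then have "b 0" by (auto split: if_splits)
    then show ?case using 0 by (auto simp: first_hit_def intro!: exI[of _ 0])
  next
    case (Suc j)
    show ?case
    proof (cases "b 0")
      case True
      have "\<not> P (l (x 0))" using Suc.prems(2)[rule_format, of 0] True by simp
      have "\<not> P (interleave l r (\<lambda>i. b (Suc i)) (\<lambda>i. x (Suc i)) y i)" if "i < j" for i
        using Suc.prems(2)[rule_format, of "Suc i"] True that by simp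
      then have "first_hit P (\<lambda>n. l (x (Suc n))) (interleave l r (\<lambda>i. b (Suc i)) (\<lambda>i. x (Suc i)) y j)"
        using Suc.IH[of "\<lambda>i. b (Suc i)" "\<lambda>i. x (Suc i)" y] Suc.prems True by simp
      then obtain k where "l (x (Suc k)) = interleave l r b x y (Suc j)" "P (l (x (Suc k)))" "\<forall>i<k. \<not> P (l (x (Suc i)))"
        using True by (auto simp: first_hit_def)
      then show ?thesis using \<open>\<not> P (l (x 0))\<close> unfolding first_hit_def
        by (intro exI[of _ "Suc k"]) (auto simp: less_Suc_eq_0_disj)
    next
      case False
      have "\<not> P (interleave l r (\<lambda>i. b (Suc i)) x (\<lambda>i. y (Suc i)) i)" if "i < j" for i
        using Suc.prems(2)[rule_format, of "Suc i"] False that by simp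
      then show ?thesis
        using Suc.IH[of "\<lambda>i. b (Suc i)" x "\<lambda>i. y (Suc i)"] Suc.prems False by simp
    qed
  qed
  show ?thesis
  proof
    assume "first_hit P (interleave l r b x y) v"
    then show "first_hit P (\<lambda>n. l (x n)) v" using * by (auto simp: first_hit_def[of P "interleave l r b x y"])
  next
    assume "first_hit P (\<lambda>n. l (x n)) v"
    then obtain k where k: "l (x k) = v" "P (l (x k))" "\<forall>i<k. \<not> P (l (x i))" by (auto simp: first_hit_def)
    \<comment> \<open>Conversely a hit exists, since \<open>l (x k)\<close> is used eventually; by the direction just shown, the first one is \<open>l (x k)\<close>.\<close>
    obtain j0 where "interleave l r b x y j0 = l (x k)" using interleave_cofinal[OF io] by blast
    then have ex: "\<exists>j. P (interleave l r b x y j)" using k by metis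
    define j where "j = (LEAST j. P (interleave l r b x y j))"
    have j: "P (interleave l r b x y j)" "\<forall>i<j. \<not> P (interleave l r b x y i)"
      using LeastI_ex[OF ex] not_less_Least by (auto simp: j_def)
    from *[OF j] obtain k' where k': "l (x k') = interleave l r b x y j" "P (l (x k'))" "\<forall>i<k'. \<not> P (l (x i))" by (auto simp: first_hit_def)
    have "k = k'" using k k' by (metis linorder_neqE_nat)
    then show "first_hit P (interleave l r b x y) v" using k k' j by (auto simp: first_hit_def)
  qed
qed


section \<open>The recursive cographon is a fixed point\<close>

lemma rec_fun_less:
  assumes "x < y"
  shows "rec_fun U S x y = of_bool (\<exists>j. is_first_cut U x y j \<and> S j = Minus)" "rec_fun U S y x = rec_fun U S x y"
  using assms by (auto simp: rec_fun_def rec_prec_def max_def min_def)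

lemma rec_fun_diag [simp]: "rec_fun U S x x = 0"
  by (simp add: rec_fun_def rec_prec_def)

text \<open>The first cut \<open>u\<close> decides the order of two points that it separates, and is irrelevant for the
  others.\<close>

lemma is_first_cut_case_nat:
  "(\<exists>j. is_first_cut (case_nat u U) x y j \<and> case_nat s S j = m) \<longleftrightarrow>
    (if u \<in> {x<..y} then s = m else \<exists>j. is_first_cut U x y j \<and> S j = m)"
proof (cases "u \<in> {x<..y}")
  case True
  have "is_first_cut (case_nat u U) x y j \<longleftrightarrow> j = 0" for j
    using True by (cases j) (auto simp: is_first_cut_def)
  then show ?thesis using True by simp
next
  case False
  have "is_first_cut (case_nat u U) x y (Suc j) \<longleftrightarrow> is_first_cut U x y j" "\<not> is_first_cut (case_nat u U) x y 0" for j
    using False by (auto simp: is_first_cut_def less_Suc_eq_0_disj split: nat.splits)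
  then have "(\<exists>j. is_first_cut (case_nat u U) x y j \<and> case_nat s S j = m) \<longleftrightarrow> (\<exists>j. is_first_cut U x y j \<and> S j = m)"
    by (metis not0_implies_Suc old.nat.simps(5))
  then show ?thesis by (simp only: False if_False)
qed

text \<open>Cuts with their signs are kept as one sequence of pairs, so that interleaving treats
  both together.\<close>

definition points :: "(nat \<Rightarrow> real \<times> sign) \<Rightarrow> nat \<Rightarrow> real" where "points z = (\<lambda>n. fst (z n))"
definition signs :: "(nat \<Rightarrow> real \<times> sign) \<Rightarrow> nat \<Rightarrow> sign" where "signs z = (\<lambda>n. snd (z n))"

lemma points_case_nat [simp]: "points (case_nat v z) = case_nat (fst v) (points z)"
  and signs_case_nat [simp]: "signs (case_nat v z) = case_nat (snd v) (signs z)"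
  by (auto simp: points_def signs_def fun_eq_iff split: nat.splits)

lemma first_hit_mark:
  "(\<exists>t. first_hit P z (t, m)) \<longleftrightarrow> (\<exists>j. snd (z j) = m \<and> P (z j) \<and> (\<forall>i<j. \<not> P (z i)))"
proof -
  have "(\<exists>t. z j = (t, m)) \<longleftrightarrow> snd (z j) = m" for j by (metis prod.collapse snd_conv)
  then show ?thesis unfolding first_hit_def by blast
qed

lemma first_cut_first_hit:
  "(\<exists>j. is_first_cut (points z) x y j \<and> signs z j = m) \<longleftrightarrow> (\<exists>t. first_hit (\<lambda>v. x < fst v \<and> fst v \<le> y) z (t, m))"
  unfolding first_hit_mark by (auto simp: is_first_cut_def points_def signs_def)

definition cell_mark :: "real \<Rightarrow> bool \<Rightarrow> real \<times> sign \<Rightarrow> real \<times> sign" where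
  "cell_mark u i v = (cell u i (fst v), snd v)"

lemma first_hit_cell_mark:
  assumes "\<And>t. x < cell u i t \<and> cell u i t \<le> y \<longleftrightarrow> a < t \<and> t \<le> b"
  shows "(\<exists>t. first_hit (\<lambda>v. x < fst v \<and> fst v \<le> y) (\<lambda>n. cell_mark u i (z n)) (t, m)) \<longleftrightarrow>
    (\<exists>j. is_first_cut (points z) a b j \<and> signs z j = m)"
  unfolding first_hit_mark by (auto simp: cell_mark_def assms is_first_cut_def points_def signs_def)

text \<open>Given a first cut \<open>u\<close>, the cuts between two points of one cell all come from the sequence that lives in
  that cell, so the two diagonal blocks are the recursive cographons of the two sequences.
  The points \<open>x = u\<close> and \<open>y = u\<close> are excluded: the cut \<open>u\<close> separates \<open>u\<close> from smaller points, whereas gluing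
  counts \<open>u\<close> as a point of the left cell.\<close>

lemma rec_fun_interleave:
  assumes u: "0 < u" "u < 1" and io: "\<forall>n. \<exists>m\<ge>n. b m" "\<forall>n. \<exists>m\<ge>n. \<not> b m"
    and zw: "\<And>n. fst (z n) \<in> {0..1}" "\<And>n. fst (w n) \<in> {0..1}"
    and xy: "x \<in> {0..1} - {u}" "y \<in> {0..1} - {u}"
  defines "m \<equiv> interleave (cell_mark u True) (cell_mark u False) b z w"
  shows "rec_fun (case_nat u (points m)) (case_nat s (signs m)) x y =
    glue_fun (rec_fun (points z) (signs z)) (rec_fun (points w) (signs w)) u (of_bool (s = Minus)) x y"
proof -
  have below: "rec_fun (case_nat u (points m)) (case_nat s (signs m)) x y =
    glue_fun (rec_fun (points z) (signs z)) (rec_fun (points w) (signs w)) u (of_bool (s = Minus)) x y"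
    if xy: "x \<in> {0..1} - {u}" "y \<in> {0..1} - {u}" "x < y" for x y
  proof -
    let ?P = "\<lambda>v. x < fst v \<and> fst v \<le> y"
    consider "y < u" | "x < u" "u < y" | "u < x" using xy by force
    then show ?thesis
    proof cases
      case 1
      \<comment> \<open>Cuts in the right cell do not separate points to the left of \<open>u\<close>.\<close>
      have nr: "\<not> ?P (cell_mark u False (w n))" for n
        using 1 u zw(2)[of n] by (auto simp: cell_mark_def cell_def) (smt (verit) mult_nonneg_nonneg)
      have eq: "first_hit ?P m v \<longleftrightarrow> first_hit ?P (\<lambda>n. cell_mark u True (z n)) v" for v
        unfolding m_def by (rule first_hit_interleave[where P = ?P and r = "cell_mark u False" and y = w, OF nr io(1)])
      have "x < cell u True t \<and> cell u True t \<le> y \<longleftrightarrow> x / u < t \<and> t \<le> y / u" for t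
        using u by (auto simp: cell_def field_simps)
      note hit = first_hit_cell_mark[where z = z and m = Minus, OF this]
      show ?thesis using 1 u xy
        by (simp add: rec_fun_less is_first_cut_case_nat first_cut_first_hit[of m] eq hit glue_fun_def divide_strict_right_mono)
    next
      case 2
      then show ?thesis using xy by (simp add: rec_fun_less is_first_cut_case_nat glue_fun_def)
    next
      case 3
      \<comment> \<open>Cuts in the left cell do not separate points to the right of \<open>u\<close>; the roles of the sequences are exchanged.\<close>
      have nl: "\<not> ?P (cell_mark u True (z n))" for n
        using 3 u zw(1)[of n] cell_True_le[of u "fst (z n)"] by (auto simp: cell_mark_def)
      have io': "\<forall>n. \<exists>m\<ge>n. \<not> b m" by (rule io(2))
      have eq: "first_hit ?P m v \<longleftrightarrow> first_hit ?P (\<lambda>n. cell_mark u False (w n)) v" for v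
      proof -
        have "m = interleave (cell_mark u False) (cell_mark u True) (\<lambda>i. \<not> b i) w z"
          unfolding m_def by (rule ext) (rule interleave_swap)
        then show ?thesis using first_hit_interleave[where P = ?P and r = "cell_mark u True" and y = z, OF nl io'] by simp
      qed
      have "x < cell u False t \<and> cell u False t \<le> y \<longleftrightarrow> (x - u) / (1 - u) < t \<and> t \<le> (y - u) / (1 - u)" for t
        using u by (auto simp: cell_def field_simps)
      note hit = first_hit_cell_mark[where z = w and m = Minus, OF this]
      show ?thesis using 3 u xy
        by (simp add: rec_fun_less is_first_cut_case_nat first_cut_first_hit[of m] eq hit glue_fun_def divide_strict_right_mono)
    qed
  qed
  have sym: "glue_fun (rec_fun (points z) (signs z)) (rec_fun (points w) (signs w)) u t y x =
     glue_fun (rec_fun (points z) (signs z)) (rec_fun (points w) (signs w)) u t x y" for t x y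
    by (auto simp: glue_fun_def rec_fun_def max.commute min.commute)
  show ?thesis
  proof (cases x y rule: linorder_cases)
    case less show ?thesis by (rule below[OF xy less])
  next
    case equal then show ?thesis by (simp add: glue_fun_def)
  next
    case greater
    from below[OF xy(2,1) greater] show ?thesis by (simp add: rec_fun_less(2)[OF greater] sym)
  qed
qed

text \<open>The cut norm of the difference vanishes, so the distance of the graphons does.\<close>

lemma abs_graphon_eq_cofinite:
  assumes g: "graphon_fun v" "graphon_fun w" and N: "finite N"
    and eq: "\<And>x y. x \<in> {0..1} - N \<Longrightarrow> y \<in> {0..1} - N \<Longrightarrow> v x y = w x y"
  shows "abs_graphon v = abs_graphon w"
proof -
  have k0: "kern (\<lambda>_ _. 0)" by (simp add: kern_def)
  have "dist (abs_graphon v) (abs_graphon w) \<le> cut_norm (\<lambda>x y. v x y - w x y)"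
    unfolding dist_abs_graphon[OF g] using cut_dist_lower[OF g mp_bij_id] .
  also have "\<dots> = cut_norm (\<lambda>_ _. 0)"
    by (rule cut_norm_cong_cofinite[OF kern_diff[OF g] k0 N]) (simp add: eq)
  also have "\<dots> \<le> 0" by (rule cut_norm_least) (simp add: set_lebesgue_integral_def)
  finally show ?thesis by simp
qed

lemma prob_space_rec_space: "prob_space (rec_space p)"
  unfolding rec_space_def by (intro prob_space_pair prob_space_Seq prob_space_unitM prob_space_measure_pmf)

lemma measurable_rec_graphon: "rec_graphon \<in> borel_measurable (rec_space p)"
proof -
  let ?P = "rec_space p \<Otimes>\<^sub>M (unitM \<Otimes>\<^sub>M unitM)"
  have "(\<lambda>\<omega>. abs_graphon ((\<lambda>(U, S). rec_fun U S) \<omega>)) \<in> borel_measurable (rec_space p)"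
  proof (rule borel_measurable_abs_graphon)
    show "graphon_fun ((\<lambda>(U, S). rec_fun U S) \<omega>)" for \<omega> by (simp add: case_prod_unfold graphon_fun_rec_fun)
    have f: "(\<lambda>z. fst (fst z)) \<in> ?P \<rightarrow>\<^sub>M Seq unitM" "(\<lambda>z. snd (fst z)) \<in> ?P \<rightarrow>\<^sub>M Seq (measure_pmf (sign_pmf p))"
      unfolding rec_space_def by measurable
    have [measurable]: "(\<lambda>z. fst (fst z) n) \<in> borel_measurable ?P" for n
      by (rule measurable_compose[OF measurable_Seq_nth[OF f(1)] measurable_unitM_real])
    have [measurable]: "(\<lambda>z. snd (fst z) n) \<in> ?P \<rightarrow>\<^sub>M count_space UNIV" for n
      using measurable_Seq_nth[OF f(2), of n] by simp
    have [measurable]: "(\<lambda>z. fst (snd z)) \<in> borel_measurable ?P" "(\<lambda>z. snd (snd z)) \<in> borel_measurable ?P"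
      using measurable_compose[OF measurable_compose[OF measurable_snd measurable_fst] measurable_unitM_real]
        measurable_compose[OF measurable_compose[OF measurable_snd measurable_snd] measurable_unitM_real] by auto
    have "(\<lambda>z. rec_fun (fst (fst z)) (snd (fst z)) (fst (snd z)) (snd (snd z))) \<in> borel_measurable ?P"
      unfolding rec_fun_def rec_prec_def is_first_cut_def greaterThanAtMost_iff by measurable
    then show "(\<lambda>(\<omega>, z). (\<lambda>(U, S). rec_fun U S) \<omega> (fst z) (snd z)) \<in> borel_measurable ?P"
      by (simp add: case_prod_unfold)
  qed
  then show ?thesis by (simp add: rec_graphon_def case_prod_unfold)
qed

abbreviation markM :: "real \<Rightarrow> (real \<times> sign) measure" where
  "markM p \<equiv> unitM \<Otimes>\<^sub>M measure_pmf (sign_pmf p)"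

lemma prob_space_markM: "prob_space (markM p)"
  by (intro prob_space_pair prob_space_unitM prob_space_measure_pmf)

lemma measurable_unzip: "(\<lambda>z. (points z, signs z)) \<in> Seq (markM p) \<rightarrow>\<^sub>M rec_space p"
  unfolding rec_space_def points_def signs_def
  by (intro measurable_Pair measurable_SeqI measurable_compose[OF measurable_Seq_coords(1) measurable_fst]
      measurable_compose[OF measurable_Seq_coords(1) measurable_snd])

text \<open>The two independent sequences of cuts and signs amount to one i.i.d. sequence of pairs.\<close>

lemma distr_unzip: "distr (Seq (markM p)) (rec_space p) (\<lambda>z. (points z, signs z)) = rec_space p"
proof -
  let ?z = "\<lambda>(x, y) n. (x n, y n)" and ?u = "\<lambda>z. (points z, signs z)"
  have zip: "distr (rec_space p) (Seq (markM p)) ?z = Seq (markM p)"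
    unfolding rec_space_def by (rule distr_zip_Seq) (rule prob_space_unitM prob_space_measure_pmf)+
  have zm: "?z \<in> rec_space p \<rightarrow>\<^sub>M Seq (markM p)"
  proof (rule measurable_SeqI)
    fix n
    have "(\<lambda>x. (fst x n, snd x n)) \<in> rec_space p \<rightarrow>\<^sub>M markM p"
      unfolding rec_space_def by (intro measurable_Pair measurable_Seq_coords)
    then show "(\<lambda>x. ?z x n) \<in> rec_space p \<rightarrow>\<^sub>M markM p" by (simp add: case_prod_unfold)
  qed
  have "distr (Seq (markM p)) (rec_space p) ?u = distr (distr (rec_space p) (Seq (markM p)) ?z) (rec_space p) ?u"
    by (simp only: zip)
  also have "\<dots> = distr (rec_space p) (rec_space p) (\<lambda>x. x)"
    unfolding distr_distr[OF measurable_unzip zm] by (rule distr_cong) (auto simp: points_def signs_def)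
  finally show ?thesis by (simp add: distr_id[unfolded id_def])
qed

lemma nn_integral_rec_space:
  "f \<in> borel_measurable (rec_space p) \<Longrightarrow> (\<integral>\<^sup>+\<omega>. f \<omega> \<partial>rec_space p) = (\<integral>\<^sup>+z. f (points z, signs z) \<partial>Seq (markM p))"
  by (subst distr_unzip[symmetric], subst nn_integral_distr[OF measurable_unzip]) (auto simp: distr_unzip)

lemma nn_integral_markM:
  assumes f: "f \<in> borel_measurable (markM p)"
  shows "(\<integral>\<^sup>+v. f v \<partial>markM p) = (\<integral>\<^sup>+t. \<integral>\<^sup>+s. f (t, s) \<partial>sign_pmf p \<partial>unitM)"
  by (rule sigma_finite_measure.nn_integral_fst[OF prob_space_imp_sigma_finite[OF prob_space_measure_pmf], symmetric]) (rule f)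

lemma measurable_cell_mark:
  assumes u: "u \<in> {0..1}" shows "cell_mark u i \<in> markM p \<rightarrow>\<^sub>M markM p"
  unfolding cell_mark_def[abs_def]
  by (intro measurable_Pair measurable_compose[OF measurable_fst measurable_cell[OF u]] measurable_snd)

text \<open>The mixture hypothesis of \<open>distr_interleave_Seq\<close> for a uniform point with an independent
  sign.\<close>

lemma emeasure_markM_cells:
  assumes u: "u \<in> {0..1}" and A: "A \<in> sets (markM p)"
  shows "emeasure (markM p) A = ennreal u * (\<integral>\<^sup>+v. indicator A (cell_mark u True v) \<partial>markM p) +
    ennreal (1 - u) * (\<integral>\<^sup>+v. indicator A (cell_mark u False v) \<partial>markM p)"
proof -
  have cell_mark: "(\<integral>\<^sup>+t. \<integral>\<^sup>+s. indicator A (cell u i t, s) \<partial>sign_pmf p \<partial>unitM) = (\<integral>\<^sup>+v. indicator A (cell_mark u i v) \<partial>markM p)" for i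
    by (subst nn_integral_markM[OF measurable_compose[OF measurable_cell_mark[OF u] indicator_ennreal[OF A]]]) (simp add: cell_mark_def)
  have "emeasure (markM p) A = (\<integral>\<^sup>+v. indicator A v \<partial>markM p)" using A by simp
  also have "\<dots> = (\<integral>\<^sup>+t. \<integral>\<^sup>+s. indicator A (t, s) \<partial>sign_pmf p \<partial>unitM)"
    by (rule nn_integral_markM[OF indicator_ennreal[OF A]])
  also have "\<dots> = ennreal u * (\<integral>\<^sup>+t. \<integral>\<^sup>+s. indicator A (cell u True t, s) \<partial>sign_pmf p \<partial>unitM) +
      ennreal (1 - u) * (\<integral>\<^sup>+t. \<integral>\<^sup>+s. indicator A (cell u False t, s) \<partial>sign_pmf p \<partial>unitM)"
    by (rule nn_integral_cells[OF u], rule measure_pmf.borel_measurable_nn_integral) (use indicator_ennreal[OF A] in \<open>simp add: case_prod_unfold\<close>)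
  finally show ?thesis by (simp only: cell_mark)
qed

lemma nn_integral_Seq_markM_interleave:
  assumes u: "u \<in> {0..1}" and f: "f \<in> borel_measurable (Seq (markM p))"
  shows "(\<integral>\<^sup>+z. f z \<partial>Seq (markM p)) = (\<integral>\<^sup>+b. \<integral>\<^sup>+z. \<integral>\<^sup>+w. f (interleave (cell_mark u True) (cell_mark u False) b z w)
    \<partial>Seq (markM p) \<partial>Seq (markM p) \<partial>Seq (measure_pmf (bernoulli_pmf u)))"
  using nn_integral_distr_interleave[OF prob_space_markM measurable_cell_mark[OF u] measurable_cell_mark[OF u] f, of u]
  by (subst distr_interleave_Seq[OF u prob_space_markM prob_space_markM measurable_cell_mark[OF u] measurable_cell_mark[OF u] emeasure_markM_cells[OF u], symmetric])
    simp

text \<open>The conditional form of the fixed point property: given the first cut \<open>u\<close> and the first sign \<open>s\<close>, the recursive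
  cographon has the law of two independent recursive cographons glued at \<open>u\<close> with the value prescribed by \<open>s\<close>.
  The remaining sequence is replaced by an interleaving, and the bits integrate out since almost surely both values occur
  infinitely often.\<close>

lemma nn_integral_rec_glue:
  assumes u: "0 < u" "u < 1" and f: "f \<in> borel_measurable borel"
  shows "(\<integral>\<^sup>+z. f (rec_graphon (case_nat u (points z), case_nat s (signs z))) \<partial>Seq (markM p)) =
    (\<integral>\<^sup>+a. \<integral>\<^sup>+b. f (glue (rec_graphon a) (rec_graphon b) u (s = Minus)) \<partial>rec_space p \<partial>rec_space p)"
proof -
  let ?S = "Seq (markM p)" and ?B = "Seq (measure_pmf (bernoulli_pmf u))"
  let ?rg = "\<lambda>z. rec_graphon (points z, signs z)"
  have uI: "u \<in> {0..1}" using u by simp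
  interpret B: prob_space ?B by (rule prob_space_Seq) (rule prob_space_measure_pmf)
  interpret R: prob_space "rec_space p" by (rule prob_space_rec_space)
  have "(\<lambda>z. case_nat (u, s) z) \<in> ?S \<rightarrow>\<^sub>M ?S"
    by (rule measurable_Seq_case_nat) (use uI in \<open>auto simp: space_pair_measure\<close>)
  from measurable_compose[OF this measurable_compose[OF measurable_unzip measurable_compose[OF measurable_rec_graphon f]]]
  have fm: "(\<lambda>z. f (rec_graphon (case_nat u (points z), case_nat s (signs z)))) \<in> borel_measurable ?S"
    by simp
  have fst01: "fst (z n) \<in> {0..1}" if "z \<in> space ?S" for z n
    using that by (auto simp: space_PiM PiE_iff space_pair_measure mem_Times_iff)
  have "(\<integral>\<^sup>+z. f (rec_graphon (case_nat u (points z), case_nat s (signs z))) \<partial>?S) =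
    (\<integral>\<^sup>+b. \<integral>\<^sup>+z. \<integral>\<^sup>+w. f (glue (?rg z) (?rg w) u (s = Minus)) \<partial>?S \<partial>?S \<partial>?B)"
  proof (subst nn_integral_Seq_markM_interleave[OF uI fm], rule nn_integral_cong_AE)
    have "AE b in ?B. \<forall>n. \<exists>m\<ge>n. b m = True" "AE b in ?B. \<forall>n. \<exists>m\<ge>n. b m = False"
      by (rule AE_Seq_infinitely_often, use u in simp)+
    then show "AE b in ?B. (\<integral>\<^sup>+z. \<integral>\<^sup>+w. f (rec_graphon (case_nat u (points (interleave (cell_mark u True) (cell_mark u False) b z w)),
          case_nat s (signs (interleave (cell_mark u True) (cell_mark u False) b z w)))) \<partial>?S \<partial>?S) =
        (\<integral>\<^sup>+z. \<integral>\<^sup>+w. f (glue (?rg z) (?rg w) u (s = Minus)) \<partial>?S \<partial>?S)"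
    proof eventually_elim
      fix b :: "nat \<Rightarrow> bool" assume b: "\<forall>n. \<exists>m\<ge>n. b m = True" "\<forall>n. \<exists>m\<ge>n. b m = False"
      show "(\<integral>\<^sup>+z. \<integral>\<^sup>+w. f (rec_graphon (case_nat u (points (interleave (cell_mark u True) (cell_mark u False) b z w)),
          case_nat s (signs (interleave (cell_mark u True) (cell_mark u False) b z w)))) \<partial>?S \<partial>?S) =
        (\<integral>\<^sup>+z. \<integral>\<^sup>+w. f (glue (?rg z) (?rg w) u (s = Minus)) \<partial>?S \<partial>?S)"
      proof (intro nn_integral_cong arg_cong[where f = f])
        fix z w assume zw: "z \<in> space ?S" "w \<in> space ?S"
        have gf: "graphon_fun (glue_fun (rec_fun (points z) (signs z)) (rec_fun (points w) (signs w)) u (of_bool (s = Minus)))"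
          by (intro graphon_fun_glue_fun graphon_fun_rec_fun uI) simp
        show "rec_graphon (case_nat u (points (interleave (cell_mark u True) (cell_mark u False) b z w)),
           case_nat s (signs (interleave (cell_mark u True) (cell_mark u False) b z w))) = glue (?rg z) (?rg w) u (s = Minus)"
          unfolding rec_graphon_def prod.case glue_abs_graphon[OF uI graphon_fun_rec_fun graphon_fun_rec_fun]
        proof (rule abs_graphon_eq_cofinite[OF graphon_fun_rec_fun gf, of "{u}"])
          fix x y assume xy: "x \<in> {0..1} - {u}" "y \<in> {0..1} - {u}"
          show "rec_fun (case_nat u (points (interleave (cell_mark u True) (cell_mark u False) b z w)))
             (case_nat s (signs (interleave (cell_mark u True) (cell_mark u False) b z w))) x y =
            glue_fun (rec_fun (points z) (signs z)) (rec_fun (points w) (signs w)) u (of_bool (s = Minus)) x y"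
            by (rule rec_fun_interleave[OF u _ _ fst01[OF zw(1)] fst01[OF zw(2)] xy]) (use b in auto)
        qed simp
      qed
    qed
  qed
  also have "\<dots> = (\<integral>\<^sup>+z. \<integral>\<^sup>+w. f (glue (?rg z) (?rg w) u (s = Minus)) \<partial>?S \<partial>?S)"
    by (simp add: B.emeasure_space_1)
  also have "\<dots> = (\<integral>\<^sup>+a. \<integral>\<^sup>+b. f (glue (rec_graphon a) (rec_graphon b) u (s = Minus)) \<partial>rec_space p \<partial>rec_space p)"
  proof -
    have gm: "(\<lambda>x. f (glue (rec_graphon (g x)) (rec_graphon (h x)) u (s = Minus))) \<in> borel_measurable L"
      if "g \<in> L \<rightarrow>\<^sub>M rec_space p" "h \<in> L \<rightarrow>\<^sub>M rec_space p" for g h L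
      by (rule measurable_compose[OF measurable_glue f])
        (use uI measurable_compose[OF that(1) measurable_rec_graphon] measurable_compose[OF that(2) measurable_rec_graphon] in auto)
    have "(\<lambda>a. \<integral>\<^sup>+b. f (glue (rec_graphon a) (rec_graphon b) u (s = Minus)) \<partial>rec_space p) \<in> borel_measurable (rec_space p)"
      by (rule R.borel_measurable_nn_integral) (use gm[OF measurable_fst measurable_snd] in \<open>simp add: case_prod_unfold\<close>)
    then have "(\<integral>\<^sup>+a. \<integral>\<^sup>+b. f (glue (rec_graphon a) (rec_graphon b) u (s = Minus)) \<partial>rec_space p \<partial>rec_space p) =
      (\<integral>\<^sup>+z. \<integral>\<^sup>+b. f (glue (?rg z) (rec_graphon b) u (s = Minus)) \<partial>rec_space p \<partial>?S)"
      by (rule nn_integral_rec_space)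
    also have "\<dots> = (\<integral>\<^sup>+z. \<integral>\<^sup>+w. f (glue (?rg z) (?rg w) u (s = Minus)) \<partial>?S \<partial>?S)"
    proof (intro nn_integral_cong nn_integral_rec_space)
      fix z assume "z \<in> space ?S"
      then have "(points z, signs z) \<in> space (rec_space p)" by (rule measurable_space[OF measurable_unzip])
      then show "(\<lambda>b. f (glue (?rg z) (rec_graphon b) u (s = Minus))) \<in> borel_measurable (rec_space p)"
        by (intro gm measurable_const) auto
    qed
    finally show ?thesis by simp
  qed
  finally show ?thesis .
qed

lemma nn_integral_sign_pmf:
  assumes "0 \<le> p" "p \<le> 1"
  shows "(\<integral>\<^sup>+s. f s \<partial>sign_pmf p) = f Plus * ennreal p + f Minus * ennreal (1 - p)"
  unfolding sign_pmf_def nn_integral_map_pmf using assms by (subst nn_integral_bernoulli_pmf) auto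

text \<open>Integrate the conditional identity over the first cut and the first sign. The value \<open>1\<close> between the cells has
  probability \<open>1 - p\<close> and corresponds to the sign \<open>Minus\<close>.\<close>

theorem distr_rec_graphon_fixed:
  assumes p: "0 \<le> p" "p \<le> 1"
  shows "distr (glue_space p (rec_space p)) borel (glued rec_graphon) = distr (rec_space p) borel rec_graphon"
proof (rule measure_eqI)
  fix A assume "A \<in> sets (distr (glue_space p (rec_space p)) borel (glued rec_graphon))"
  then have A: "A \<in> sets borel" by simp
  define f :: "graphon \<Rightarrow> ennreal" where "f = indicator A"
  have f: "f \<in> borel_measurable borel" unfolding f_def by (rule indicator_ennreal[OF A])
  let ?G = "glue_space p (rec_space p)"
  note g = measurable_glued[OF measurable_rec_graphon, of p p]
  define h where "h u s = (\<integral>\<^sup>+z. f (rec_graphon (case_nat u (points z), case_nat s (signs z))) \<partial>Seq (markM p))" for u s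
  interpret S: prob_space "Seq (markM p)" by (rule prob_space_Seq) (rule prob_space_markM)
  have rm: "(\<lambda>z. f (rec_graphon (points z, signs z))) \<in> borel_measurable (Seq (markM p))"
    by (rule measurable_compose[OF measurable_unzip measurable_compose[OF measurable_rec_graphon f]])
  have hm: "(\<lambda>v. h (fst v) (snd v)) \<in> borel_measurable (markM p)"
    unfolding h_def by (rule S.borel_measurable_nn_integral)
      (use measurable_compose[OF measurable_Seq_case_nat[OF measurable_fst measurable_snd] rm] in \<open>simp add: case_prod_unfold\<close>)
  have "emeasure (distr ?G borel (glued rec_graphon)) A = (\<integral>\<^sup>+W. f W \<partial>distr ?G borel (glued rec_graphon))"
    using A by (simp add: f_def)
  also have "\<dots> = (\<integral>\<^sup>+\<omega>. f (glued rec_graphon \<omega>) \<partial>?G)"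
    by (rule nn_integral_distr[OF g]) (simp add: f)
  also have "\<dots> = (\<integral>\<^sup>+u. \<integral>\<^sup>+s. \<integral>\<^sup>+a. \<integral>\<^sup>+b. f (glue (rec_graphon a) (rec_graphon b) u s) \<partial>rec_space p \<partial>rec_space p \<partial>bernoulli_pmf (1 - p) \<partial>unitM)"
    by (subst nn_integral_glue_space[OF prob_space_rec_space measurable_compose[OF g f]]) (simp add: glued_def)
  also have "\<dots> = (\<integral>\<^sup>+u. \<integral>\<^sup>+s. h u s \<partial>sign_pmf p \<partial>unitM)"
  proof (rule nn_integral_cong_AE)
    \<comment> \<open>At \<open>u = 0\<close> or \<open>u = 1\<close> one of the two sequences would never be used.\<close>
    have "AE u in unitM. u \<notin> {0, 1}" by (rule AE_unitM_finite) simp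
    then show "AE u in unitM. (\<integral>\<^sup>+s. \<integral>\<^sup>+a. \<integral>\<^sup>+b. f (glue (rec_graphon a) (rec_graphon b) u s) \<partial>rec_space p \<partial>rec_space p \<partial>bernoulli_pmf (1 - p)) =
       (\<integral>\<^sup>+s. h u s \<partial>sign_pmf p)"
      using AE_space
    proof eventually_elim
      fix u assume "u \<notin> {0, 1}" "u \<in> space unitM"
      then have u: "0 < u" "u < 1" by auto
      show "(\<integral>\<^sup>+s. \<integral>\<^sup>+a. \<integral>\<^sup>+b. f (glue (rec_graphon a) (rec_graphon b) u s) \<partial>rec_space p \<partial>rec_space p \<partial>bernoulli_pmf (1 - p)) =
       (\<integral>\<^sup>+s. h u s \<partial>sign_pmf p)"
        unfolding nn_integral_sign_pmf[OF p] h_def nn_integral_rec_glue[OF u f]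
        using p by (subst nn_integral_bernoulli_pmf) (auto simp: add.commute)
    qed
  qed
  also have "\<dots> = (\<integral>\<^sup>+v. h (fst v) (snd v) \<partial>markM p)"
    using nn_integral_markM[OF hm] by simp
  also have "\<dots> = (\<integral>\<^sup>+z. f (rec_graphon (points z, signs z)) \<partial>Seq (markM p))"
    by (simp add: nn_integral_Seq[OF prob_space_markM rm] h_def)
  also have "\<dots> = (\<integral>\<^sup>+\<omega>. f (rec_graphon \<omega>) \<partial>rec_space p)"
    by (rule nn_integral_rec_space[symmetric, OF measurable_compose[OF measurable_rec_graphon f]])
  also have "\<dots> = (\<integral>\<^sup>+W. f W \<partial>distr (rec_space p) borel rec_graphon)"
    by (rule nn_integral_distr[symmetric, OF measurable_rec_graphon]) (simp add: f)
  also have "\<dots> = emeasure (distr (rec_space p) borel rec_graphon) A" using A by (simp add: f_def)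
  finally show "emeasure (distr ?G borel (glued rec_graphon)) A = emeasure (distr (rec_space p) borel rec_graphon) A" .
qed simp

theorem proposition1p13:
  fixes p :: real
  assumes "0 \<le> p" "p \<le> 1"
  shows "random_graphon (rec_space p) rec_graphon \<and>
    random_graphon (glue_space p (rec_space p)) (glued rec_graphon) \<and>
    distr (glue_space p (rec_space p)) borel (glued rec_graphon) =
      distr (rec_space p) borel rec_graphon \<and>
    (\<forall>(M :: 'a measure) V. random_graphon M V \<longrightarrow>
      random_graphon (glue_space p M) (glued V) \<and>
      (distr (glue_space p M) borel (glued V) = distr M borel V \<longrightarrow>
        distr M borel V = distr (rec_space p) borel rec_graphon))"
proof (intro conjI allI impI)
  show "random_graphon (rec_space p) rec_graphon"
    by (simp add: random_graphon_def prob_space_rec_space measurable_rec_graphon)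
  show "random_graphon (glue_space p (rec_space p)) (glued rec_graphon)"
    by (simp add: random_graphon_def prob_space_glue_space prob_space_rec_space measurable_glued measurable_rec_graphon)
  show fixed: "distr (glue_space p (rec_space p)) borel (glued rec_graphon) = distr (rec_space p) borel rec_graphon"
    by (rule distr_rec_graphon_fixed[OF assms])
  fix M :: "'a measure" and V assume V: "random_graphon M V"
  then have M: "prob_space M" and Vm: "V \<in> borel_measurable M" by (simp_all add: random_graphon_def)
  show "random_graphon (glue_space p M) (glued V)"
    by (simp add: random_graphon_def prob_space_glue_space[OF M] measurable_glued[OF Vm])
  assume "distr (glue_space p M) borel (glued V) = distr M borel V"
  then have "glue_law p (distr M borel V) = distr M borel V"
    by (simp only: distr_glued[OF M Vm])
  moreover have "glue_law p (distr (rec_space p) borel rec_graphon) = distr (rec_space p) borel rec_graphon"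
    using fixed by (simp only: distr_glued[OF prob_space_rec_space measurable_rec_graphon])
  ultimately show "distr M borel V = distr (rec_space p) borel rec_graphon"
    by (rule glue_law_fixed_point_unique[OF prob_space.prob_space_distr[OF M Vm] sets_distr _
        prob_space.prob_space_distr[OF prob_space_rec_space measurable_rec_graphon] sets_distr])
qed

end
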